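(* Let $n=2m\ge 4$ be even, $0<\alpha,\beta,\gamma,\delta<1$, $\lambda=\alpha-\beta$, $\mu=\gamma-\delta$, and let $p$ be the unique probability vector with $Up=p$, where $U$ is the Markov matrix of the boundary driven rule-54 cellular automaton defined in the context. Let $T$, $l$, $r$, $D_{\rm e}$, $D_{\rm o}$, $\tau_1,\tau_2,\tau_3$ be as in the context. Write $\rho_j=\sum_{\underline s\in\{0,1\}^n}s_j\,p_{\underline s}$, $\tilde C_{j,j'}=\sum_{\underline s\in\{0,1\}^n}s_js_{j'}\,p_{\underline s}$ and $C_{j,j'}=\tilde C_{j,j'}-\rho_j\rho_{j'}$ for the steady state density, the two-point density-density correlation function and the connected two-point correlation function. (a) For even sites $2k,2k'$ with $1\le k<k'\le m-1$, $$\tilde C_{2k,2k'}=\frac{(D_{\rm e}l)\cdot T^{\,k'-k}D_{\rm e}\,r}{l\cdot T^{\,k'-k}\,r},$$ and similarly for the other pairs of bulk sites $1<j<j'<n$ (even-odd, odd-even, odd-odd), where $k=\lfloor j/2\rfloor$, $k'=\lfloor j'/2\rfloor$ and the first (respectively second) factor $D_{\rm e}$ is replaced by $D_{\rm o}$ if the first (respectively second) site is odd. (b) With the eigenvalue decomposition $T=\sum_{\nu=1}^3\tau_\nu\,\psi_\nu\otimes\phi_\nu$, where $\phi_1=l/\sqrt{l\cdot r}$, $\psi_1=r/\sqrt{l\cdot r}$ and $\phi_\nu\cdot\psi_{\nu'}=\delta_{\nu,\nu'}$, one has for $1\le k<k'\le m-1$ $$C_{2k,2k'}=\frac{(D_{\rm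 e}l\cdot\psi_2)(\phi_2\cdot D_{\rm e}r)}{l\cdot r}\Bigl(\frac{\tau_2}{\tau_1}\Bigr)^{k'-k}+\frac{(D_{\rm e}l\cdot\psi_3)(\phi_3\cdot D_{\rm e}r)}{l\cdot r}\Bigl(\frac{\tau_3}{\tau_1}\Bigr)^{k'-k}.$$ (c) Consequently, in the bulk $1<j,j'<n$, the connected two-point correlation function $C_{j,j'}$ is only a function of the difference of the positions $j,j'$; it decays exponentially, $\sim\exp(-|j-j'|/\ell)$, with correlation scale $\ell=1/\log|\tau_1/\tau_2|$; and it depends only on the difference driving parameters $\lambda,\mu$ and not on $\alpha,\beta,\gamma,\delta$ separately.
   Context: Model. Let $\mathbb{Z}_2=\{0,1\}$ and $\chi(w,c,e)= c+w+e+we \pmod 2$ for $w,c,e\in\mathbb{Z}_2$ (the middle argument is the cell being updated). Vectors $p\in\mathbb{R}^{2^n}=(\mathbb{R}^2)^{\otimes n}$ have components $p_{s_1,\dots,s_n}$ indexed by configurations in $\mathbb{Z}_2^n$; matrices act on column vectors (first index = row = final configuration, second index = column = initial configuration). Bulk: $P$ is the $8\times 8$ permutation matrix $P_{(s,s',s''),(t,t',t'')}=\delta_{s,t}\,\delta_{s',\chi(t,t',t'')}\,\delta_{s'',t''}$. Boundaries: $E^{\alpha,\beta}=\begin{pmatrix}1-\alpha&\beta\\ \alpha&1-\beta\end{pmatrix}$, $\tilde P^{\rm L}_{(s',s''),(t',t'')}=\frac12\sum_{s=0}^1 P_{(s,s',s''),(s,t',t'')}$, $\tilde P^{\rm R}_{(s,s'),(t,t')}=\frac12\sum_{s''=0}^1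 P_{(s,s',s''),(t,t',s'')}$, $P^{\rm L}=\tilde P^{\rm L}(E^{\alpha,\beta}\otimes \mathbb{1}_2)$, $P^{\rm R}=\tilde P^{\rm R}(\mathbb{1}_2\otimes E^{\gamma,\delta})$. Propagator: with $P_{k,k+1,k+2}=\mathbb{1}_{2^{k-1}}\otimes P\otimes \mathbb{1}_{2^{n-k-2}}$, $P^{\rm L}_{12}=P^{\rm L}\otimes \mathbb{1}_{2^{n-2}}$, $P^{\rm R}_{n-1,n}=\mathbb{1}_{2^{n-2}}\otimes P^{\rm R}$, put $U_{\rm e}=P_{123}P_{345}\cdots P_{n-3,n-2,n-1}P^{\rm R}_{n-1,n}$, $U_{\rm o}=P_{n-2,n-1,n}\cdots P_{456}P_{234}P^{\rm L}_{12}$, $U=U_{\rm o}U_{\rm e}$. For $0<\alpha,\beta,\gamma,\delta<1$ the matrix $U$ is irreducible and aperiodic, so the fixed probability vector $p$ exists and is unique. Transfer matrix. Put $A=\lambda\mu+\lambda-2$, $B=\lambda\mu+\mu-2$, $\omega=-\frac{(\mu+2)A}{B^2}$, $\xi=-\frac{(\lambda+2)B}{A^2}$, $$T=\begin{pmatrix}1&1&1&1\\ \xi\omega&\xi\omega&1/\xi&\omega\\ \xi\omega&\xi\omega&\xi\omega&\xi\omega\\ \xi&\xi&1&\xi\omega\end{pmatrix},\quad D_{\rm e}=\mathrm{diag}(0,0,1,1),\quad D_{\rm o}=\mathrm{diag}(0,1,0,1).$$ The boundary vectors (components labelled by $2s+s'$, $s,s'\in\{0,1\}$) are $$l=\Bigl(2,\;2,\;-\tfrac{2A}{\lambda+2},\;\tfrac{2A}{B}\Bigr),\qquad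 r=\Bigl(2,\;-\tfrac{2(\mu+2)}{B},\;\tfrac{2(\lambda+2)(\mu+2)}{AB},\;-\tfrac{2(\lambda+2)}{A}\Bigr),$$ and $u\cdot v$ is the standard (bilinear) scalar product. They satisfy $lT=\tau_1 l$ and $Tr=\tau_1 r$. Eigenvalues. $T$ is singular with, in general, three nonvanishing eigenvalues: it is diagonalizable as $T=V\,\mathrm{diag}(\tau_1,\tau_2,\tau_3,0)\,V^{-1}$ with $$\tau_1=\frac{(\lambda\mu-4)^2}{AB},\qquad \tau_{2,3}=\frac{\lambda\mu(\lambda+\mu+8)+4(\lambda+\mu)\pm(\lambda-\mu)\sqrt{\Delta}}{2AB},\qquad \Delta=\lambda\mu(\lambda\mu-12)-8(\lambda+\mu),$$ and $\tau_1>|\tau_{2,3}|$ for $\lambda,\mu\in(-1,1)$.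
   Formalization: In (c), C may also depend on the left site's parity at odd distances; decay is exp(-|j-j'|/(2ℓ)) (bounded by a constant multiple, not smaller order), with the larger of |τ2|,|τ3| in ℓ; the decay claim excludes λ=μ=0 and Δ=0 with λ≠μ. *)

theory Defs
  imports
    "HOL-Analysis.Analysis"
    "HOL-Library.Z2"
    "HOL-Library.Landau_Symbols"
begin

instance bit :: finite
proof
  have "(UNIV :: bit set) \<subseteq> {0, 1}"
    by auto
  then show "finite (UNIV :: bit set)"
    by (rule finite_subset) simp
qed

section \<open>The Markov matrix of the boundary driven rule 54 automaton\<close>

definition rule54 :: "bit \<Rightarrow> bit \<Rightarrow> bit \<Rightarrow> bit" where
  "rule54 w c e = c + w + e + w * e"

text \<open>
  A square matrix is a function of its row index (final configuration) and its column index
  (initial configuration). One-, two- and three-site matrices are indexed by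
  \<open>bit\<close>, \<open>bit \<times> bit\<close> and \<open>bit \<times> bit \<times> bit\<close>.
\<close>

type_synonym 'c mat = "'c \<Rightarrow> 'c \<Rightarrow> real"

definition loc_mult :: "('c::finite) mat \<Rightarrow> 'c mat \<Rightarrow> 'c mat" where
  "loc_mult M N = (\<lambda>s t. \<Sum>u\<in>UNIV. M s u * N u t)"

definition one1 :: "bit mat" where
  "one1 s t = of_bool (s = t)"

definition tensor :: "bit mat \<Rightarrow> bit mat \<Rightarrow> (bit \<times> bit) mat" where
  "tensor M N = (\<lambda>(s, s') (t, t'). M s t * N s' t')"

definition bulkP :: "(bit \<times> bit \<times> bit) mat" where
  "bulkP = (\<lambda>(s, s', s'') (t, t', t'').
     of_bool (s = t) * of_bool (s' = rule54 t t' t'') * of_bool (s'' = t''))"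

definition flipE :: "real \<Rightarrow> real \<Rightarrow> bit mat" where
  "flipE \<alpha> \<beta> s t =
     (if t = 0 then (if s = 0 then 1 - \<alpha> else \<alpha>) else (if s = 0 then \<beta> else 1 - \<beta>))"

definition leftP0 :: "(bit \<times> bit) mat" where
  "leftP0 = (\<lambda>(s', s'') (t', t''). 1/2 * (\<Sum>s\<in>UNIV. bulkP (s, s', s'') (s, t', t'')))"

definition rightP0 :: "(bit \<times> bit) mat" where
  "rightP0 = (\<lambda>(s, s') (t, t'). 1/2 * (\<Sum>s''\<in>UNIV. bulkP (s, s', s'') (t, t', s'')))"

definition leftP :: "real \<Rightarrow> real \<Rightarrow> (bit \<times> bit) mat" where
  "leftP \<alpha> \<beta> = loc_mult leftP0 (tensor (flipE \<alpha> \<beta>) one1)"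

definition rightP :: "real \<Rightarrow> real \<Rightarrow> (bit \<times> bit) mat" where
  "rightP \<gamma> \<delta> = loc_mult rightP0 (tensor one1 (flipE \<gamma> \<delta>))"

text \<open>
  Configurations of a chain of \<open>n\<close> sites, numbered from 1. Vectors of dimension \<open>2 ^ n\<close> and
  \<open>2 ^ n \<times> 2 ^ n\<close> matrices are functions of configurations; their values outside
  \<open>config n\<close> are irrelevant.
\<close>

type_synonym conf = "nat \<Rightarrow> bit"

definition config :: "nat \<Rightarrow> conf set" where
  "config n = ({1..n} \<rightarrow>\<^sub>E UNIV)"

definition mmult :: "nat \<Rightarrow> conf mat \<Rightarrow> conf mat \<Rightarrow> conf mat" where
  "mmult n M N = (\<lambda>s t. \<Sum>u\<in>config n. M s u * N u t)"

definition mone :: "conf mat" where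
  "mone s t = of_bool (s = t)"

definition mprod :: "nat \<Rightarrow> conf mat list \<Rightarrow> conf mat" where
  "mprod n Ms = foldr (mmult n) Ms mone"

text \<open>
  \<open>embed3 n k M\<close> is \<open>M\<close> acting on sites \<open>k, k + 1, k + 2\<close>, tensored with identities on all
  other sites; \<open>embed2\<close> is the two-site analogue.
\<close>

definition embed3 :: "nat \<Rightarrow> nat \<Rightarrow> (bit \<times> bit \<times> bit) mat \<Rightarrow> conf mat" where
  "embed3 n k M s t =
     M (s k, s (k + 1), s (k + 2)) (t k, t (k + 1), t (k + 2)) *
     (\<Prod>i\<in>{1..n} - {k, k + 1, k + 2}. one1 (s i) (t i))"

definition embed2 :: "nat \<Rightarrow> nat \<Rightarrow> (bit \<times> bit) mat \<Rightarrow> conf mat" where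
  "embed2 n k M s t =
     M (s k, s (k + 1)) (t k, t (k + 1)) *
     (\<Prod>i\<in>{1..n} - {k, k + 1}. one1 (s i) (t i))"

text \<open>
  The chain has \<open>n = 2 * m\<close> sites. The lists are in the order of the matrix product, so the
  last factor acts first: \<open>Ue = P\<^sub>1\<^sub>2\<^sub>3 \<dots> P\<^sub>n\<^sub>-\<^sub>3\<^sub>,\<^sub>n\<^sub>-\<^sub>2\<^sub>,\<^sub>n\<^sub>-\<^sub>1 P\<^sup>R\<close> and \<open>Uo = P\<^sub>n\<^sub>-\<^sub>2\<^sub>,\<^sub>n\<^sub>-\<^sub>1\<^sub>,\<^sub>n \<dots> P\<^sub>2\<^sub>3\<^sub>4 P\<^sup>L\<close>.
\<close>

definition Ue :: "nat \<Rightarrow> real \<Rightarrow> real \<Rightarrow> conf mat" where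
  "Ue m \<gamma> \<delta> = mprod (2 * m)
     (map (\<lambda>i. embed3 (2 * m) (2 * i - 1) bulkP) [1..<m] @
      [embed2 (2 * m) (2 * m - 1) (rightP \<gamma> \<delta>)])"

definition Uo :: "nat \<Rightarrow> real \<Rightarrow> real \<Rightarrow> conf mat" where
  "Uo m \<alpha> \<beta> = mprod (2 * m)
     (map (\<lambda>i. embed3 (2 * m) (2 * i) bulkP) (rev [1..<m]) @
      [embed2 (2 * m) 1 (leftP \<alpha> \<beta>)])"

definition U :: "nat \<Rightarrow> real \<Rightarrow> real \<Rightarrow> real \<Rightarrow> real \<Rightarrow> conf mat" where
  "U m \<alpha> \<beta> \<gamma> \<delta> = mmult (2 * m) (Uo m \<alpha> \<beta>) (Ue m \<gamma> \<delta>)"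

definition steady_state ::
    "nat \<Rightarrow> real \<Rightarrow> real \<Rightarrow> real \<Rightarrow> real \<Rightarrow> (conf \<Rightarrow> real) \<Rightarrow> bool" where
  "steady_state m \<alpha> \<beta> \<gamma> \<delta> p \<longleftrightarrow>
     (\<forall>s\<in>config (2 * m). 0 \<le> p s) \<and>
     (\<Sum>s\<in>config (2 * m). p s) = 1 \<and>
     (\<forall>s\<in>config (2 * m). (\<Sum>t\<in>config (2 * m). U m \<alpha> \<beta> \<gamma> \<delta> s t * p t) = p s)"

section \<open>Density and correlation functions\<close>

definition density :: "nat \<Rightarrow> (conf \<Rightarrow> real) \<Rightarrow> nat \<Rightarrow> real" where
  "density n p j = (\<Sum>s\<in>config n. of_bit (s j) * p s)"

definition corr2 :: "nat \<Rightarrow> (conf \<Rightarrow> real) \<Rightarrow> nat \<Rightarrow> nat \<Rightarrow> real" where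
  "corr2 n p j j' = (\<Sum>s\<in>config n. of_bit (s j) * of_bit (s j') * p s)"

definition conn_corr :: "nat \<Rightarrow> (conf \<Rightarrow> real) \<Rightarrow> nat \<Rightarrow> nat \<Rightarrow> real" where
  "conn_corr n p j j' = corr2 n p j j' - density n p j * density n p j'"

section \<open>The transfer matrix\<close>

definition Apar :: "real \<Rightarrow> real \<Rightarrow> real" where
  "Apar lam mu = lam * mu + lam - 2"

definition Bpar :: "real \<Rightarrow> real \<Rightarrow> real" where
  "Bpar lam mu = lam * mu + mu - 2"

definition omega :: "real \<Rightarrow> real \<Rightarrow> real" where
  "omega lam mu = - ((mu + 2) * Apar lam mu / (Bpar lam mu)^2)"

definition xi :: "real \<Rightarrow> real \<Rightarrow> real" where
  "xi lam mu = - ((lam + 2) * Bpar lam mu / (Apar lam mu)^2)"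

text \<open>
  The component labelled \<open>2 * s + s'\<close> (from 0 to 3) is component \<open>2 * s + s' + 1\<close> of a vector
  in \<open>real ^ 4\<close>.
\<close>

definition Tmat :: "real \<Rightarrow> real \<Rightarrow> real^4^4" where
  "Tmat lam mu = (let x = xi lam mu; w = omega lam mu in
     vector [vector [1, 1, 1, 1],
             vector [x * w, x * w, 1 / x, w],
             vector [x * w, x * w, x * w, x * w],
             vector [x, x, 1, x * w]])"

definition diag4 :: "real^4 \<Rightarrow> real^4^4" where
  "diag4 d = (\<chi> i j. if i = j then d $ i else 0)"

definition De :: "real^4^4" where
  "De = diag4 (vector [0, 0, 1, 1])"

definition Do :: "real^4^4" where
  "Do = diag4 (vector [0, 1, 0, 1])"

definition Dsite :: "nat \<Rightarrow> real^4^4" where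
  "Dsite j = (if even j then De else Do)"

primrec matpow :: "real^4^4 \<Rightarrow> nat \<Rightarrow> real^4^4" where
  "matpow M 0 = mat 1"
| "matpow M (Suc d) = M ** matpow M d"

definition lvec :: "real \<Rightarrow> real \<Rightarrow> real^4" where
  "lvec lam mu = (let A = Apar lam mu; B = Bpar lam mu in
     vector [2, 2, - (2 * A / (lam + 2)), 2 * A / B])"

definition rvec :: "real \<Rightarrow> real \<Rightarrow> real^4" where
  "rvec lam mu = (let A = Apar lam mu; B = Bpar lam mu in
     vector [2, - (2 * (mu + 2) / B), 2 * (lam + 2) * (mu + 2) / (A * B),
             - (2 * (lam + 2) / A)])"

section \<open>Eigenvalues\<close>

definition discr :: "real \<Rightarrow> real \<Rightarrow> real" where
  "discr lam mu = lam * mu * (lam * mu - 12) - 8 * (lam + mu)"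

definition tau1 :: "real \<Rightarrow> real \<Rightarrow> real" where
  "tau1 lam mu = (lam * mu - 4)^2 / (Apar lam mu * Bpar lam mu)"

text \<open>
  \<open>discr\<close> may be negative, hence the complex square root. \<open>tau_pm\<close> takes the sign in front of
  the square root as first argument.
\<close>

definition tau_pm :: "complex \<Rightarrow> real \<Rightarrow> real \<Rightarrow> complex" where
  "tau_pm \<sigma> lam mu =
     (of_real (lam * mu * (lam + mu + 8) + 4 * (lam + mu)) +
      \<sigma> * of_real (lam - mu) * csqrt (of_real (discr lam mu))) /
     of_real (2 * Apar lam mu * Bpar lam mu)"

definition tau :: "real \<Rightarrow> real \<Rightarrow> nat \<Rightarrow> complex" where
  "tau lam mu \<nu> = (if \<nu> = 1 then of_real (tau1 lam mu)
                   else if \<nu> = 2 then tau_pm 1 lam mu else tau_pm (- 1) lam mu)"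

text \<open>The scalar product is bilinear, not sesquilinear, also for complex vectors.\<close>

definition bdot :: "complex^4 \<Rightarrow> complex^4 \<Rightarrow> complex" where
  "bdot u v = (\<Sum>i\<in>UNIV. u $ i * v $ i)"

definition cvec :: "real^4 \<Rightarrow> complex^4" where
  "cvec v = (\<chi> i. of_real (v $ i))"

definition eigen_decomposition ::
    "real \<Rightarrow> real \<Rightarrow> (nat \<Rightarrow> complex^4) \<Rightarrow> (nat \<Rightarrow> complex^4) \<Rightarrow> bool" where
  "eigen_decomposition lam mu \<phi> \<psi> \<longleftrightarrow>
     \<phi> 1 = cvec ((1 / sqrt (lvec lam mu \<bullet> rvec lam mu)) *\<^sub>R lvec lam mu) \<and>
     \<psi> 1 = cvec ((1 / sqrt (lvec lam mu \<bullet> rvec lam mu)) *\<^sub>R rvec lam mu) \<and>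
     (\<forall>\<nu>\<in>{1..3}. \<forall>\<nu>'\<in>{1..3}. bdot (\<phi> \<nu>) (\<psi> \<nu>') = of_bool (\<nu> = \<nu>')) \<and>
     (\<forall>i j. of_real (Tmat lam mu $ i $ j) = (\<Sum>\<nu>=1..3. tau lam mu \<nu> * \<psi> \<nu> $ i * \<phi> \<nu> $ j))"

text \<open>
  Either of the two subleading eigenvalues can have the larger modulus (exchanging
  \<open>lam\<close> and \<open>mu\<close> swaps them). The correlation scale refers to the dominant one of them, and is measured in unit
  cells of two sites, because one factor of the transfer matrix advances by two sites.
\<close>

definition tau_sub :: "real \<Rightarrow> real \<Rightarrow> complex" where
  "tau_sub lam mu =
     (if cmod (tau lam mu 3) \<le> cmod (tau lam mu 2) then tau lam mu 2 else tau lam mu 3)"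

definition corr_scale :: "real \<Rightarrow> real \<Rightarrow> real" where
  "corr_scale lam mu = 1 / ln (cmod (tau lam mu 1 / tau_sub lam mu))"

text \<open>
  Excluded are \<open>lam = mu = 0\<close>, where both subleading eigenvalues vanish and the correlation scale
  is undefined, and the curve \<open>discr = 0\<close>, \<open>lam \<noteq> mu\<close>, on which the subleading
  eigenvalues coalesce and the transfer matrix is not diagonalizable.
\<close>

definition generic_driving :: "real \<Rightarrow> real \<Rightarrow> bool" where
  "generic_driving lam mu \<longleftrightarrow>
     (lam \<noteq> 0 \<or> mu \<noteq> 0) \<and> (discr lam mu \<noteq> 0 \<or> lam = mu)"

end

(*
  The stationary vector is a product of overlapping 4-site patches, whose entries are those of
  the transfer matrix, with a 3-site weight at either end. One half-step of the dynamics maps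
  each patch to its mirror image with xi and omega exchanged, up to a gauge factor that
  telescopes along the chain and is absorbed by the boundary weights. Hence a stationary
  expectation value is a matrix product, in which the eigenvectors l and r collapse everything
  outside the two observed sites.

  The steady state is unique because every configuration can be driven to the vacuum: if site n
  copies its neighbour and site 1 is kept at 0, then along successive light rays the pairs of
  adjacent ones are eliminated one by one, after which the remaining ones drift out of the chain.

  For the decay, T acts on the part of its range orthogonal to l as a 2 x 2 matrix with
  eigenvalues tau_2 and tau_3, so a connected correlation c_k obeys a two-term recurrence. The
  Hankel determinant c_0 c_2 - c_1^2 is an explicit product, which vanishes only where lam = mu
  or where one of the two eigenvalues is 0; outside these cases both eigenvalues contribute.
*)

theory Submission
  imports Defs
begin

text \<open>The rates enter only through the two boundary weights. Summing out an end site turns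
  these into \<open>l\<close> and \<open>r\<close>, where only the differences \<open>lam\<close>
  and \<open>mu\<close> survive, so the parameter dependence claimed in (c) is a by-product of the
  computation.

  The product vector is never shown to be positive: uniqueness is proved in the form that a
  stationary vector with nonzero sum, of whatever signs, is a multiple of the steady state.

  The obstacle in the decay statement is that tau_2 and tau_3 may form a conjugate pair. Rescaled
  correlations then oscillate and need not have a limit, so exact exponential order is expressed as
  membership in O together with failure of o. Eigenvectors are avoided here: trace and determinant
  of the 2 x 2 block carry the information, except for lam = mu, where the block is scalar and is
  treated separately.

  That even-even and odd-odd correlations agree at equal distance is obtained by comparing the first
  terms of two sequences that obey the same recurrence.\<close>

lemma UNIV_bit: "(UNIV :: bit set) = {0, 1}"
  by (auto intro: bit.exhaust)

lemma sum_bit: "(\<Sum>b\<in>UNIV. f (b :: bit)) = f 0 + f 1"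
  by (simp add: UNIV_bit)

lemma rule54_if: "rule54 w c e = (if w = 0 \<and> e = 0 then c else c + 1)"
  by (cases w; cases e) (simp_all add: rule54_def)

lemma rule54_involutive: "rule54 w (rule54 w c e) e = c"
  by (cases w; cases c; cases e) (simp_all add: rule54_def)

lemma sum_bit_pair:
  "(\<Sum>u\<in>UNIV. f (u :: bit \<times> bit)) = f (0, 0) + f (0, 1) + f (1, 0) + f (1, 1)"
proof -
  have "sum f (UNIV \<times> UNIV) = sum f {(0, 0), (0, 1), (1, 0), (1, 1)}"
    by (simp only: UNIV_bit) (rule sum.cong; auto)
  then show ?thesis by (simp add: add.assoc)
qed

section \<open>Patches and boundary weights\<close>

definition patch :: "real \<Rightarrow> real \<Rightarrow> bit \<Rightarrow> bit \<Rightarrow> bit \<Rightarrow> bit \<Rightarrow> real" where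
  "patch x w a b c d =
     (if a = 0 then
        (if b = 0 then 1 else if c = 0 then x * w else if d = 0 then 1 / x else w)
      else
        (if b = 0 then x * w else if c = 0 then x else if d = 0 then 1 else x * w))"

text \<open>
  \<open>gaugeE\<close> and \<open>gaugeO\<close> solve \<open>patch_even\<close> and \<open>patch_odd\<close>, which determine them up to a constant
  factor.
\<close>

definition gaugeE :: "real \<Rightarrow> real \<Rightarrow> bit \<Rightarrow> bit \<Rightarrow> bit \<Rightarrow> real" where
  "gaugeE x w a b c =
     (if b = 1 \<and> c = 1 then 1 / w
      else if a = b \<and> c = 0 then 1 else 1 / (x * w))"

definition gaugeO :: "real \<Rightarrow> real \<Rightarrow> bit \<Rightarrow> bit \<Rightarrow> bit \<Rightarrow> real" where
  "gaugeO x w a b c =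
     (if a = 1 \<and> b = 1 then x
      else if a = 0 \<and> b = c then 1 else x * w)"

lemma gauge_nonzero: "x \<noteq> 0 \<Longrightarrow> w \<noteq> 0 \<Longrightarrow> gaugeE x w a b c \<noteq> 0"
  by (simp add: gaugeE_def)

text \<open>The gauge on the right is the gauge on the left moved by two sites; this is the shape
  that \<open>prod_telescope\<close> needs.\<close>

lemma patch_even:
  assumes "x \<noteq> 0" "w \<noteq> 0"
  shows "patch x w (rule54 a b c) c (rule54 c d e) e * gaugeE x w a b c
    = patch w x e d c b * gaugeE x w c d e"
  using assms
  by (cases a; cases b; cases c; cases d; cases e)
     (simp_all add: patch_def gaugeE_def rule54_if)

lemma patch_odd:
  assumes "x \<noteq> 0" "w \<noteq> 0"
  shows "patch w x (rule54 d e f) d (rule54 b c d) b * gaugeO x w b c d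
    = patch x w b c d e * gaugeO x w d e f"
  using assms
  by (cases b; cases c; cases d; cases e; cases f)
     (simp_all add: patch_def gaugeO_def rule54_if)

text \<open>Probability that an end site with neighbour \<open>b\<close> passes from
  \<open>t\<close> to \<open>a\<close>. Averaging over the virtual site outside the chain makes the
  result uniform for \<open>b = 0\<close>. For \<open>b = 1\<close> the rule always flips, so the
  site must hold \<open>a + 1\<close> before the flip, and the driving matrix alone decides
  that.\<close>

definition bnd_step :: "real \<Rightarrow> real \<Rightarrow> bit \<Rightarrow> bit \<Rightarrow> bit \<Rightarrow> real" where
  "bnd_step \<alpha> \<beta> b a t = (if b = 0 then 1 / 2 else flipE \<alpha> \<beta> (a + 1) t)"

lemma leftP_eq:
  "leftP \<alpha> \<beta> (s, s') (t, t') = (if s' = t' then bnd_step \<alpha> \<beta> s' s t else 0)"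
  by (cases s; cases s'; cases t; cases t')
     (simp_all add: leftP_def loc_mult_def leftP0_def tensor_def bulkP_def one1_def bnd_step_def
       flipE_def rule54_if sum_bit sum_bit_pair field_simps)

lemma rightP_eq:
  "rightP \<gamma> \<delta> (s, s') (t, t') = (if s = t then bnd_step \<gamma> \<delta> s s' t' else 0)"
  by (cases s; cases s'; cases t; cases t')
     (simp_all add: rightP_def loc_mult_def rightP0_def tensor_def bulkP_def one1_def bnd_step_def
       flipE_def rule54_if sum_bit sum_bit_pair field_simps)

lemma bnd_step_pos:
  assumes "\<alpha> \<in> {0<..<1}" "\<beta> \<in> {0<..<1}"
  shows "0 < bnd_step \<alpha> \<beta> b a t"
  using assms by (auto simp: bnd_step_def flipE_def)

lemma bnd_step_sum: "bnd_step \<alpha> \<beta> b 0 t + bnd_step \<alpha> \<beta> b 1 t = 1"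
  by (auto simp: bnd_step_def flipE_def)

section \<open>The transfer matrix\<close>

definition pair4 :: "bit \<Rightarrow> bit \<Rightarrow> 4" where
  "pair4 a b = (if a = 0 then (if b = 0 then 1 else 2) else (if b = 0 then 3 else 4))"

lemma vector4 [simp]:
  "(vector [x, y, z, u] :: ('a::zero)^4) $ 1 = x"
  "(vector [x, y, z, u] :: ('a::zero)^4) $ 2 = y"
  "(vector [x, y, z, u] :: ('a::zero)^4) $ 3 = z"
  "(vector [x, y, z, u] :: ('a::zero)^4) $ 4 = u"
  unfolding vector_def by simp_all

lemma Tmat_pair4:
  "Tmat lam mu $ pair4 a b $ pair4 c d = patch (xi lam mu) (omega lam mu) a b c d"
  by (cases a; cases b; cases c; cases d) (simp_all add: Tmat_def Let_def pair4_def patch_def)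

lemma Tmat_mult:
  fixes v :: "real^4" and lam mu :: real
  defines "x \<equiv> xi lam mu" and "w \<equiv> omega lam mu"
  shows "(Tmat lam mu *v v) $ 1 = v $ 1 + v $ 2 + v $ 3 + v $ 4"
    and "(Tmat lam mu *v v) $ 2 = x * w * (v $ 1 + v $ 2) + v $ 3 / x + w * v $ 4"
    and "(Tmat lam mu *v v) $ 3 = x * w * (v $ 1 + v $ 2 + v $ 3 + v $ 4)"
    and "(Tmat lam mu *v v) $ 4 = x * (v $ 1 + v $ 2) + v $ 3 + x * w * v $ 4"
  by (simp_all add: matrix_vector_mult_def sum_4 Tmat_def Let_def x_def w_def algebra_simps)

lemma diag4_mult: "(diag4 d *v v) $ i = d $ i * v $ i"
  by (simp add: diag4_def matrix_vector_mult_def if_distrib[of "\<lambda>z. z * _"] cong: if_cong)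

text \<open>What concerns the transfer matrix alone is kept apart from the rates, because the decay
  statement ranges over all \<open>lam\<close> and \<open>mu\<close> in the open square.\<close>

locale driving =
  fixes lam mu :: real
  assumes lam_bounds: "-1 < lam" "lam < 1" and mu_bounds: "-1 < mu" "mu < 1"
begin

abbreviation "A \<equiv> Apar lam mu"
abbreviation "B \<equiv> Bpar lam mu"
abbreviation "x \<equiv> xi lam mu"
abbreviation "w \<equiv> omega lam mu"
abbreviation "T \<equiv> Tmat lam mu"
abbreviation "l \<equiv> lvec lam mu"
abbreviation "r \<equiv> rvec lam mu"
abbreviation "\<tau>1 \<equiv> tau1 lam mu"

lemma A_neg: "A < 0"
proof -
  have "lam * (mu + 1) \<le> 1 * (mu + 1)"
    using lam_bounds mu_bounds by (intro mult_right_mono) auto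
  then show ?thesis using mu_bounds by (simp add: Apar_def algebra_simps)
qed

lemma B_neg: "B < 0"
proof -
  have "mu * (lam + 1) \<le> 1 * (lam + 1)"
    using lam_bounds mu_bounds by (intro mult_right_mono) auto
  then show ?thesis using lam_bounds by (simp add: Bpar_def algebra_simps)
qed

lemma nonzero [simp]: "A \<noteq> 0" "B \<noteq> 0" "lam + 2 \<noteq> 0" "mu + 2 \<noteq> 0" "x \<noteq> 0" "w \<noteq> 0"
  using A_neg B_neg lam_bounds mu_bounds by (auto simp: xi_def omega_def)

lemma xw: "x * w = (lam + 2) * (mu + 2) / (A * B)"
  by (simp add: xi_def omega_def power2_eq_square)

lemma lam_mu_less: "lam * mu < 1"
proof -
  have "\<bar>lam * mu\<bar> < 1 * 1"
    unfolding abs_mult using lam_bounds mu_bounds by (intro mult_strict_mono') auto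
  then show ?thesis by auto
qed

lemma tau1_pos: "0 < \<tau>1"
  using A_neg B_neg lam_mu_less by (auto simp: tau1_def mult_neg_neg zero_less_divide_iff)

lemma l_nth: "l $ 1 = 2" "l $ 2 = 2" "l $ 3 = - (2 * A / (lam + 2))" "l $ 4 = 2 * A / B"
  by (simp_all add: lvec_def Let_def)

lemma r_nth: "r $ 1 = 2" "r $ 2 = - (2 * (mu + 2) / B)"
  "r $ 3 = 2 * (lam + 2) * (mu + 2) / (A * B)" "r $ 4 = - (2 * (lam + 2) / A)"
  by (simp_all add: rvec_def Let_def)

lemma inner4: "u \<bullet> v = u $ 1 * v $ 1 + u $ 2 * v $ 2 + u $ 3 * v $ 3 + (u $ 4 * v $ 4 :: real)"
  for u v :: "real^4"
  by (simp add: inner_vec_def sum_4)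

lemma l_T: "l \<bullet> (T *v v) = \<tau>1 * (l \<bullet> v)"
proof -
  define p q where "p = 2 * A / (lam + 2)" and "q = 2 * A / B"
  \<comment> \<open>Three identities suffice for four columns: columns 1 and 2 of \<open>T\<close>
    coincide, and so do the first two entries of \<open>l\<close>.\<close>
  have c: "2 + 2 * (x * w) - p * (x * w) + q * x = 2 * \<tau>1"
    "2 + 2 / x - p * (x * w) + q = - p * \<tau>1"
    "2 + 2 * w - p * (x * w) + q * (x * w) = q * \<tau>1"
    unfolding xw xi_def omega_def tau1_def power2_eq_square p_def q_def
    by (simp_all add: divide_simps) (simp_all only: Apar_def Bpar_def, algebra+)
  have "l \<bullet> (T *v v) = (2 + 2 * (x * w) - p * (x * w) + q * x) * v $ 1
    + (2 + 2 * (x * w) - p * (x * w) + q * x) * v $ 2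
    + (2 + 2 / x - p * (x * w) + q) * v $ 3 + (2 + 2 * w - p * (x * w) + q * (x * w)) * v $ 4"
    by (simp only: inner4 Tmat_mult l_nth flip: p_def q_def) (simp add: algebra_simps)
  also have "\<dots> = \<tau>1 * (l \<bullet> v)"
    unfolding c by (simp only: inner4 l_nth flip: p_def q_def) (simp add: algebra_simps)
  finally show ?thesis .
qed

lemma T_r: "T *v r = \<tau>1 *\<^sub>R r"
proof -
  define p q s where "p = 2 * (mu + 2) / B" and "q = 2 * (lam + 2) / A"
    and "s = 2 * (lam + 2) * (mu + 2) / (A * B)"
  have c: "2 - p + s - q = 2 * \<tau>1"
    "x * w * (2 - p) + s / x - w * q = - p * \<tau>1"
    "x * (2 - p) + s - x * w * q = - q * \<tau>1"
    unfolding xw xi_def omega_def tau1_def power2_eq_square p_def q_def s_def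
    by (simp_all add: divide_simps) (simp_all only: Apar_def Bpar_def, algebra+)
  \<comment> \<open>Row 3 of \<open>T\<close> is \<open>x * w\<close> times row 1, and the entries 3
    and 1 of \<open>r\<close> have the same ratio; hence the third component follows from the
    first.\<close>
  have s: "s = x * w * 2" by (simp add: s_def xw)
  have "(T *v r) $ 3 = x * w * (2 - p + s - q)"
    by (simp only: Tmat_mult r_nth flip: p_def q_def s_def) (simp add: algebra_simps)
  then have "(T *v r) $ 3 = s * \<tau>1"
    unfolding c(1) unfolding s by simp
  moreover have "(T *v r) $ 1 = 2 * \<tau>1" "(T *v r) $ 2 = - p * \<tau>1" "(T *v r) $ 4 = - q * \<tau>1"
    unfolding c[symmetric] by (simp_all only: Tmat_mult r_nth flip: p_def q_def s_def) simp_all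
  ultimately show ?thesis
    by (simp only: vec_eq_iff forall_4 r_nth vector_scaleR_component flip: p_def q_def s_def) simp
qed

lemma l_r_pos: "0 < l \<bullet> r"
proof -
  have "l \<bullet> r = 4 * (lam * mu - mu - lam - 8) / B"
    by (simp add: inner4 l_nth r_nth divide_simps) (simp add: Apar_def Bpar_def algebra_simps)
  moreover have "lam * mu - mu - lam - 8 < 0"
    using lam_mu_less lam_bounds mu_bounds by simp
  ultimately show ?thesis using B_neg by (simp add: zero_less_divide_iff)
qed

end

section \<open>Boundary weights\<close>

locale rates = driving lam mu for lam mu +
  fixes \<alpha> \<beta> \<gamma> \<delta> :: real
  assumes rates: "{\<alpha>, \<beta>, \<gamma>, \<delta>} \<subseteq> {0<..<1}"
    and lam_eq: "\<alpha> - \<beta> = lam" and mu_eq: "\<gamma> - \<delta> = mu"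
begin

definition \<kappa> :: real where "\<kappa> = A / B"

lemma kappa_nonzero [simp]: "\<kappa> \<noteq> 0"
  by (simp add: \<kappa>_def)

text \<open>
  The boundary weights are obtained by solving \<open>bndL_odd\<close>, \<open>bndR_even\<close> and \<open>bndR_odd\<close>, which
  are linear in them. In one time step the left weights pick up a factor \<open>\<kappa>\<close>, the right ones
  its inverse.
\<close>

definition bndL :: "bit \<Rightarrow> bit \<Rightarrow> bit \<Rightarrow> real" where
  "bndL a b c =
     (if b = 0 then 1
      else if c = 0 then (if a = 0 then 1 + lam else 1 - lam) / (\<kappa> * x)
      else (flipE \<alpha> \<beta> (a + 1) 0 * (1 + lam) * w / \<kappa> + flipE \<alpha> \<beta> (a + 1) 1) / (\<kappa> * x))"

definition bndR :: "bit \<Rightarrow> bit \<Rightarrow> bit \<Rightarrow> real" where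
  "bndR a b c =
     (if a = 0 then
        (if b = c then \<kappa> else (if b = 0 then 1 - mu else 1 + mu) * \<kappa> * \<kappa> * x)
      else if b = 1 then \<kappa> * x
      else \<kappa> * x * (flipE \<gamma> \<delta> (c + 1) 0 * (1 + mu) * \<kappa> * \<kappa> * x + flipE \<gamma> \<delta> (c + 1) 1 * \<kappa>))"

text \<open>Left weight after the half step on the even sites. It is defined by the requirement that
  the left end matches in that half step, so the genuine condition on the left is
  \<open>bndL_odd\<close>.\<close>

definition bndL' :: "bit \<Rightarrow> bit \<Rightarrow> bit \<Rightarrow> real" where
  "bndL' a b c = bndL a (rule54 a b c) c / gaugeE x w a b c"

definition bndR' :: "bit \<Rightarrow> bit \<Rightarrow> bit \<Rightarrow> real" where
  "bndR' b c d =
     (if c = 0 then 1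
      else if b = 0 then (if d = 0 then 1 + mu else 1 - mu) * \<kappa> / w
      else (flipE \<gamma> \<delta> (d + 1) 0 * (1 + mu) * \<kappa> * \<kappa> * x + flipE \<gamma> \<delta> (d + 1) 1 * \<kappa>) / w)"

lemma kappa_mult: "\<kappa> * x = - ((lam + 2) / A)" "\<kappa> * \<kappa> * x = - ((lam + 2) / B)"
    "w / \<kappa> = - ((mu + 2) / B)"
  by (simp_all add: \<kappa>_def xi_def omega_def power2_eq_square)

lemma flipE_nth [simp]: "flipE a b 0 0 = 1 - a" "flipE a b 1 0 = a" "flipE a b 0 1 = b"
  "flipE a b 1 1 = 1 - b"
  by (simp_all add: flipE_def)

text \<open>Each column of \<open>flipE\<close> sums to 1, which removes the rates up to their
  difference.\<close>

lemma sum_bndL: "bndL 0 b c + bndL 1 b c = l $ pair4 b c"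
proof -
  have "((1 + lam) * (w / \<kappa>) + 1) / (\<kappa> * x) = 2 * A / B"
    unfolding kappa_mult by (simp add: divide_simps) (simp add: Apar_def Bpar_def algebra_simps)
  moreover have "bndL 0 1 1 + bndL 1 1 1 = ((1 + lam) * (w / \<kappa>) + 1) / (\<kappa> * x)"
    by (simp add: bndL_def add_divide_distrib[symmetric] algebra_simps)
  moreover have "bndL 0 1 0 + bndL 1 1 0 = 2 / (\<kappa> * x)"
    by (simp add: bndL_def add_divide_distrib[symmetric])
  ultimately show ?thesis
    by (cases b; cases c) (simp_all add: l_nth pair4_def kappa_mult, simp_all add: bndL_def)
qed

lemma sum_bndR: "bndR a b 0 + bndR a b 1 = r $ pair4 a b"
proof -
  have e1: "\<kappa> + (1 - mu) * (\<kappa> * \<kappa> * x) = 2"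
    unfolding kappa_mult unfolding \<kappa>_def
    by (simp add: divide_simps) (simp add: Apar_def Bpar_def algebra_simps)
  have e2: "(1 + mu) * (\<kappa> * \<kappa> * x) + \<kappa> = - (2 * (mu + 2) / B)"
    unfolding kappa_mult unfolding \<kappa>_def
    by (simp add: divide_simps) (simp add: Apar_def Bpar_def algebra_simps)
  have "bndR 0 0 0 + bndR 0 0 1 = r $ 1"
    unfolding r_nth e1[symmetric] by (simp add: bndR_def)
  moreover have "bndR 0 1 0 + bndR 0 1 1 = r $ 2"
    unfolding r_nth e2[symmetric] by (simp add: bndR_def)
  moreover have "bndR 1 0 0 + bndR 1 0 1 = \<kappa> * x * ((1 + mu) * (\<kappa> * \<kappa> * x) + \<kappa>)"
    by (simp add: bndR_def algebra_simps)
  moreover have "\<kappa> * x * (- (2 * (mu + 2) / B)) = r $ 3"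
    unfolding kappa_mult r_nth by (simp only: minus_mult_minus times_divide_times_eq mult_ac)
  moreover have "bndR 1 1 0 + bndR 1 1 1 = 2 * (\<kappa> * x)"
    by (simp add: bndR_def)
  moreover have "2 * (\<kappa> * x) = r $ 4"
    unfolding kappa_mult r_nth by (simp only: mult_minus_right times_divide_eq_right)
  ultimately show ?thesis
    by (cases a; cases b) (simp_all only: pair4_def e2 simp_thms if_True if_False bit.distinct)
qed

text \<open>The right side is free of \<open>a\<close>: for \<open>c = 0\<close> the gauge
  compensates the dependence of \<open>rule54 a b c\<close> on \<open>a\<close>, and for
  \<open>c = 1\<close> neither factor depends on it.\<close>

lemma bndR_even:
  "gaugeE x w a b c * (\<Sum>t\<in>UNIV. bndR (rule54 a b c) c t * bnd_step \<gamma> \<delta> c d t) = bndR' b c d"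
proof (cases "c = 0")
  case 0: True
  have nz: "lam * 2 + 4 \<noteq> 0" using lam_bounds by simp
  have "(\<Sum>t\<in>UNIV. bndR (rule54 a b c) c t * bnd_step \<gamma> \<delta> c d t) = r $ pair4 (a + b) 0 / 2"
    unfolding sum_bndR[symmetric] 0
    by (cases a) (simp_all add: sum_bit bnd_step_def rule54_if add.commute)
  then show ?thesis unfolding 0
    by (cases a; cases b) (simp_all add: gaugeE_def xw bndR'_def pair4_def r_nth nz)
next
  case False
  then have 1: "c = 1" by simp
  \<comment> \<open>Row sums of \<open>flipE\<close>, in contrast to its column sums, see the
    driving.\<close>
  have e: "flipE \<gamma> \<delta> (d + 1) 0 + flipE \<gamma> \<delta> (d + 1) 1 = (if d = 0 then 1 + mu else 1 - mu)"
    using mu_eq by (cases d) simp_all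
  have r: "rule54 a b 1 = b + 1" by (simp add: rule54_if)
  have s: "(\<Sum>t\<in>UNIV. bndR (b + 1) 1 t * bnd_step \<gamma> \<delta> 1 d t)
    = bndR (b + 1) 1 0 * flipE \<gamma> \<delta> (d + 1) 0 + bndR (b + 1) 1 1 * flipE \<gamma> \<delta> (d + 1) 1"
    by (simp add: sum_bit bnd_step_def)
  show ?thesis
  proof (cases "b = 0")
    case True
    have "bndR 1 1 0 * flipE \<gamma> \<delta> (d + 1) 0 + bndR 1 1 1 * flipE \<gamma> \<delta> (d + 1) 1
      = \<kappa> * x * (if d = 0 then 1 + mu else 1 - mu)"
      unfolding e[symmetric] by (simp add: bndR_def algebra_simps)
    then show ?thesis unfolding 1 r s using True
      by (simp add: gaugeE_def bndR'_def)
  next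
    case False
    then have b: "b = 1" by simp
    show ?thesis unfolding 1 r s unfolding b
      by (cases d) (simp_all add: gaugeE_def bndR'_def bndR_def mult_ac)
  qed
qed

lemma bndL_odd:
  "(\<Sum>t\<in>UNIV. bnd_step \<alpha> \<beta> b a t * bndL' t b (rule54 b c d)) = \<kappa> * bndL a b c * gaugeO x w b c d"
proof (cases "b = 0")
  case 0: True
  \<comment> \<open>The condition on \<open>\<kappa>\<close> that comes from an empty site 2:
    averaging over the end site must reproduce the left weight up to this factor.\<close>
  have e1: "1 + (1 - lam) * (w / \<kappa>) = 2 * \<kappa>"
    unfolding kappa_mult unfolding \<kappa>_def
    by (simp add: divide_simps) (simp add: Apar_def Bpar_def algebra_simps)
  show ?thesis
  proof (cases "c = d")
    case True
    then have [simp]: "rule54 0 d d = 0" by (cases d) (simp_all add: rule54_if)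
    have "bndL' 0 0 0 + bndL' 1 0 0 = 1 + (1 - lam) * (w / \<kappa>)"
      by (simp add: bndL'_def rule54_if gaugeE_def bndL_def)
    then have "(bndL' 0 0 0 + bndL' 1 0 0) / 2 = \<kappa>" using e1 by simp
    then show ?thesis using 0 True
      by (simp add: sum_bit bnd_step_def bndL_def gaugeO_def add_divide_distrib)
  next
    case False
    then have [simp]: "rule54 0 c d = 1" by (cases c; cases d) (simp_all add: rule54_if)
    have "bndL' 0 0 1 + bndL' 1 0 1 = x * w * (bndL 0 1 1 + bndL 1 1 1)"
      by (simp add: bndL'_def rule54_if gaugeE_def algebra_simps)
    also have "\<dots> = x * w * (2 * \<kappa>)"
      by (simp add: sum_bndL pair4_def l_nth \<kappa>_def)
    finally have "(bndL' 0 0 1 + bndL' 1 0 1) / 2 = x * w * \<kappa>" by simp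
    then show ?thesis using 0 False
      by (simp add: sum_bit bnd_step_def bndL_def gaugeO_def add_divide_distrib)
  qed
next
  case False
  then have 1: "b = 1" by simp
  have e: "flipE \<alpha> \<beta> (a + 1) 0 + flipE \<alpha> \<beta> (a + 1) 1 = (if a = 0 then 1 + lam else 1 - lam)"
    using lam_eq by (cases a) simp_all
  have r: "rule54 1 c d = c + 1" by (simp add: rule54_if)
  have s: "(\<Sum>t\<in>UNIV. bnd_step \<alpha> \<beta> 1 a t * bndL' t 1 (c + 1))
    = flipE \<alpha> \<beta> (a + 1) 0 * bndL' 0 1 (c + 1) + flipE \<alpha> \<beta> (a + 1) 1 * bndL' 1 1 (c + 1)"
    by (simp add: sum_bit bnd_step_def)
  show ?thesis
  proof (cases "c = 0")
    case True
    have "flipE \<alpha> \<beta> (a + 1) 0 * bndL' 0 1 1 + flipE \<alpha> \<beta> (a + 1) 1 * bndL' 1 1 1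
      = w * (if a = 0 then 1 + lam else 1 - lam)"
      unfolding e[symmetric] by (simp add: bndL'_def bndL_def rule54_if gaugeE_def algebra_simps)
    then show ?thesis unfolding 1 r s using True
      by (simp add: gaugeO_def bndL_def)
  next
    case False
    then have c: "c = 1" by simp
    have "flipE \<alpha> \<beta> (a + 1) 0 * bndL' 0 1 0 + flipE \<alpha> \<beta> (a + 1) 1 * bndL' 1 1 0
      = flipE \<alpha> \<beta> (a + 1) 0 * (1 + lam) * w / \<kappa> + flipE \<alpha> \<beta> (a + 1) 1"
      by (simp add: bndL'_def bndL_def rule54_if gaugeE_def)
    then show ?thesis unfolding 1 r s unfolding c
      by (cases a) (simp_all add: gaugeO_def bndL_def)
  qed
qed

lemma bndR_odd:
  "\<kappa> * gaugeO x w b c d * bndR' b (rule54 b c d) d = bndR b c d"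
proof -
  have h0: "\<kappa> * gaugeO x w 0 0 0 * bndR' 0 (rule54 0 0 0) 0 = bndR 0 0 0"
    by (simp add: bndR_def bndR'_def rule54_if gaugeO_def)
  have h1: "\<kappa> * gaugeO x w 0 0 1 * bndR' 0 (rule54 0 0 1) 1 = bndR 0 0 1"
    by (simp add: bndR_def bndR'_def rule54_if gaugeO_def)
  have h2: "\<kappa> * gaugeO x w 0 1 0 * bndR' 0 (rule54 0 1 0) 0 = bndR 0 1 0"
    by (simp add: bndR_def bndR'_def rule54_if gaugeO_def)
  have h3: "\<kappa> * gaugeO x w 0 1 1 * bndR' 0 (rule54 0 1 1) 1 = bndR 0 1 1"
    by (simp add: bndR_def bndR'_def rule54_if gaugeO_def)
  have h4: "\<kappa> * gaugeO x w 1 0 0 * bndR' 1 (rule54 1 0 0) 0 = bndR 1 0 0"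
    by (simp add: bndR_def bndR'_def rule54_if gaugeO_def)
  have h5: "\<kappa> * gaugeO x w 1 0 1 * bndR' 1 (rule54 1 0 1) 1 = bndR 1 0 1"
    by (simp add: bndR_def bndR'_def rule54_if gaugeO_def)
  have h6: "\<kappa> * gaugeO x w 1 1 0 * bndR' 1 (rule54 1 1 0) 0 = bndR 1 1 0"
    by (simp add: bndR_def bndR'_def rule54_if gaugeO_def)
  have h7: "\<kappa> * gaugeO x w 1 1 1 * bndR' 1 (rule54 1 1 1) 1 = bndR 1 1 1"
    by (simp add: bndR_def bndR'_def rule54_if gaugeO_def)
  show ?thesis by (cases b; cases c; cases d) (simp_all only: h0 h1 h2 h3 h4 h5 h6 h7)
qed

end

declare One_nat_def [simp del]

section \<open>The propagator as an operator on functions of configurations\<close>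

definition act :: "nat \<Rightarrow> conf mat \<Rightarrow> (conf \<Rightarrow> real) \<Rightarrow> conf \<Rightarrow> real" where
  "act n M v s = (\<Sum>t\<in>config n. M s t * v t)"

definition upd :: "nat set \<Rightarrow> conf \<Rightarrow> conf" where
  "upd C s = (\<lambda>j. if j \<in> C then rule54 (s (j - 1)) (s j) (s (j + 1)) else s j)"

lemma finite_config [simp]: "finite (config n)"
  by (simp add: config_def finite_PiE)

lemma config_eqI: "s \<in> config n \<Longrightarrow> t \<in> config n \<Longrightarrow> (\<And>i. i \<in> {1..n} \<Longrightarrow> s i = t i) \<Longrightarrow> s = t"
  unfolding config_def by (rule PiE_ext)

lemma fun_upd_config [simp]: "s \<in> config n \<Longrightarrow> k \<in> {1..n} \<Longrightarrow> s(k := x) \<in> config n"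
  by (auto simp: config_def PiE_iff extensional_def)

lemma upd_config [simp]: "s \<in> config n \<Longrightarrow> C \<subseteq> {1..n} \<Longrightarrow> upd C s \<in> config n"
  by (auto simp: config_def PiE_iff extensional_def upd_def)

lemma act_mmult: "act n (mmult n M N) v s = act n M (act n N v) s"
proof -
  have "act n (mmult n M N) v s = (\<Sum>t\<in>config n. \<Sum>u\<in>config n. M s u * N u t * v t)"
    by (simp add: act_def mmult_def sum_distrib_right)
  also have "\<dots> = (\<Sum>u\<in>config n. \<Sum>t\<in>config n. M s u * N u t * v t)"
    by (rule sum.swap)
  also have "\<dots> = act n M (act n N v) s"
    by (simp add: act_def sum_distrib_left mult.assoc)
  finally show ?thesis .
qed

lemma act_cong: "(\<And>t. t \<in> config n \<Longrightarrow> v t = v' t) \<Longrightarrow> act n M v s = act n M v' s"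
  unfolding act_def by (rule sum.cong) auto

lemma act_one: "s \<in> config n \<Longrightarrow> act n mone v s = v s"
  by (simp add: act_def mone_def of_bool_def if_distrib[of "\<lambda>z. z * _"] cong: if_cong)

lemma mprod_Cons: "mprod n (M # Ms) = mmult n M (mprod n Ms)"
  by (simp add: mprod_def)

lemma mprod_Nil: "mprod n [] = mone"
  by (simp add: mprod_def)

lemma prod_one1:
  "finite I \<Longrightarrow> (\<Prod>i\<in>I. one1 (s i) (t i)) = of_bool (\<forall>i\<in>I. s i = t i)"
  by (induction rule: finite_induct) (auto simp: one1_def)

text \<open>A permutation matrix acts on functions by evaluation at the preimage of
  \<open>s\<close>. For fixed neighbours the rule is an involution of the middle cell, so the
  preimage is again an update.\<close>

lemma act_bulk:
  assumes s: "s \<in> config n" and c: "1 < c" "c < n"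
  shows "act n (embed3 n (c - 1) bulkP) v s = v (upd {c} s)"
proof -
  have u: "upd {c} s \<in> config n"
    using s c by simp
  have "embed3 n (c - 1) bulkP s t = of_bool (t = upd {c} s)" if t: "t \<in> config n" for t
  proof -
    have c': "c - 1 + 1 = c" "c - 1 + 2 = c + 1" using c by auto
    have "embed3 n (c - 1) bulkP s t = of_bool (s (c - 1) = t (c - 1)
        \<and> s c = rule54 (t (c - 1)) (t c) (t (c + 1)) \<and> s (c + 1) = t (c + 1)
        \<and> (\<forall>i\<in>{1..n} - {c - 1, c, c + 1}. s i = t i))"
      unfolding embed3_def c' by (simp add: bulkP_def prod_one1)
    also have "\<dots> = of_bool (\<forall>i\<in>{1..n}. t i = upd {c} s i)"
    proof (rule arg_cong[of _ _ of_bool], rule iffI)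
      assume *: "s (c - 1) = t (c - 1) \<and> s c = rule54 (t (c - 1)) (t c) (t (c + 1)) \<and>
        s (c + 1) = t (c + 1) \<and> (\<forall>i\<in>{1..n} - {c - 1, c, c + 1}. s i = t i)"
      show "\<forall>i\<in>{1..n}. t i = upd {c} s i"
      proof
        fix i assume "i \<in> {1..n}"
        then show "t i = upd {c} s i"
          using * by (cases "i \<in> {c - 1, c, c + 1}") (auto simp: upd_def rule54_involutive)
      qed
    next
      assume *: "\<forall>i\<in>{1..n}. t i = upd {c} s i"
      have "{c - 1, c, c + 1} \<subseteq> {1..n}" using c by (simp; linarith)
      then have "t (c - 1) = s (c - 1)" "t (c + 1) = s (c + 1)"
        "t c = rule54 (s (c - 1)) (s c) (s (c + 1))"
        using * c less_imp_neq[of "c - 1" c] by (simp_all add: upd_def)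
      moreover have "s i = t i" if "i \<in> {1..n} - {c - 1, c, c + 1}" for i
        using that * by (simp add: upd_def)
      ultimately show "s (c - 1) = t (c - 1) \<and> s c = rule54 (t (c - 1)) (t c) (t (c + 1)) \<and>
        s (c + 1) = t (c + 1) \<and> (\<forall>i\<in>{1..n} - {c - 1, c, c + 1}. s i = t i)"
        by (simp add: rule54_involutive)
    qed
    also have "\<dots> = of_bool (t = upd {c} s)"
      using config_eqI[OF t u] by auto
    finally show ?thesis .
  qed
  then have "act n (embed3 n (c - 1) bulkP) v s = (\<Sum>t\<in>config n. of_bool (t = upd {c} s) * v t)"
    unfolding act_def by (intro sum.cong) auto
  also have "\<dots> = v (upd {c} s)"
    using u by (simp add: of_bool_def if_distrib[of "\<lambda>z. z * _"] cong: if_cong)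
  finally show ?thesis .
qed

text \<open>Sites of equal parity are never neighbours, so updating them one after the other agrees
  with the simultaneous update \<open>upd\<close>.\<close>

lemma act_bulk_list:
  assumes "s \<in> config n" "distinct cs" "\<And>c. c \<in> set cs \<Longrightarrow> 1 < c \<and> c < n"
    and "\<And>c c'. c \<in> set cs \<Longrightarrow> c' \<in> set cs \<Longrightarrow> even c = even c'"
  shows "act n (mprod n (map (\<lambda>c. embed3 n (c - 1) bulkP) cs @ Ms)) v s
    = act n (mprod n Ms) v (upd (set cs) s)"
  using assms
proof (induction cs arbitrary: s)
  case Nil
  then show ?case by (simp add: upd_def)
next
  case (Cons c cs)
  have c: "1 < c" "c < n" using Cons.prems(3)[of c] by auto
  have p: "j \<noteq> c" "j - 1 \<noteq> c" "j + 1 \<noteq> c" "even j = even c" if "j \<in> set cs" for j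
  proof -
    have "even j = even c" "1 < j" using that Cons.prems(3,4)[of j] by auto
    moreover have "even (j - 1) \<noteq> even j" using \<open>1 < j\<close> by simp
    ultimately show "j - 1 \<noteq> c" "j + 1 \<noteq> c" "even j = even c" by auto
    show "j \<noteq> c" using that Cons.prems(2) by auto
  qed
  have "upd (set cs) (upd {c} s) = upd (set (c # cs)) s"
    unfolding upd_def using p by (auto simp: fun_eq_iff)
  moreover have "upd {c} s \<in> config n" using Cons.prems(1) c by simp
  ultimately show ?case
    using Cons.IH[of "upd {c} s"] Cons.prems
    by (simp add: mprod_Cons act_mmult act_bulk[OF Cons.prems(1) c])
qed

lemma sum_site:
  fixes G :: "conf \<Rightarrow> real"
  assumes "s \<in> config n" "k \<in> {1..n}"
  shows "(\<Sum>t\<in>config n. of_bool (\<forall>i\<in>{1..n} - {k}. s i = t i) * G t) = (\<Sum>b\<in>UNIV. G (s(k := b)))"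
proof -
  have of_bool: "of_bool P * y = (if P then y else 0)" for P and y :: real
    by simp
  have "{t \<in> config n. \<forall>i\<in>{1..n} - {k}. s i = t i} = (\<lambda>b. s(k := b)) ` UNIV"
  proof safe
    fix t assume t: "t \<in> config n" "\<forall>i\<in>{1..n} - {k}. s i = t i"
    then have "t = s(k := t k)" using assms by (intro config_eqI[of _ n]) auto
    then show "t \<in> range (\<lambda>b. s(k := b))" by blast
  qed (use assms in \<open>auto split: if_splits\<close>)
  moreover have "inj (\<lambda>b. s(k := b))"
    by (rule injI) (metis fun_upd_same)
  ultimately have "(\<Sum>b\<in>UNIV. G (s(k := b))) = (\<Sum>t | t \<in> config n \<and> (\<forall>i\<in>{1..n} - {k}. s i = t i). G t)"
    by (simp add: sum.reindex)
  also have "\<dots> = (\<Sum>t\<in>config n. of_bool (\<forall>i\<in>{1..n} - {k}. s i = t i) * G t)"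
    unfolding of_bool by (rule sum.inter_filter) simp
  finally show ?thesis ..
qed

lemma act_left:
  assumes s: "s \<in> config n" and n: "2 \<le> n"
  shows "act n (embed2 n 1 (leftP \<alpha> \<beta>)) v s
    = (\<Sum>b\<in>UNIV. bnd_step \<alpha> \<beta> (s 2) (s 1) b * v (s(1 := b)))"
proof -
  have "embed2 n 1 (leftP \<alpha> \<beta>) s t
      = of_bool (\<forall>i\<in>{1..n} - {1}. s i = t i) * bnd_step \<alpha> \<beta> (s 2) (s 1) (t 1)" for t
  proof -
    have "(\<forall>i\<in>{1..n} - {1}. s i = t i) \<longleftrightarrow> s 2 = t 2 \<and> (\<forall>i\<in>{1..n} - {1, 2}. s i = t i)"
      using n by auto
    moreover have "1 + 1 = (2::nat)" by simp
    ultimately show ?thesis unfolding embed2_def by (simp add: leftP_eq prod_one1)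
  qed
  then have "act n (embed2 n 1 (leftP \<alpha> \<beta>)) v s
    = (\<Sum>t\<in>config n. of_bool (\<forall>i\<in>{1..n} - {1}. s i = t i) * (bnd_step \<alpha> \<beta> (s 2) (s 1) (t 1) * v t))"
    unfolding act_def by (simp only: mult.assoc)
  also have "\<dots> = (\<Sum>b\<in>UNIV. bnd_step \<alpha> \<beta> (s 2) (s 1) ((s(1 := b)) 1) * v (s(1 := b)))"
    by (rule sum_site) (use s n in auto)
  finally show ?thesis by simp
qed

lemma act_right:
  assumes s: "s \<in> config n" and n: "2 \<le> n"
  shows "act n (embed2 n (n - 1) (rightP \<gamma> \<delta>)) v s
    = (\<Sum>b\<in>UNIV. bnd_step \<gamma> \<delta> (s (n - 1)) (s n) b * v (s(n := b)))"
proof -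
  have n': "n - 1 + 1 = n" using n by simp
  have "embed2 n (n - 1) (rightP \<gamma> \<delta>) s t
      = of_bool (\<forall>i\<in>{1..n} - {n}. s i = t i) * bnd_step \<gamma> \<delta> (s (n - 1)) (s n) (t n)" for t
  proof -
    have "(\<forall>i\<in>{1..n} - {n}. s i = t i)
        \<longleftrightarrow> s (n - 1) = t (n - 1) \<and> (\<forall>i\<in>{1..n} - {n - 1, n}. s i = t i)"
      using n by auto
    then show ?thesis unfolding embed2_def n' by (simp add: rightP_eq prod_one1)
  qed
  then have "act n (embed2 n (n - 1) (rightP \<gamma> \<delta>)) v s
    = (\<Sum>t\<in>config n. of_bool (\<forall>i\<in>{1..n} - {n}. s i = t i)
        * (bnd_step \<gamma> \<delta> (s (n - 1)) (s n) (t n) * v t))"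
    unfolding act_def by (simp only: mult.assoc)
  also have "\<dots> = (\<Sum>b\<in>UNIV. bnd_step \<gamma> \<delta> (s (n - 1)) (s n) ((s(n := b)) n) * v (s(n := b)))"
    by (rule sum_site) (use s n in auto)
  finally show ?thesis by simp
qed

text \<open>Interior sites only: sites 1 and \<open>2 * m\<close> are changed by the boundary
  matrices.\<close>

definition evens :: "nat \<Rightarrow> nat set" where
  "evens m = {c. even c \<and> 1 < c \<and> c < 2 * m}"

definition odds :: "nat \<Rightarrow> nat set" where
  "odds m = {c. odd c \<and> 1 < c \<and> c < 2 * m}"

lemma evens_odds_subset [simp]: "evens m \<subseteq> {1..2 * m}" "odds m \<subseteq> {1..2 * m}"
  by (auto simp: evens_def odds_def)

lemma act_Ue:
  assumes s: "s \<in> config (2 * m)" and m: "2 \<le> m"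
  shows "act (2 * m) (Ue m \<gamma> \<delta>) v s
    = (\<Sum>b\<in>UNIV. bnd_step \<gamma> \<delta> (s (2 * m - 1)) (s (2 * m)) b * v ((upd (evens m) s)(2 * m := b)))"
proof -
  define cs where "cs = map (\<lambda>i. 2 * i) [1..<m]"
  have set: "set cs = evens m"
    by (auto simp: cs_def evens_def image_iff elim!: evenE)
  have "distinct cs" by (simp add: cs_def distinct_map inj_on_def)
  have eq: "map (\<lambda>i. embed3 (2 * m) (2 * i - 1) bulkP) [1..<m]
      = map (\<lambda>c. embed3 (2 * m) (c - 1) bulkP) cs"
    by (simp add: cs_def)
  have "act (2 * m) (Ue m \<gamma> \<delta>) v s
    = act (2 * m) (embed2 (2 * m) (2 * m - 1) (rightP \<gamma> \<delta>)) v (upd (evens m) s)"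
    unfolding Ue_def eq set[symmetric]
    by (subst act_bulk_list)
       (use s \<open>distinct cs\<close> in \<open>auto simp: set evens_def mprod_Cons mprod_Nil act_mmult
          intro: act_cong act_one\<close>)
  moreover have "upd (evens m) s (2 * m) = s (2 * m)" "upd (evens m) s (2 * m - 1) = s (2 * m - 1)"
    using m by (auto simp: upd_def evens_def)
  ultimately show ?thesis
    using m s by (subst (asm) act_right) auto
qed

lemma act_Uo:
  assumes s: "s \<in> config (2 * m)" and m: "2 \<le> m"
  shows "act (2 * m) (Uo m \<alpha> \<beta>) v s
    = (\<Sum>b\<in>UNIV. bnd_step \<alpha> \<beta> (s 2) (s 1) b * v ((upd (odds m) s)(1 := b)))"
proof -
  define cs where "cs = map (\<lambda>i. 2 * i + 1) (rev [1..<m])"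
  have set: "set cs = odds m"
    by (auto simp: cs_def odds_def image_iff elim!: oddE)
  have "distinct cs" by (simp add: cs_def distinct_map inj_on_def)
  have eq: "map (\<lambda>i. embed3 (2 * m) (2 * i) bulkP) (rev [1..<m])
      = map (\<lambda>c. embed3 (2 * m) (c - 1) bulkP) cs"
    by (simp add: cs_def)
  have "act (2 * m) (Uo m \<alpha> \<beta>) v s
    = act (2 * m) (embed2 (2 * m) 1 (leftP \<alpha> \<beta>)) v (upd (odds m) s)"
    unfolding Uo_def eq set[symmetric]
    by (subst act_bulk_list)
       (use s \<open>distinct cs\<close> in \<open>auto simp: set odds_def mprod_Cons mprod_Nil act_mmult
          intro: act_cong act_one\<close>)
  moreover have "upd (odds m) s 2 = s 2" "upd (odds m) s 1 = s 1"
    using m by (auto simp: upd_def odds_def)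
  ultimately show ?thesis
    using m s by (subst (asm) act_left) auto
qed

lemma upd_evens_involutive: "upd (evens m) (upd (evens m) s) = s"
  by (auto simp: upd_def evens_def fun_eq_iff rule54_involutive)

lemma upd_odds_involutive: "upd (odds m) (upd (odds m) s) = s"
  by (auto simp: upd_def odds_def fun_eq_iff rule54_involutive)

section \<open>Uniqueness of the steady state\<close>

text \<open>A Perron-Frobenius argument. If \<open>v\<close> is stationary, so is
  \<open>\<bar>v\<bar>\<close>, and hence so are \<open>\<bar>v\<bar> + v\<close> and
  \<open>\<bar>v\<bar> - v\<close>. A nonnegative stationary vector that is positive somewhere is
  positive at \<open>z\<close>, which cannot hold for both. So \<open>v\<close> has a constant sign,
  and its sum is 0.\<close>

lemma stationary_zero:
  fixes M :: "'a \<Rightarrow> 'a \<Rightarrow> real"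
  assumes fin: "finite S"
    and nonneg: "\<And>s t. s \<in> S \<Longrightarrow> t \<in> S \<Longrightarrow> 0 \<le> M s t"
    and mass: "\<And>v. (\<Sum>s\<in>S. \<Sum>t\<in>S. M s t * v t) = (\<Sum>t\<in>S. v t)"
    and reach: "\<And>t. t \<in> S \<Longrightarrow> (t, z) \<in> {(t, s). t \<in> S \<and> s \<in> S \<and> 0 < M s t}\<^sup>*"
    and stat: "\<And>s. s \<in> S \<Longrightarrow> (\<Sum>t\<in>S. M s t * v t) = v s"
    and total: "(\<Sum>s\<in>S. v s) = 0"
    and s: "s \<in> S"
  shows "v s = 0"
proof -
  have le: "\<bar>v s\<bar> \<le> (\<Sum>t\<in>S. M s t * \<bar>v t\<bar>)" if "s \<in> S" for s
    using sum_abs[of "\<lambda>t. M s t * v t" S] nonneg[OF that] unfolding stat[OF that, symmetric]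
    by (simp add: abs_mult cong: sum.cong)
  \<comment> \<open>The differences are nonnegative by \<open>le\<close>, and by conservation of
    mass they add up to 0.\<close>
  have "(\<Sum>t\<in>S. M s t * \<bar>v t\<bar>) - \<bar>v s\<bar> = 0" if "s \<in> S" for s
    using sum_nonneg_eq_0_iff[OF fin, of "\<lambda>s. (\<Sum>t\<in>S. M s t * \<bar>v t\<bar>) - \<bar>v s\<bar>"] le that
      mass[of "\<lambda>t. \<bar>v t\<bar>"] by (simp add: sum_subtractf)
  then have abs: "(\<Sum>t\<in>S. M s t * \<bar>v t\<bar>) = \<bar>v s\<bar>" if "s \<in> S" for s
    using that by simp
  have pos: "0 < w z"
    if w: "\<And>s. s \<in> S \<Longrightarrow> 0 \<le> w s" "\<And>s. s \<in> S \<Longrightarrow> (\<Sum>t\<in>S. M s t * w t) = w s"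
      and t: "t \<in> S" "0 < w t" for w t
  proof -
    from reach[OF t(1)] show ?thesis
    proof (induction rule: rtrancl_induct)
      case base
      then show ?case using t by simp
    next
      case (step u u')
      have "0 < M u' u * w u" using step by auto
      also have "\<dots> \<le> (\<Sum>t\<in>S. M u' t * w t)"
        using step fin nonneg w(1) by (intro member_le_sum) auto
      finally show ?case using step w(2) by auto
    qed
  qed
  have "\<not> (\<exists>t\<in>S. 0 < v t) \<or> \<not> (\<exists>t\<in>S. v t < 0)"
  proof (rule ccontr)
    assume "\<not> ?thesis"
    then obtain t u where *: "t \<in> S" "0 < v t" "u \<in> S" "v u < 0" by blast
    have "0 < \<bar>v z\<bar> + v z"
      by (rule pos[of "\<lambda>s. \<bar>v s\<bar> + v s" t])
         (use * in \<open>auto simp: distrib_left sum.distrib stat abs\<close>)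
    moreover have "0 < \<bar>v z\<bar> - v z"
      by (rule pos[of "\<lambda>s. \<bar>v s\<bar> - v s" u])
         (use * in \<open>auto simp: right_diff_distrib sum_subtractf stat abs\<close>)
    ultimately show False by auto
  qed
  then show ?thesis
  proof
    assume "\<not> (\<exists>t\<in>S. 0 < v t)"
    then have "\<forall>t\<in>S. - v t \<ge> 0" by (auto simp: not_less)
    then have "\<forall>t\<in>S. - v t = 0"
      using sum_nonneg_eq_0_iff[OF fin, of "\<lambda>t. - v t"] total by (simp add: sum_negf)
    then show ?thesis using s by auto
  next
    assume "\<not> (\<exists>t\<in>S. v t < 0)"
    then have "\<forall>t\<in>S. v t \<ge> 0" by (auto simp: not_less)
    then show ?thesis
      using sum_nonneg_eq_0_iff[OF fin, of v] total s by simp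
  qed
qed

section \<open>Conservation of total mass by the two half steps\<close>

lemma sum_swap_site:
  assumes "k \<in> {1..n}"
  shows "(\<Sum>s\<in>config n. \<Sum>b\<in>UNIV. H (s(k := b)) (s k)) = (\<Sum>s\<in>config n. \<Sum>b\<in>UNIV. H s b)"
  unfolding sum.cartesian_product
  by (rule sum.reindex_bij_witness[of _ "\<lambda>(s, b). (s(k := b), s k)" "\<lambda>(s, b). (s(k := b), s k)"])
     (use assms in auto)

lemma sum_upd:
  assumes "C \<subseteq> {1..n}" "\<And>s. upd C (upd C s) = s"
  shows "(\<Sum>s\<in>config n. f (upd C s)) = (\<Sum>s\<in>config n. f s)"
  by (rule sum.reindex_bij_witness[of _ "upd C" "upd C"]) (use assms in auto)

lemma sum_act_Ue:
  assumes m: "2 \<le> m"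
  shows "(\<Sum>s\<in>config (2 * m). act (2 * m) (Ue m \<gamma> \<delta>) v s) = (\<Sum>s\<in>config (2 * m). v s)"
proof -
  let ?n = "2 * m"
  have "(\<Sum>s\<in>config ?n. act ?n (Ue m \<gamma> \<delta>) v s)
    = (\<Sum>s\<in>config ?n. \<Sum>b\<in>UNIV. bnd_step \<gamma> \<delta> (upd (evens m) s (?n - 1)) (upd (evens m) s ?n) b
        * v ((upd (evens m) s)(?n := b)))"
    by (rule sum.cong) (use m in \<open>auto simp: act_Ue upd_def evens_def\<close>)
  also have "\<dots> = (\<Sum>s\<in>config ?n. \<Sum>b\<in>UNIV. bnd_step \<gamma> \<delta> (s (?n - 1)) (s ?n) b * v (s(?n := b)))"
    by (rule sum_upd) (simp_all add: upd_evens_involutive)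
  also have "\<dots> = (\<Sum>s\<in>config ?n. \<Sum>b\<in>UNIV. bnd_step \<gamma> \<delta> (s (?n - 1)) b (s ?n) * v s)"
    using sum_swap_site[of ?n ?n "\<lambda>s b. bnd_step \<gamma> \<delta> (s (?n - 1)) b (s ?n) * v s"] m
      less_imp_neq[of "?n - 1" ?n] by simp
  also have "\<dots> = (\<Sum>s\<in>config ?n. v s)"
    by (simp add: sum_distrib_right[symmetric] sum_bit bnd_step_sum)
  finally show ?thesis .
qed

lemma sum_act_Uo:
  assumes m: "2 \<le> m"
  shows "(\<Sum>s\<in>config (2 * m). act (2 * m) (Uo m \<alpha> \<beta>) v s) = (\<Sum>s\<in>config (2 * m). v s)"
proof -
  let ?n = "2 * m"
  have "(\<Sum>s\<in>config ?n. act ?n (Uo m \<alpha> \<beta>) v s)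
    = (\<Sum>s\<in>config ?n. \<Sum>b\<in>UNIV. bnd_step \<alpha> \<beta> (upd (odds m) s 2) (upd (odds m) s 1) b
        * v ((upd (odds m) s)(1 := b)))"
    by (rule sum.cong) (use m in \<open>auto simp: act_Uo upd_def odds_def\<close>)
  also have "\<dots> = (\<Sum>s\<in>config ?n. \<Sum>b\<in>UNIV. bnd_step \<alpha> \<beta> (s 2) (s 1) b * v (s(1 := b)))"
    by (rule sum_upd) (simp_all add: upd_odds_involutive)
  also have "\<dots> = (\<Sum>s\<in>config ?n. \<Sum>b\<in>UNIV. bnd_step \<alpha> \<beta> (s 2) b (s 1) * v s)"
    using sum_swap_site[of 1 ?n "\<lambda>s b. bnd_step \<alpha> \<beta> (s 2) b (s 1) * v s"] m by simp
  also have "\<dots> = (\<Sum>s\<in>config ?n. v s)"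
    by (simp add: sum_distrib_right[symmetric] sum_bit bnd_step_sum)
  finally show ?thesis .
qed

lemma act_indicator: "t \<in> config n \<Longrightarrow> act n M (\<lambda>u. of_bool (u = t)) s = M s t"
  by (simp add: act_def of_bool_def if_distrib[of "\<lambda>z. _ * z"] cong: if_cong)

lemma upd_fun_upd:
  assumes "\<And>j. j \<in> C \<Longrightarrow> k \<noteq> j - 1 \<and> k \<noteq> j \<and> k \<noteq> j + 1"
  shows "upd C (s(k := a)) = (upd C s)(k := a)"
  using assms by (auto simp: upd_def fun_eq_iff)

locale chain = rates +
  fixes m :: nat
  assumes m: "2 \<le> m"
begin

abbreviation "n \<equiv> 2 * m"

lemma act_U: "act n (U m \<alpha> \<beta> \<gamma> \<delta>) v s = act n (Uo m \<alpha> \<beta>) (act n (Ue m \<gamma> \<delta>) v) s"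
  by (simp add: U_def act_mmult)

lemma act_Ue_nonneg:
  "s \<in> config n \<Longrightarrow> (\<And>t. t \<in> config n \<Longrightarrow> 0 \<le> v t) \<Longrightarrow> 0 \<le> act n (Ue m \<gamma> \<delta>) v s"
  using m rates by (auto simp: act_Ue intro!: sum_nonneg mult_nonneg_nonneg less_imp_le[OF bnd_step_pos])

lemma U_nonneg:
  assumes "s \<in> config n" "t \<in> config n"
  shows "0 \<le> U m \<alpha> \<beta> \<gamma> \<delta> s t"
  unfolding act_indicator[OF assms(2), symmetric] act_U act_Uo[OF assms(1) m]
  using m rates assms
  by (auto intro!: sum_nonneg mult_nonneg_nonneg less_imp_le[OF bnd_step_pos] act_Ue_nonneg)

lemma U_mass:
  "(\<Sum>s\<in>config n. \<Sum>t\<in>config n. U m \<alpha> \<beta> \<gamma> \<delta> s t * v t) = (\<Sum>t\<in>config n. v t)"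
  using sum_act_Uo[OF m] sum_act_Ue[OF m] act_U by (simp flip: act_def)

text \<open>All boundary transitions have positive probability, so the new values \<open>a\<close>
  and \<open>b\<close> of the end sites can be prescribed freely in every time step.\<close>

lemma U_pos:
  fixes t :: conf and a b :: bit
  assumes t: "t \<in> config n"
  defines "u \<equiv> (upd (evens m) t)(n := a)"
  defines "s \<equiv> (upd (odds m) u)(1 := b)"
  shows "0 < U m \<alpha> \<beta> \<gamma> \<delta> s t"
proof -
  let ?w = "act n (Ue m \<gamma> \<delta>) (\<lambda>v. of_bool (v = t))"
  have u: "u \<in> config n" and s: "s \<in> config n"
    using t m by (simp_all add: u_def s_def)
  have eq: "(upd (evens m) u)(n := t n) = t"
  proof -
    have "upd (evens m) u = (upd (evens m) (upd (evens m) t))(n := a)"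
      unfolding u_def by (rule upd_fun_upd) (simp add: evens_def, presburger)
    then show ?thesis by (simp add: upd_evens_involutive)
  qed
  have "?w u = (\<Sum>c\<in>UNIV. bnd_step \<gamma> \<delta> (u (n - 1)) (u n) c * of_bool ((upd (evens m) u)(n := c) = t))"
    by (simp add: act_Ue[OF u m])
  also have "0 < \<dots>"
    by (rule sum_pos2[of UNIV "t n"])
       (use eq rates in \<open>auto intro: bnd_step_pos less_imp_le[OF bnd_step_pos]\<close>)
  finally have wu: "0 < ?w u" .
  have eq': "(upd (odds m) s)(1 := u 1) = u"
  proof -
    have "upd (odds m) s = (upd (odds m) (upd (odds m) u))(1 := b)"
      unfolding s_def by (rule upd_fun_upd) (simp add: odds_def, presburger)
    then show ?thesis by (simp add: upd_odds_involutive)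
  qed
  have "U m \<alpha> \<beta> \<gamma> \<delta> s t = (\<Sum>c\<in>UNIV. bnd_step \<alpha> \<beta> (s 2) (s 1) c * ?w ((upd (odds m) s)(1 := c)))"
    unfolding act_indicator[OF t, symmetric] act_U by (rule act_Uo[OF s m])
  also have "0 < \<dots>"
  proof (rule sum_pos2[of UNIV "u 1"])
    show "0 < bnd_step \<alpha> \<beta> (s 2) (s 1) (u 1) * ?w ((upd (odds m) s)(1 := u 1))"
      unfolding eq' using rates wu by (intro mult_pos_pos bnd_step_pos) auto
    fix c
    have "(upd (odds m) s)(1 := c) \<in> config n" using s m by simp
    then show "0 \<le> bnd_step \<alpha> \<beta> (s 2) (s 1) c * ?w ((upd (odds m) s)(1 := c))"
      using rates by (intro mult_nonneg_nonneg less_imp_le[OF bnd_step_pos] act_Ue_nonneg) auto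
  qed auto
  finally show ?thesis .
qed

section \<open>A history that drains every configuration to the vacuum\<close>

primrec history :: "conf \<Rightarrow> nat \<Rightarrow> conf" where
  "history t 0 = t"
| "history t (Suc k) =
     (if even k then (upd (evens m) (history t k))(n := history t k (n - 1))
      else (upd (odds m) (history t k))(1 := 0))"

lemma history_config: "t \<in> config n \<Longrightarrow> history t k \<in> config n"
  using m by (induction k) auto

lemma history_still:
  assumes "even k \<noteq> even j"
  shows "history t (Suc k) j = history t k j"
  using assms by (auto simp: upd_def evens_def odds_def)

lemma history_move:
  assumes "even k = even j" "1 < j" "j < n"
  shows "history t (Suc k) j = rule54 (history t k (j - 1)) (history t k j) (history t k (j + 1))"
  using assms by (auto simp: upd_def evens_def odds_def)

text \<open>The history along the \<open>k\<close>-th light ray running from site \<open>n\<close> to site 1.\<close>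

definition ray :: "conf \<Rightarrow> nat \<Rightarrow> nat \<Rightarrow> bit" where
  "ray t k i = history t (2 * k + i + 1) (n - i)"

lemma ray_first: "ray t (Suc k) 0 = ray t k 1"
  by (simp add: ray_def)

lemma ray_last: "ray t k (n - 1) = 0"
proof -
  have i: "n - (n - 1) = 1" and o: "even (2 * k + (n - 1)) = False" using m by auto
  have "history t (Suc (2 * k + (n - 1))) (n - (n - 1)) = 0"
    by (simp only: history.simps o if_False i fun_upd_same)
  then show ?thesis unfolding ray_def by (simp only: Suc_eq_plus1)
qed

text \<open>Along rays the evolution is a sequential scan: when site \<open>n - i\<close> is
  updated, its left neighbour still belongs to the old ray and its right neighbour already to the
  new one.\<close>

lemma ray_step:
  assumes "1 \<le> i" "i + 2 \<le> n"
  shows "ray t (Suc k) i = rule54 (ray t k (i + 1)) (ray t k i) (ray t (Suc k) (i - 1))"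
proof -
  let ?t = "2 * k + i + 1"
  have "ray t (Suc k) i = history t (Suc (Suc ?t)) (n - i)"
    by (simp add: ray_def)
  also have "\<dots> = rule54 (history t (Suc ?t) (n - i - 1)) (history t (Suc ?t) (n - i))
      (history t (Suc ?t) (n - i + 1))"
    using assms by (intro history_move) auto
  also have "history t (Suc ?t) (n - i - 1) = ray t k (i + 1)"
    by (simp add: ray_def)
  also have "history t (Suc ?t) (n - i) = ray t k i"
    unfolding ray_def using assms by (intro history_still) auto
  also have "history t (Suc ?t) (n - i + 1) = ray t (Suc k) (i - 1)"
  proof -
    have "n - (i - 1) = n - i + 1" "2 * Suc k + (i - 1) + 1 = Suc ?t" using assms by auto
    then show ?thesis by (simp add: ray_def)
  qed
  finally show ?thesis .
qed

text \<open>Once entry \<open>i - 1\<close> of the new ray equals entry \<open>i\<close> of the old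
  one, the rule sees the same value as centre and as right neighbour. If it is 0, the result is old
  entry \<open>i + 1\<close>. If it is 1, the result is 0, which again is old entry
  \<open>i + 1\<close>, since adjacent ones are excluded. The copying at site \<open>n\<close>
  starts the induction.\<close>

lemma ray_shift:
  assumes sep: "\<And>j. j \<le> i \<Longrightarrow> \<not> (ray t k j = 1 \<and> ray t k (j + 1) = 1)" and "i + 2 \<le> n"
  shows "ray t (Suc k) i = ray t k (i + 1)"
  using assms
proof (induction i)
  case 0
  then show ?case by (simp add: ray_first)
next
  case (Suc i)
  then have "ray t (Suc k) i = ray t k (i + 1)" by auto
  then show ?case
    using ray_step[of "i + 1" t k] Suc.prems(1)[of "i + 1"] Suc.prems(2)
    unfolding Suc_eq_plus1
    by (cases "ray t k (i + 1)"; cases "ray t k (i + 1 + 1)") (auto simp: rule54_if)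
qed

text \<open>
  If \<open>j\<close> is the first index at which a ray has two adjacent ones, then up to there the next ray
  is a shifted copy, followed by a 0: the part without adjacent ones grows by one site per ray.
\<close>

lemma ray_separated:
  "j < k \<Longrightarrow> j + 2 \<le> n \<Longrightarrow> \<not> (ray t k j = 1 \<and> ray t k (j + 1) = 1)"
proof (induction k arbitrary: j)
  case (Suc k)
  have last: "ray t (Suc k) i = 0" if "\<not> i + 2 \<le> n" "i < n" for i
    using ray_last[of t "Suc k"] that by (metis One_nat_def Suc_1 add_2_eq_Suc' diff_Suc_1 less_antisym linorder_not_le not_less_eq_eq)
  have shift: "ray t (Suc k) i = ray t k (i + 1)" if "i < k \<or> i = 0" "i + 2 \<le> n" for i
  proof (cases "i = 0")
    case False
    then have "\<not> (ray t k j = 1 \<and> ray t k (j + 1) = 1)" if "j \<le> i" for j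
      using Suc.IH[of j] that \<open>i < k \<or> i = 0\<close> \<open>i + 2 \<le> n\<close> by linarith
    then show ?thesis using that by (intro ray_shift)
  qed (simp add: ray_first)
  show ?case
  proof (cases "j < k \<or> j = 0")
    case True
    then have s: "ray t (Suc k) j = ray t k (j + 1)" using shift Suc.prems by auto
    show ?thesis
    proof (cases "j + 3 \<le> n")
      case True
      then show ?thesis using ray_step[of "j + 1" t k] s
        by (cases "ray t k (j + 1)") (auto simp: rule54_if)
    next
      case False
      then show ?thesis using last[of "j + 1"] Suc.prems by auto
    qed
  next
    case False
    then have j: "j = k" "1 \<le> j" using Suc.prems by auto
    then have s: "ray t (Suc k) (j - 1) = ray t k j" using shift[of "j - 1"] Suc.prems by auto
    \<comment> \<open>If old entry \<open>j\<close> is 1, new entry \<open>j\<close> is 0. Otherwise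
      new entry \<open>j\<close> copies old entry \<open>j + 1\<close>, and if that is 1, centre and
      right neighbour are both 1 at the next index, so new entry \<open>j + 1\<close> is 0.\<close>
    have s1: "ray t (Suc k) j = rule54 (ray t k (j + 1)) (ray t k j) (ray t k j)"
      using ray_step[of j t k] j Suc.prems s by simp
    show ?thesis
    proof (cases "j + 3 \<le> n")
      case True
      then show ?thesis using ray_step[of "j + 1" t k] s1
        by (cases "ray t k j"; cases "ray t k (j + 1)") (auto simp: rule54_if)
    next
      case False
      then show ?thesis using last[of "j + 1"] Suc.prems by auto
    qed
  qed
qed simp

text \<open>From ray \<open>n\<close> on no ray has adjacent ones, so each is the shift of its
  predecessor, with the 0 of site 1 entering at the far end.\<close>

lemma ray_drain: "i < n \<Longrightarrow> n \<le> i + d \<Longrightarrow> ray t (n + d) i = 0"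
proof (induction d arbitrary: i)
  case (Suc d)
  show ?case
  proof (cases "i + 2 \<le> n")
    case True
    then have "ray t (Suc (n + d)) i = ray t (n + d) (i + 1)"
      by (intro ray_shift ray_separated) auto
    then show ?thesis using Suc True by auto
  next
    case False
    then have "i = n - 1" using Suc by auto
    then show ?thesis using ray_last by auto
  qed
qed simp

definition vacuum :: conf where
  "vacuum = (\<lambda>i\<in>{1..n}. 0)"

lemma history_vacuum:
  assumes t: "t \<in> config n"
  shows "history t (2 * (3 * n)) = vacuum"
proof (rule config_eqI[OF history_config[OF t]])
  show "vacuum \<in> config n" by (auto simp: vacuum_def config_def)
  fix j assume j: "j \<in> {1..n}"
  define i where "i = n - j"
  have ij: "j = n - i" "i < n" using j by (auto simp: i_def)
  have "history t (2 * (3 * n)) j = 0"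
  proof (cases "even i")
    case False
    \<comment> \<open>At time \<open>6 * n\<close> site \<open>n - i\<close> lies on ray
      \<open>k\<close>, which is at least the \<open>2 * n\<close>-th and therefore drained. For
      even \<open>i\<close> the parities do not match, and the site keeps its value from the
      preceding half step.\<close>
    define k where "k = 3 * n - (i + 1) div 2"
    have "ray t (n + (k - n)) i = 0"
      by (rule ray_drain) (use ij in \<open>auto simp: k_def\<close>)
    moreover have "2 * (3 * n) = 2 * k + i + 1" "n + (k - n) = k"
      using False ij by (auto simp: k_def elim!: oddE)
    ultimately show ?thesis using ij by (simp add: ray_def)
  next
    case True
    define k where "k = 3 * n - (i + 2) div 2"
    have "ray t (n + (k - n)) i = 0"
      by (rule ray_drain) (use ij in \<open>auto simp: k_def\<close>)
    moreover have e: "2 * (3 * n) = Suc (2 * k + i + 1)" "n + (k - n) = k"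
      using True ij by (auto simp: k_def elim!: evenE)
    ultimately have "history t (2 * k + i + 1) j = 0" using ij by (simp add: ray_def)
    then show ?thesis unfolding e(1)
      by (subst history_still) (use True ij in auto)
  qed
  then show "history t (2 * (3 * n)) j = vacuum j" using j by (simp add: vacuum_def)
qed

lemma vacuum_reachable:
  assumes t: "t \<in> config n"
  shows "(t, vacuum) \<in> {(t, s). t \<in> config n \<and> s \<in> config n \<and> 0 < U m \<alpha> \<beta> \<gamma> \<delta> s t}\<^sup>*" (is "_ \<in> ?R\<^sup>*")
proof -
  have "(t, history t (2 * k)) \<in> ?R\<^sup>*" for k
  proof (induction k)
    case (Suc k)
    have "(history t (2 * k), history t (2 * Suc k)) \<in> ?R"
      using U_pos[OF history_config[OF t, of "2 * k"], of "history t (2 * k) (n - 1)" 0]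
        history_config[OF t, of "2 * k"] history_config[OF t, of "2 * Suc k"] by simp
    with Suc show ?case by (rule rtrancl_into_rtrancl)
  qed simp
  from this[of "3 * n"] show ?thesis unfolding history_vacuum[OF t] .
qed

text \<open>The difference of two normalised stationary vectors has total mass 0; normalising
  \<open>q\<close> takes only a nonzero sum.\<close>

lemma steady_state_unique:
  assumes p: "steady_state m \<alpha> \<beta> \<gamma> \<delta> p"
    and q: "\<And>s. s \<in> config n \<Longrightarrow> act n (U m \<alpha> \<beta> \<gamma> \<delta>) q s = q s"
    and Z: "(\<Sum>s\<in>config n. q s) = Z" "Z \<noteq> 0"
    and s: "s \<in> config n"
  shows "p s = q s / Z"
proof -
  have "p s - q s / Z = 0"
  proof (rule stationary_zero[of "config n" "U m \<alpha> \<beta> \<gamma> \<delta>" vacuum "\<lambda>s. p s - q s / Z"])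
    fix s assume s: "s \<in> config n"
    have "(\<Sum>t\<in>config n. U m \<alpha> \<beta> \<gamma> \<delta> s t * (p t - q t / Z))
      = (\<Sum>t\<in>config n. U m \<alpha> \<beta> \<gamma> \<delta> s t * p t) - (\<Sum>t\<in>config n. U m \<alpha> \<beta> \<gamma> \<delta> s t * q t) / Z"
      by (simp add: right_diff_distrib sum_subtractf sum_divide_distrib)
    then show "(\<Sum>t\<in>config n. U m \<alpha> \<beta> \<gamma> \<delta> s t * (p t - q t / Z)) = p s - q s / Z"
      using p q[OF s] s by (simp add: steady_state_def act_def)
  next
    show "(\<Sum>s\<in>config n. p s - q s / Z) = 0"
      using p Z by (simp add: steady_state_def sum_subtractf flip: sum_divide_distrib)
  qed (use s U_nonneg U_mass vacuum_reachable in auto)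
  then show ?thesis by simp
qed

end

declare add_2_eq_Suc [simp del] add_2_eq_Suc' [simp del]

section \<open>The steady state as a product of patches\<close>

lemma prod_telescope:
  fixes g :: "nat \<Rightarrow> real"
  assumes "\<And>k. q k * g k = q' k * g (Suc k)"
  shows "(\<Prod>k<M. q k) * g 0 = (\<Prod>k<M. q' k) * g M"
proof (induction M)
  case (Suc M)
  have "(\<Prod>k<Suc M. q k) * g 0 = (\<Prod>k<M. q' k) * (q M * g M)"
    unfolding mult.assoc[symmetric, of _ "q M"] using Suc by (simp add: mult_ac)
  then show ?case by (simp add: assms)
qed simp

context chain
begin

text \<open>Sites \<open>2, ..., n - 1\<close> form \<open>m - 1\<close> unit cells, an even site
  followed by an odd one. Patch \<open>k\<close> joins the cells \<open>k\<close> and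
  \<open>k + 1\<close>; for \<open>m = 2\<close> there is a single cell and no patch.\<close>

definition ansatz :: "conf \<Rightarrow> real" where
  "ansatz s = bndL (s 1) (s 2) (s 3)
     * (\<Prod>k<m - 2. patch x w (s (2 * k + 2)) (s (2 * k + 3)) (s (2 * k + 4)) (s (2 * k + 5)))
     * bndR (s (n - 2)) (s (n - 1)) (s n)"

text \<open>The vector after half a time step, on which the patches are reflected.\<close>

definition ansatz' :: "conf \<Rightarrow> real" where
  "ansatz' s = bndL' (s 1) (s 2) (s 3)
     * (\<Prod>k<m - 2. patch w x (s (2 * k + 5)) (s (2 * k + 4)) (s (2 * k + 3)) (s (2 * k + 2)))
     * bndR' (s (n - 2)) (s (n - 1)) (s n)"

lemma patches_even:
  fixes s :: conf
  shows "(\<Prod>k<M. patch x w (rule54 (s (2 * k + 1)) (s (2 * k + 2)) (s (2 * k + 3))) (s (2 * k + 3))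
        (rule54 (s (2 * k + 3)) (s (2 * k + 4)) (s (2 * k + 5))) (s (2 * k + 5)))
      * gaugeE x w (s 1) (s 2) (s 3)
    = (\<Prod>k<M. patch w x (s (2 * k + 5)) (s (2 * k + 4)) (s (2 * k + 3)) (s (2 * k + 2)))
      * gaugeE x w (s (2 * M + 1)) (s (2 * M + 2)) (s (2 * M + 3))"
proof -
  have i: "2 * Suc k + 1 = 2 * k + 3" "2 * Suc k + 2 = 2 * k + 4" "2 * Suc k + 3 = 2 * k + 5" for k
    by simp_all
  show ?thesis
    using prod_telescope[of "\<lambda>k. patch x w (rule54 (s (2 * k + 1)) (s (2 * k + 2)) (s (2 * k + 3)))
        (s (2 * k + 3)) (rule54 (s (2 * k + 3)) (s (2 * k + 4)) (s (2 * k + 5))) (s (2 * k + 5))"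
      "\<lambda>k. gaugeE x w (s (2 * k + 1)) (s (2 * k + 2)) (s (2 * k + 3))"
      "\<lambda>k. patch w x (s (2 * k + 5)) (s (2 * k + 4)) (s (2 * k + 3)) (s (2 * k + 2))" M]
    unfolding i by (simp add: patch_even)
qed

lemma patches_odd:
  fixes s :: conf
  shows "(\<Prod>k<M. patch w x (rule54 (s (2 * k + 4)) (s (2 * k + 5)) (s (2 * k + 6))) (s (2 * k + 4))
        (rule54 (s (2 * k + 2)) (s (2 * k + 3)) (s (2 * k + 4))) (s (2 * k + 2)))
      * gaugeO x w (s 2) (s 3) (s 4)
    = (\<Prod>k<M. patch x w (s (2 * k + 2)) (s (2 * k + 3)) (s (2 * k + 4)) (s (2 * k + 5)))
      * gaugeO x w (s (2 * M + 2)) (s (2 * M + 3)) (s (2 * M + 4))"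
proof -
  have i: "2 * Suc k + 2 = 2 * k + 4" "2 * Suc k + 3 = 2 * k + 5" "2 * Suc k + 4 = 2 * k + 6" for k
    by simp_all
  show ?thesis
    using prod_telescope[of "\<lambda>k. patch w x (rule54 (s (2 * k + 4)) (s (2 * k + 5)) (s (2 * k + 6)))
        (s (2 * k + 4)) (rule54 (s (2 * k + 2)) (s (2 * k + 3)) (s (2 * k + 4))) (s (2 * k + 2))"
      "\<lambda>k. gaugeO x w (s (2 * k + 2)) (s (2 * k + 3)) (s (2 * k + 4))"
      "\<lambda>k. patch x w (s (2 * k + 2)) (s (2 * k + 3)) (s (2 * k + 4)) (s (2 * k + 5))" M]
    unfolding i by (simp add: patch_odd)
qed

lemma ansatz_even:
  assumes s: "s \<in> config n"
  shows "act n (Ue m \<gamma> \<delta>) ansatz s = ansatz' s"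
proof -
  obtain M where M: "m = M + 2" using m by (metis add.commute le_Suc_ex)
  define t where "t = upd (evens m) s"
  have odd: "t j = s j" if "odd j" for j
    using that by (simp add: t_def upd_def evens_def)
  have even: "t (2 * k + 2) = rule54 (s (2 * k + 1)) (s (2 * k + 2)) (s (2 * k + 3))" if "k \<le> M" for k
  proof -
    have "2 * k + 2 - 1 = 2 * k + 1" "2 * k + 2 + 1 = 2 * k + 3" "2 * k + 2 \<in> evens m"
      using that by (auto simp: evens_def M)
    then show ?thesis unfolding t_def upd_def by (simp only: if_True)
  qed
  have even': "t (2 * k + 4) = rule54 (s (2 * k + 3)) (s (2 * k + 4)) (s (2 * k + 5))" if "k < M" for k
  proof -
    have "2 * (k + 1) + 1 = 2 * k + 3" "2 * (k + 1) + 2 = 2 * k + 4" "2 * (k + 1) + 3 = 2 * k + 5"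
      by simp_all
    then show ?thesis using even[of "k + 1"] that by (simp add: add.commute)
  qed
  have eq: "ansatz (t(n := b)) = bndL (s 1) (rule54 (s 1) (s 2) (s 3)) (s 3)
     * (\<Prod>k<M. patch x w (rule54 (s (2 * k + 1)) (s (2 * k + 2)) (s (2 * k + 3))) (s (2 * k + 3))
        (rule54 (s (2 * k + 3)) (s (2 * k + 4)) (s (2 * k + 5))) (s (2 * k + 5)))
     * bndR (rule54 (s (2 * M + 1)) (s (2 * M + 2)) (s (2 * M + 3))) (s (2 * M + 3)) b" for b
  proof -
    have "(\<Prod>k<M. patch x w ((t(n := b)) (2 * k + 2)) ((t(n := b)) (2 * k + 3)) ((t(n := b)) (2 * k + 4)) ((t(n := b)) (2 * k + 5)))
      = (\<Prod>k<M. patch x w (rule54 (s (2 * k + 1)) (s (2 * k + 2)) (s (2 * k + 3))) (s (2 * k + 3))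
        (rule54 (s (2 * k + 3)) (s (2 * k + 4)) (s (2 * k + 5))) (s (2 * k + 5)))"
    proof (rule prod.cong)
      fix k assume "k \<in> {..<M}"
      then show "patch x w ((t(n := b)) (2 * k + 2)) ((t(n := b)) (2 * k + 3)) ((t(n := b)) (2 * k + 4)) ((t(n := b)) (2 * k + 5))
        = patch x w (rule54 (s (2 * k + 1)) (s (2 * k + 2)) (s (2 * k + 3))) (s (2 * k + 3))
        (rule54 (s (2 * k + 3)) (s (2 * k + 4)) (s (2 * k + 5))) (s (2 * k + 5))"
        using even[of k] even'[of k] by (simp add: odd M)
    qed simp
    then show ?thesis
      using even[of 0] even[of M] odd[of 1] odd[of 3] odd[of "2 * M + 3"]
      unfolding ansatz_def by (simp add: M add.commute[of _ "2 * M"])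
  qed
  have i: "n - 1 = 2 * M + 3" by (simp add: M)
  have L: "bndL (s 1) (rule54 (s 1) (s 2) (s 3)) (s 3)
    = bndL' (s 1) (s 2) (s 3) * gaugeE x w (s 1) (s 2) (s 3)"
    by (simp add: bndL'_def gauge_nonzero)
  have "act n (Ue m \<gamma> \<delta>) ansatz s
    = bndL' (s 1) (s 2) (s 3)
     * ((\<Prod>k<M. patch x w (rule54 (s (2 * k + 1)) (s (2 * k + 2)) (s (2 * k + 3))) (s (2 * k + 3))
        (rule54 (s (2 * k + 3)) (s (2 * k + 4)) (s (2 * k + 5))) (s (2 * k + 5))) * gaugeE x w (s 1) (s 2) (s 3))
     * (\<Sum>b\<in>UNIV. bndR (rule54 (s (2 * M + 1)) (s (2 * M + 2)) (s (2 * M + 3))) (s (2 * M + 3)) b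
          * bnd_step \<gamma> \<delta> (s (2 * M + 3)) (s n) b)"
    unfolding act_Ue[OF s m] t_def[symmetric] eq i L by (simp only: sum_bit distrib_left distrib_right mult_ac)
  also have "\<dots> = ansatz' s"
  proof -
    have i: "n - 1 = 2 * M + 3" "n - 2 = 2 * M + 2" "m - 2 = M" by (simp_all add: M)
    show ?thesis
      unfolding patches_even ansatz'_def i
        bndR_even[of "s (2 * M + 1)" "s (2 * M + 2)" "s (2 * M + 3)" "s n", symmetric]
      by (simp only: mult_ac)
  qed
  finally show ?thesis .
qed

lemma ansatz_odd:
  assumes s: "s \<in> config n"
  shows "act n (Uo m \<alpha> \<beta>) ansatz' s = ansatz s"
proof -
  obtain M where M: "m = M + 2" using m by (metis add.commute le_Suc_ex)
  define t where "t = upd (odds m) s"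
  have even: "t j = s j" if "even j" for j
    using that by (simp add: t_def upd_def odds_def)
  have odd: "t (2 * k + 3) = rule54 (s (2 * k + 2)) (s (2 * k + 3)) (s (2 * k + 4))" if "k \<le> M" for k
  proof -
    have "2 * k + 3 - 1 = 2 * k + 2" "2 * k + 3 + 1 = 2 * k + 4" "2 * k + 3 \<in> odds m"
      using that by (auto simp: odds_def M)
    then show ?thesis unfolding t_def upd_def by (simp only: if_True)
  qed
  have odd': "t (2 * k + 5) = rule54 (s (2 * k + 4)) (s (2 * k + 5)) (s (2 * k + 6))" if "k < M" for k
  proof -
    have "2 * (k + 1) + 2 = 2 * k + 4" "2 * (k + 1) + 3 = 2 * k + 5" "2 * (k + 1) + 4 = 2 * k + 6"
      by simp_all
    then show ?thesis using odd[of "k + 1"] that by (simp add: add.commute)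
  qed
  have eq: "ansatz' (t(1 := b)) = bndL' b (s 2) (rule54 (s 2) (s 3) (s 4))
     * (\<Prod>k<M. patch w x (rule54 (s (2 * k + 4)) (s (2 * k + 5)) (s (2 * k + 6))) (s (2 * k + 4))
        (rule54 (s (2 * k + 2)) (s (2 * k + 3)) (s (2 * k + 4))) (s (2 * k + 2)))
     * bndR' (s (2 * M + 2)) (rule54 (s (2 * M + 2)) (s (2 * M + 3)) (s (2 * M + 4))) (s (2 * M + 4))" for b
  proof -
    have "(\<Prod>k<M. patch w x ((t(1 := b)) (2 * k + 5)) ((t(1 := b)) (2 * k + 4)) ((t(1 := b)) (2 * k + 3)) ((t(1 := b)) (2 * k + 2)))
      = (\<Prod>k<M. patch w x (rule54 (s (2 * k + 4)) (s (2 * k + 5)) (s (2 * k + 6))) (s (2 * k + 4))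
        (rule54 (s (2 * k + 2)) (s (2 * k + 3)) (s (2 * k + 4))) (s (2 * k + 2)))"
    proof (rule prod.cong)
      fix k assume "k \<in> {..<M}"
      then show "patch w x ((t(1 := b)) (2 * k + 5)) ((t(1 := b)) (2 * k + 4)) ((t(1 := b)) (2 * k + 3)) ((t(1 := b)) (2 * k + 2))
        = patch w x (rule54 (s (2 * k + 4)) (s (2 * k + 5)) (s (2 * k + 6))) (s (2 * k + 4))
        (rule54 (s (2 * k + 2)) (s (2 * k + 3)) (s (2 * k + 4))) (s (2 * k + 2))"
        using odd[of k] odd'[of k] by (simp add: even M)
    qed simp
    then show ?thesis
      using odd[of 0] odd[of M] even[of 2] even[of "2 * M + 2"] even[of "2 * M + 4"]
      unfolding ansatz'_def by (simp add: M add.commute[of _ "2 * M"])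
  qed
  have "act n (Uo m \<alpha> \<beta>) ansatz' s
    = (\<Sum>b\<in>UNIV. bnd_step \<alpha> \<beta> (s 2) (s 1) b * bndL' b (s 2) (rule54 (s 2) (s 3) (s 4)))
     * (\<Prod>k<M. patch w x (rule54 (s (2 * k + 4)) (s (2 * k + 5)) (s (2 * k + 6))) (s (2 * k + 4))
        (rule54 (s (2 * k + 2)) (s (2 * k + 3)) (s (2 * k + 4))) (s (2 * k + 2)))
     * bndR' (s (2 * M + 2)) (rule54 (s (2 * M + 2)) (s (2 * M + 3)) (s (2 * M + 4))) (s (2 * M + 4))"
    unfolding act_Uo[OF s m] t_def[symmetric] eq by (simp only: sum_distrib_right mult.assoc)
  also have "\<dots> = bndL (s 1) (s 2) (s 3)
     * ((\<Prod>k<M. patch w x (rule54 (s (2 * k + 4)) (s (2 * k + 5)) (s (2 * k + 6))) (s (2 * k + 4))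
        (rule54 (s (2 * k + 2)) (s (2 * k + 3)) (s (2 * k + 4))) (s (2 * k + 2))) * gaugeO x w (s 2) (s 3) (s 4))
     * (\<kappa> * bndR' (s (2 * M + 2)) (rule54 (s (2 * M + 2)) (s (2 * M + 3)) (s (2 * M + 4))) (s (2 * M + 4)))"
    unfolding bndL_odd by (simp add: mult_ac)
  also have "\<dots> = ansatz s"
  proof -
    have i: "n - 1 = 2 * M + 3" "n - 2 = 2 * M + 2" "n = 2 * M + 4" "m - 2 = M" by (simp_all add: M)
    show ?thesis
      unfolding patches_odd ansatz_def i(1,2,4) unfolding i(3) bndR_odd[symmetric]
      by (simp only: mult_ac)
  qed
  finally show ?thesis .
qed

lemma ansatz_stationary: "s \<in> config n \<Longrightarrow> act n (U m \<alpha> \<beta> \<gamma> \<delta>) ansatz s = ansatz s"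
  unfolding act_U by (simp add: ansatz_even ansatz_odd cong: act_cong)

end

section \<open>Summation over configurations\<close>

lemma sum_config_Suc:
  "(\<Sum>s\<in>config (Suc n). F s) = (\<Sum>s\<in>config n. \<Sum>b\<in>UNIV. F (s(Suc n := b)))"
  unfolding sum.cartesian_product
  \<comment> \<open>Configurations are extensional, so dropping the last site means resetting it to
    \<open>undefined\<close>.\<close>
  by (rule sum.reindex_bij_witness[of _ "\<lambda>(s, b). s(Suc n := b)" "\<lambda>s. (s(Suc n := undefined), s (Suc n))"])
     (auto simp: config_def PiE_iff extensional_def)

lemma sum_config_0: "(\<Sum>s\<in>config 0. F s) = F (\<lambda>_. undefined)"
  by (simp add: config_def)

lemma sum_config_3:
  "(\<Sum>s\<in>config 3. F s)
    = (\<Sum>a\<in>UNIV. \<Sum>b\<in>UNIV. \<Sum>c\<in>UNIV. F ((\<lambda>_. undefined)(1 := a, 2 := b, 3 := c)))"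
proof -
  have e: "3 = Suc (Suc (Suc 0))" "2 = Suc (Suc 0)" "1 = Suc 0" by simp_all
  show ?thesis by (simp only: e sum_config_Suc sum_config_0)
qed

lemma sum_config_add_2:
  "(\<Sum>s\<in>config (n + 2). F s) = (\<Sum>s\<in>config n. \<Sum>b\<in>UNIV. \<Sum>c\<in>UNIV. F (s(n + 1 := b, n + 2 := c)))"
proof -
  have e: "n + 2 = Suc (Suc n)" "n + 1 = Suc n" by simp_all
  show ?thesis by (simp only: e sum_config_Suc)
qed

lemma sum_pair4: "(\<Sum>a\<in>UNIV. \<Sum>b\<in>UNIV. f (pair4 a b)) = (\<Sum>i\<in>UNIV. f i)"
  by (simp add: sum_bit sum_4 pair4_def add.assoc)

lemma Tmat_mult_pair4:
  "(Tmat lam mu *v v) $ pair4 a b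
    = (\<Sum>c\<in>UNIV. \<Sum>d\<in>UNIV. patch (xi lam mu) (omega lam mu) a b c d * v $ pair4 c d)"
  unfolding Tmat_pair4[symmetric] sum_pair4[of "\<lambda>i. Tmat lam mu $ pair4 a b $ i * v $ i"]
  by (simp add: matrix_vector_mult_def)

context rates
begin

text \<open>The matrix product \<open>l D_0 T D_1 T ... T D_M v\<close>, where \<open>D_k\<close> is
  the diagonal matrix with entries \<open>g k\<close>. Factors are absorbed into \<open>v\<close>
  from the right, so that summing out the last cell is one unfolding.\<close>

primrec wsum :: "(nat \<Rightarrow> real^4) \<Rightarrow> nat \<Rightarrow> real^4 \<Rightarrow> real" where
  "wsum g 0 v = l \<bullet> (diag4 (g 0) *v v)"
| "wsum g (Suc M) v = wsum g M (T *v (diag4 (g (Suc M)) *v v))"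

definition weight :: "(nat \<Rightarrow> real^4) \<Rightarrow> nat \<Rightarrow> conf \<Rightarrow> real" where
  "weight g M s = bndL (s 1) (s 2) (s 3)
     * (\<Prod>k<M. patch x w (s (2 * k + 2)) (s (2 * k + 3)) (s (2 * k + 4)) (s (2 * k + 5)))
     * (\<Prod>k\<le>M. g k $ pair4 (s (2 * k + 2)) (s (2 * k + 3)))"

lemma weight_upd: "2 * M + 3 < j \<Longrightarrow> weight g M (s(j := b)) = weight g M s"
  by (auto simp: weight_def intro!: arg_cong2[of _ _ _ _ "(*)"] prod.cong)

text \<open>The vector \<open>v\<close> is general because in the induction it stands for everything
  to the right of the last cell, already summed out.\<close>

lemma sum_weight:
  "(\<Sum>s\<in>config (2 * M + 3). weight g M s * v $ pair4 (s (2 * M + 2)) (s (2 * M + 3))) = wsum g M v"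
proof (induction M arbitrary: v)
  case 0
  have "(\<Sum>s\<in>config 3. weight g 0 s * v $ pair4 (s 2) (s 3))
    = (\<Sum>a\<in>UNIV. \<Sum>b\<in>UNIV. \<Sum>c\<in>UNIV. bndL a b c * (g 0 $ pair4 b c * v $ pair4 b c))"
    unfolding sum_config_3 by (simp add: weight_def mult.assoc)
  also have "\<dots> = (\<Sum>b\<in>UNIV. \<Sum>c\<in>UNIV. l $ pair4 b c * (g 0 $ pair4 b c * v $ pair4 b c))"
    unfolding sum_bndL[symmetric] by (simp add: sum_bit algebra_simps)
  also have "\<dots> = l \<bullet> (diag4 (g 0) *v v)"
    unfolding sum_pair4[of "\<lambda>i. l $ i * (g 0 $ i * v $ i)"]
    by (simp add: inner_vec_def diag4_mult)
  finally show ?case by simp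
next
  case (Suc M)
  have j: "2 * Suc M + 3 = 2 * M + 3 + 2" "2 * M + 3 + 1 = 2 * M + 4"
    "2 * Suc M + 3 = 2 * M + 5" "2 * Suc M + 2 = 2 * M + 4" "2 * M + 3 + 2 = 2 * M + 5"
    by simp_all
  have w: "weight g (Suc M) s = weight g M s
      * (patch x w (s (2 * M + 2)) (s (2 * M + 3)) (s (2 * M + 4)) (s (2 * M + 5))
        * g (Suc M) $ pair4 (s (2 * M + 4)) (s (2 * M + 5)))" for s
    unfolding weight_def prod.lessThan_Suc prod.atMost_Suc j(3,4) by (simp only: mult_ac)
  have "(\<Sum>s\<in>config (2 * Suc M + 3). weight g (Suc M) s * v $ pair4 (s (2 * Suc M + 2)) (s (2 * Suc M + 3)))
    = (\<Sum>s\<in>config (2 * M + 3). \<Sum>c\<in>UNIV. \<Sum>d\<in>UNIV. weight g M s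
      * (patch x w (s (2 * M + 2)) (s (2 * M + 3)) c d * g (Suc M) $ pair4 c d) * v $ pair4 c d)"
    unfolding w j(1) sum_config_add_2 unfolding j(2,4,5)
    by (simp add: weight_upd)
  also have "\<dots> = (\<Sum>s\<in>config (2 * M + 3). weight g M s
      * (T *v (diag4 (g (Suc M)) *v v)) $ pair4 (s (2 * M + 2)) (s (2 * M + 3)))"
    by (simp add: Tmat_mult_pair4 diag4_mult sum_distrib_left mult.assoc)
  also have "\<dots> = wsum g (Suc M) v"
    using Suc by simp
  finally show ?case .
qed

end

section \<open>Correlation functions\<close>

definition site_diag :: "nat \<Rightarrow> real^4" where
  "site_diag j = (if even j then vector [0, 0, 1, 1] else vector [0, 1, 0, 1])"

lemma Dsite_eq: "Dsite j = diag4 (site_diag j)"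
  by (simp add: Dsite_def De_def Do_def site_diag_def)

lemma site_diag_pair4: "site_diag j $ pair4 a b = of_bit (if even j then a else b)"
  by (cases a; cases b) (simp_all add: site_diag_def pair4_def)

lemma diag4_one: "diag4 1 *v v = v"
  by (simp add: vec_eq_iff diag4_mult)

lemma diag4_times: "diag4 (a * b) *v v = diag4 a *v (diag4 b *v v)"
  by (simp add: vec_eq_iff diag4_mult)

lemma inner_diag4: "u \<bullet> (diag4 d *v v) = (diag4 d *v u) \<bullet> v" for u v :: "real^4"
  by (simp add: inner_vec_def diag4_mult mult_ac)

lemma matpow_Suc_right: "matpow M d *v (M *v v) = matpow M (Suc d) *v v"
  by (induction d) (simp_all add: matrix_vector_mul_assoc[symmetric])

lemma matpow_Suc_left: "matpow M (Suc d) *v v = M *v (matpow M d *v v)"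
  by (simp add: matrix_vector_mul_assoc)

context driving
begin

lemma l_matpow: "l \<bullet> (matpow T d *v v) = \<tau>1 ^ d * (l \<bullet> v)"
  by (induction d) (simp_all add: matpow_Suc_left l_T del: matpow.simps(2))

end

context rates
begin

lemma wsum_scale: "wsum g M (c *\<^sub>R v) = c * wsum g M v"
  by (induction M arbitrary: v) (simp_all add: matrix_vector_mult_scaleR)

lemma wsum_one:
  assumes "\<And>k. K < k \<Longrightarrow> k \<le> K + d \<Longrightarrow> g k = 1"
  shows "wsum g (K + d) v = wsum g K (matpow T d *v v)"
  using assms
  by (induction d arbitrary: v) (simp_all add: diag4_one matpow_Suc_right del: matpow.simps(2))

lemma wsum_one_r:
  assumes "\<And>k. K < k \<Longrightarrow> k \<le> K + d \<Longrightarrow> g k = 1"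
  shows "wsum g (K + d) r = \<tau>1 ^ d * wsum g K r"
proof -
  have "matpow T d *v r = \<tau>1 ^ d *\<^sub>R r"
    by (induction d) (simp_all add: matpow_Suc_left T_r matrix_vector_mult_scaleR mult_ac del: matpow.simps(2))
  then show ?thesis using wsum_one[of K d g r] assms by (simp add: wsum_scale)
qed

lemma wsum_l:
  assumes "\<And>k. k < K \<Longrightarrow> g k = 1"
  shows "wsum g K v = \<tau>1 ^ K * (l \<bullet> (diag4 (g K) *v v))"
proof (cases K)
  case (Suc M)
  have "wsum g (0 + M) u = \<tau>1 ^ M * (l \<bullet> u)" for u
    using assms Suc by (subst wsum_one) (auto simp: diag4_one l_matpow)
  then show ?thesis using Suc by (simp add: l_T)
qed simp

end

context chain
begin

lemma sum_ansatz:
  "(\<Sum>s\<in>config n. (\<Prod>k\<le>m - 2. g k $ pair4 (s (2 * k + 2)) (s (2 * k + 3))) * ansatz s)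
    = wsum g (m - 2) r"
proof -
  obtain M where M: "m = M + 2" using m by (metis add.commute le_Suc_ex)
  have i: "n - 1 = 2 * M + 3" "n - 2 = 2 * M + 2" "n = 2 * M + 4" "m - 2 = M" by (simp_all add: M)
  have n: "n = Suc (2 * M + 3)" by (simp add: M)
  have "(\<Sum>s\<in>config n. (\<Prod>k\<le>m - 2. g k $ pair4 (s (2 * k + 2)) (s (2 * k + 3))) * ansatz s)
    = (\<Sum>s\<in>config n. weight g M s * bndR (s (2 * M + 2)) (s (2 * M + 3)) (s (2 * M + 4)))"
    unfolding ansatz_def weight_def i(1,2,4) unfolding i(3) by (simp only: mult_ac)
  also have "\<dots> = (\<Sum>s\<in>config (2 * M + 3). \<Sum>b\<in>UNIV. weight g M s * bndR (s (2 * M + 2)) (s (2 * M + 3)) b)"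
    unfolding n sum_config_Suc by (simp add: weight_upd)
  also have "\<dots> = (\<Sum>s\<in>config (2 * M + 3). weight g M s * r $ pair4 (s (2 * M + 2)) (s (2 * M + 3)))"
    unfolding sum_bndR[symmetric] by (simp add: sum_bit distrib_left)
  also have "\<dots> = wsum g M r" by (rule sum_weight)
  finally show ?thesis by (simp add: M)
qed

text \<open>Cell \<open>k\<close> consists of the sites \<open>2 * k + 2\<close> and
  \<open>2 * k + 3\<close>, so site \<open>j\<close> lies in cell \<open>j div 2 - 1\<close>. The
  other cells carry the trivial observable.\<close>

definition site_obs :: "nat \<Rightarrow> nat \<Rightarrow> real^4" where
  "site_obs j k = (if k = j div 2 - 1 then site_diag j else 1)"

lemma prod_site_obs:
  assumes "1 < j" "j < n"
  shows "(\<Prod>k\<le>m - 2. site_obs j k $ pair4 (s (2 * k + 2)) (s (2 * k + 3))) = of_bit (s j)"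
proof -
  define K where "K = j div 2 - 1"
  have K: "K \<le> m - 2" "j = (if even j then 2 * K + 2 else 2 * K + 3)"
    using assms by (auto simp: K_def elim!: evenE oddE)
  have "(\<Prod>k\<le>m - 2. site_obs j k $ pair4 (s (2 * k + 2)) (s (2 * k + 3)))
    = (\<Prod>k\<le>m - 2. if k = K then site_diag j $ pair4 (s (2 * k + 2)) (s (2 * k + 3)) else 1)"
    by (rule prod.cong) (auto simp: site_obs_def K_def)
  also have "\<dots> = site_diag j $ pair4 (s (2 * K + 2)) (s (2 * K + 3))"
    using K(1) by simp
  also have "\<dots> = of_bit (s j)"
    unfolding site_diag_pair4 using K(2) by (cases "even j") simp_all
  finally show ?thesis .
qed

lemma total_ansatz: "(\<Sum>s\<in>config n. ansatz s) = \<tau>1 ^ (m - 2) * (l \<bullet> r)"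
  using sum_ansatz[of "\<lambda>_. 1"] by (simp add: wsum_l diag4_one)

context
  fixes p :: "conf \<Rightarrow> real"
  assumes p: "steady_state m \<alpha> \<beta> \<gamma> \<delta> p"
begin

lemma steady_state_eq: "s \<in> config n \<Longrightarrow> p s = ansatz s / (\<tau>1 ^ (m - 2) * (l \<bullet> r))"
  using steady_state_unique[OF p ansatz_stationary total_ansatz] tau1_pos l_r_pos by simp

lemma density_eq:
  assumes j: "1 < j" "j < n"
  shows "density n p j = l \<bullet> (Dsite j *v r) / (l \<bullet> r)"
proof -
  define K where "K = j div 2 - 1"
  define d where "d = m - 2 - K"
  have d: "m - 2 = K + d" using j by (auto simp: K_def d_def)
  have "density n p j = (\<Sum>s\<in>config n. of_bit (s j) * ansatz s) / (\<tau>1 ^ (m - 2) * (l \<bullet> r))"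
    unfolding density_def sum_divide_distrib by (rule sum.cong) (simp_all add: steady_state_eq)
  also have "(\<Sum>s\<in>config n. of_bit (s j) * ansatz s) = wsum (site_obs j) (m - 2) r"
    unfolding sum_ansatz[symmetric] by (simp add: prod_site_obs[OF j])
  also have "\<dots> = \<tau>1 ^ d * (\<tau>1 ^ K * (l \<bullet> (Dsite j *v r)))"
    unfolding d
    by (subst wsum_one_r) (auto simp: site_obs_def K_def wsum_l Dsite_eq)
  finally show ?thesis
    using tau1_pos by (simp add: d power_add)
qed

lemma corr2_eq:
  assumes j: "1 < j" "j < j'" "j' < n"
  shows "corr2 n p j j' = (Dsite j *v l) \<bullet> (matpow T (j' div 2 - j div 2) *v (Dsite j' *v r))
    / (l \<bullet> (matpow T (j' div 2 - j div 2) *v r))"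
proof -
  define K where "K = j div 2 - 1"
  define e where "e = j' div 2 - j div 2"
  define d where "d = m - 2 - (K + e)"
  have "j div 2 \<le> j' div 2" "0 < j div 2" "j' div 2 < m" using j by auto
  then have K': "j' div 2 - 1 = K + e" and d: "m - 2 = K + e + d"
    by (auto simp: K_def e_def d_def)
  define g where "g k = site_obs j k * site_obs j' k" for k
  have g: "g k = 1" if "k \<noteq> K" "k \<noteq> K + e" for k
    using that by (simp add: g_def site_obs_def K' flip: K_def)
  have "corr2 n p j j'
    = (\<Sum>s\<in>config n. of_bit (s j) * of_bit (s j') * ansatz s) / (\<tau>1 ^ (m - 2) * (l \<bullet> r))"
    unfolding corr2_def sum_divide_distrib by (rule sum.cong) (simp_all add: steady_state_eq)
  also have "(\<Sum>s\<in>config n. of_bit (s j) * of_bit (s j') * ansatz s) = wsum g (m - 2) r"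
    unfolding sum_ansatz[symmetric] g_def using j
    by (simp add: prod.distrib prod_site_obs)
  also have "\<dots> = \<tau>1 ^ d * wsum g (K + e) r"
    unfolding d by (rule wsum_one_r) (auto intro: g)
  also have "wsum g (K + e) r = \<tau>1 ^ K * (l \<bullet> (Dsite j *v (matpow T e *v (Dsite j' *v r))))"
  \<comment> \<open>\<open>e = 0\<close> occurs for even \<open>j\<close> and
    \<open>j' = j + 1\<close>: both sites share a cell, and their diagonal matrices are multiplied
    with no transfer matrix in between.\<close>
  proof (cases e)
    case 0
    then have "g K = site_diag j * site_diag j'"
      using K' by (simp add: g_def site_obs_def flip: K_def)
    then show ?thesis using 0 g
      by (simp add: wsum_l diag4_times Dsite_eq)
  next
    case (Suc c)
    have "g (K + e) = site_diag j'" "g K = site_diag j"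
      using Suc by (auto simp: g_def site_obs_def K' simp flip: K_def)
    then have "wsum g (K + e) r = wsum g (K + c) (T *v (Dsite j' *v r))"
      by (simp add: Suc Dsite_eq)
    also have "\<dots> = wsum g K (matpow T c *v (T *v (Dsite j' *v r)))"
      by (rule wsum_one) (use Suc in \<open>auto intro: g\<close>)
    also have "\<dots> = \<tau>1 ^ K * (l \<bullet> (Dsite j *v (matpow T e *v (Dsite j' *v r))))"
      using g Suc \<open>g K = site_diag j\<close>
      by (subst wsum_l) (auto simp: Dsite_eq matpow_Suc_right simp del: matpow.simps(2))
    finally show ?thesis .
  qed
  finally show ?thesis
    using tau1_pos l_r_pos
    by (simp add: d power_add l_matpow inner_diag4 Dsite_eq flip: e_def)
qed

end

end

section \<open>The subleading part of the transfer matrix\<close>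

context driving
begin

text \<open>In the quantities \<open>a, b, q, h\<close> the entries of the block and the correlation
  values below are short products; they are tied by \<open>a * b = 2 * (a + b) - q\<close>.\<close>

definition a :: real where "a = lam + 2"
definition b :: real where "b = mu + 2"
definition q :: real where "q = 4 - lam * mu"
definition h :: real where "h = a + b + q"

lemma params: "A = a - q" "B = b - q" "lam = a - 2" "mu = b - 2" "a * b = 2 * (a + b) - q"
  by (simp_all add: Apar_def Bpar_def a_def b_def q_def algebra_simps)

lemma pos [simp]: "0 < a" "0 < b" "0 < q" "0 < h"
  using lam_bounds mu_bounds lam_mu_less by (auto simp: a_def b_def q_def h_def)

lemma nonzero' [simp]: "a \<noteq> 0" "b \<noteq> 0" "q \<noteq> 0" "h \<noteq> 0"
  using pos by (auto simp del: pos)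

lemma x_eq: "x = - (a * B / (A * A))" and xw_eq: "x * w = a * b / (A * B)"
  using xw by (simp_all add: xi_def a_def b_def power2_eq_square)

lemma tau1_eq: "\<tau>1 = q * q / (A * B)"
  by (simp add: tau1_def q_def power2_eq_square algebra_simps)

text \<open>
  On the intersection of the range of \<open>T\<close> with the orthogonal complement of \<open>l\<close>, components 1
  and 4 are coordinates, in which \<open>T\<close> is the following \<open>2 \<times> 2\<close> matrix.
\<close>

definition subleading :: "(real^4) set" where
  "subleading = {y. y $ 3 = x * w * y $ 1 \<and> l \<bullet> y = 0}"

definition N11 :: real where "N11 = lam * b * b / (A * B)"
definition N14 :: real where "N14 = (mu - lam) / B"
definition N41 :: real where "N41 = a * b * (lam - mu) / (A * A * B)"
definition N44 :: real where "N44 = mu * a * a / (A * B)"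

definition tr :: real where "tr = N11 + N44"
definition dt :: real where "dt = N11 * N44 - N14 * N41"

text \<open>Rows 1 and 3 of \<open>T\<close> are proportional, which gives the first condition; the
  second holds because \<open>l\<close> is a left eigenvector.\<close>

lemma T_subleading: "l \<bullet> u = 0 \<Longrightarrow> T *v u \<in> subleading"
  by (simp add: subleading_def Tmat_mult l_T)

lemma subleading_2:
  assumes "y \<in> subleading"
  shows "y $ 2 = (b / B - 1) * y $ 1 - A / B * y $ 4"
proof -
  have y3: "y $ 3 = a * b / (A * B) * y $ 1" and ly: "l \<bullet> y = 0"
    using assms by (simp_all add: subleading_def xw_eq)
  have "2 * y $ 1 + 2 * y $ 2 - 2 * A / a * (a * b / (A * B) * y $ 1) + 2 * A / B * y $ 4 = 0"
    unfolding y3[symmetric] using ly by (simp add: inner4 l_nth flip: a_def)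
  moreover have "2 * A / a * (a * b / (A * B) * y $ 1) = 2 * (b / B * y $ 1)"
    by simp
  moreover have "2 * A / B * y $ 4 = 2 * (A / B * y $ 4)" by simp
  moreover have "(b / B - 1) * y $ 1 = b / B * y $ 1 - y $ 1" by (simp only: left_diff_distrib mult_1_left)
  ultimately show ?thesis by linarith
qed

lemma T_coords:
  assumes y: "y \<in> subleading"
  shows "(T *v y) $ 1 = N11 * y $ 1 + N14 * y $ 4" "(T *v y) $ 4 = N41 * y $ 1 + N44 * y $ 4"
proof -
  have y3: "y $ 3 = a * b / (A * B) * y $ 1"
    using y by (simp add: subleading_def xw_eq)
  have c: "b / B + a * b / (A * B) = N11" "1 - A / B = N14"
    "x * (b / B) + a * b / (A * B) = N41" "a * b / (A * B) - x * (A / B) = N44"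
    unfolding x_eq N11_def N14_def N41_def N44_def
    by (simp_all add: divide_simps) (insert params, algebra+)
  show "(T *v y) $ 1 = N11 * y $ 1 + N14 * y $ 4"
    unfolding c[symmetric] Tmat_mult subleading_2[OF y] y3 by (simp add: algebra_simps)
  show "(T *v y) $ 4 = N41 * y $ 1 + N44 * y $ 4"
    unfolding c(3,4)[symmetric] Tmat_mult subleading_2[OF y] y3 xw_eq by (simp add: algebra_simps)
qed

lemma T_subleading': "y \<in> subleading \<Longrightarrow> T *v y \<in> subleading"
  by (rule T_subleading) (simp add: subleading_def)

lemma subleading_eqI:
  assumes "y \<in> subleading" "y' \<in> subleading" "y $ 1 = y' $ 1" "y $ 4 = y' $ 4"
  shows "y = y'"
proof -
  have "y $ 3 = y' $ 3" using assms by (simp add: subleading_def)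
  then show ?thesis
    using assms subleading_2[of y] subleading_2[of y'] by (simp add: vec_eq_iff forall_4)
qed

lemma subleading_lin: "y \<in> subleading \<Longrightarrow> y' \<in> subleading \<Longrightarrow> c *\<^sub>R y + c' *\<^sub>R y' \<in> subleading"
  by (simp add: subleading_def inner_add_right algebra_simps)

text \<open>The Cayley-Hamilton theorem for the 2 x 2 block, compared in the two
  coordinates.\<close>

lemma T_recurrence:
  assumes y: "y \<in> subleading"
  shows "T *v (T *v y) = tr *\<^sub>R (T *v y) + (- dt) *\<^sub>R y"
proof (rule subleading_eqI)
  show "T *v (T *v y) \<in> subleading" "tr *\<^sub>R (T *v y) + (- dt) *\<^sub>R y \<in> subleading"
    using y by (auto intro: T_subleading' simp del: scaleR_minus_left intro!: subleading_lin)
qed (simp_all add: T_coords y T_subleading' tr_def dt_def algebra_simps)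

lemma T_recurrence_equal:
  assumes y: "y \<in> subleading" and eq: "lam = mu"
  shows "T *v y = N11 *\<^sub>R y"
proof (rule subleading_eqI)
  have "N11 *\<^sub>R y + 0 *\<^sub>R y \<in> subleading" by (intro subleading_lin y)
  then show "N11 *\<^sub>R y \<in> subleading" by simp
  have "N14 = 0" "N41 = 0" "N44 = N11"
    unfolding N14_def N41_def N44_def N11_def a_def b_def using eq by simp_all
  then show "(T *v y) $ 1 = (N11 *\<^sub>R y) $ 1" "(T *v y) $ 4 = (N11 *\<^sub>R y) $ 4"
    by (simp_all add: T_coords y)
qed (use y in \<open>simp add: T_subleading'\<close>)

text \<open>The factor of the determinant that can vanish: by \<open>dt_eq\<close> and
  \<open>tau_prod\<close>, one of the two subleading eigenvalues is 0 exactly for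
  \<open>kap = 0\<close>.\<close>

definition kap :: real where "kap = a + b - q"

lemma kap_eq: "kap = lam * mu + lam + mu"
  by (simp add: kap_def a_def b_def q_def)

lemma dt_eq: "dt = a * b * kap\<^sup>2 / (A * B)\<^sup>2"
  unfolding dt_def N11_def N14_def N41_def N44_def
  by (simp add: divide_simps) (insert params kap_def, algebra)

lemma tau_sum: "tau lam mu 2 + tau lam mu 3 = of_real tr"
proof -
  have "tau lam mu 2 + tau lam mu 3
    = of_real ((lam * mu * (lam + mu + 8) + 4 * (lam + mu)) / (A * B))"
    by (simp add: tau_def tau_pm_def field_simps)
  also have "(lam * mu * (lam + mu + 8) + 4 * (lam + mu)) / (A * B) = tr"
    unfolding tr_def N11_def N44_def a_def b_def
    by (simp add: divide_simps) algebra
  finally show ?thesis .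
qed

text \<open>The square root occurs only through its square, and \<open>tau_sum\<close> is free of
  it; so the two numbers are the roots of the characteristic polynomial of the block, whatever the
  sign of the discriminant.\<close>

lemma tau_prod: "tau lam mu 2 * tau lam mu 3 = of_real dt"
proof -
  define u where "u = lam * mu * (lam + mu + 8) + 4 * (lam + mu)"
  have "csqrt (of_real (discr lam mu)) * csqrt (of_real (discr lam mu)) = of_real (discr lam mu)"
    by (metis power2_csqrt power2_eq_square)
  then have "tau lam mu 2 * tau lam mu 3
    = of_real ((u * u - (lam - mu) * (lam - mu) * discr lam mu) / (2 * A * B * (2 * A * B)))"
    unfolding tau_def tau_pm_def u_def[symmetric]
    by (simp add: algebra_simps)
  also have "(u * u - (lam - mu) * (lam - mu) * discr lam mu) / (2 * A * B * (2 * A * B)) = dt"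
  proof -
    have "u * u - (lam - mu) * (lam - mu) * discr lam mu = 4 * (a * b * kap\<^sup>2)"
      unfolding u_def discr_def a_def b_def kap_eq by algebra
    then show ?thesis by (simp add: dt_eq power2_eq_square)
  qed
  finally show ?thesis .
qed

section \<open>Subleading eigenvalues\<close>

lemma kap_less_q: "\<bar>kap\<bar> < q"
proof -
  have "0 < (1 + lam) * (1 + mu)" "(1 + lam) * (1 + mu) < 4"
    using lam_bounds mu_bounds mult_strict_mono[of "1 + lam" 2 "1 + mu" 2] by auto
  moreover have "kap = (1 + lam) * (1 + mu) - 1" by (simp add: kap_eq algebra_simps)
  moreover have "3 < q" using lam_mu_less by (simp add: q_def)
  ultimately show ?thesis by linarith
qed

text \<open>Since \<open>a * b = q + 2 * kap\<close> and \<open>\<bar>kap\<bar> < q\<close>, the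
  numerator of \<open>dt\<close> is below \<open>3 * q ^ 3\<close>, and
  \<open>3 < q\<close>.\<close>

lemma dt_less: "dt < \<tau>1\<^sup>2"
proof -
  have "3 < q" using lam_mu_less by (simp add: q_def)
  have "a * b = q + 2 * kap" using params by (simp add: kap_def)
  then have "a * b * kap\<^sup>2 \<le> (q + 2 * \<bar>kap\<bar>) * kap\<^sup>2"
    by (intro mult_right_mono) auto
  also have "\<dots> < (q + 2 * q) * q\<^sup>2"
    using kap_less_q abs_le_square_iff[of q kap] pos(1-3)
    by (intro mult_le_less_imp_less) (auto simp del: pos)
  also have "\<dots> \<le> (q * q) * q\<^sup>2"
    using \<open>3 < q\<close> by (intro mult_right_mono) auto
  finally have "a * b * kap\<^sup>2 < (q * q)\<^sup>2" by (simp add: power2_eq_square)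
  then show ?thesis
    unfolding dt_eq tau1_eq power_divide by (intro divide_strict_right_mono) auto
qed

text \<open>The characteristic polynomial of the block at \<open>\<tau>1\<close> and
  \<open>- \<tau>1\<close>. The product of the off-diagonal entries is not positive, so it can only
  help, and the diagonal entries are smaller than \<open>\<tau>1\<close> in modulus because
  \<open>a\<close> and \<open>b\<close> are below \<open>q\<close>.\<close>

lemma char_poly_pos: "0 < \<tau>1\<^sup>2 - tr * \<tau>1 + dt" "0 < \<tau>1\<^sup>2 + tr * \<tau>1 + dt"
proof -
  have q1: "b < q" "a < q" using A_neg B_neg params by auto
  have sq: "b * b < q * q" "a * a < q * q"
    using q1 by (auto intro!: mult_strict_mono simp: less_imp_le)
  have *: "\<bar>lam\<bar> * (b * b) \<le> 1 * (b * b)" "\<bar>mu\<bar> * (a * a) \<le> 1 * (a * a)"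
    using lam_bounds mu_bounds by (auto intro!: mult_right_mono)
  have lt: "\<bar>lam * b * b\<bar> < q * q" "\<bar>mu * a * a\<bar> < q * q"
  proof -
    have "\<bar>lam * b * b\<bar> = \<bar>lam\<bar> * (b * b)" "\<bar>mu * a * a\<bar> = \<bar>mu\<bar> * (a * a)"
      by (simp_all add: abs_mult mult.assoc)
    then show "\<bar>lam * b * b\<bar> < q * q" "\<bar>mu * a * a\<bar> < q * q"
      using sq * by linarith+
  qed
  have AB: "0 < A * B" using A_neg B_neg by (rule mult_neg_neg)
  have e1: "\<tau>1\<^sup>2 - tr * \<tau>1 + dt
      = ((q * q - lam * b * b) * (q * q - mu * a * a) + (lam - mu)\<^sup>2 * a * b) / (A * B)\<^sup>2"
    unfolding tau1_eq tr_def dt_def N11_def N44_def N14_def N41_def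
    by (simp add: divide_simps) algebra
  have e2: "\<tau>1\<^sup>2 + tr * \<tau>1 + dt
      = ((q * q + lam * b * b) * (q * q + mu * a * a) + (lam - mu)\<^sup>2 * a * b) / (A * B)\<^sup>2"
    unfolding tau1_eq tr_def dt_def N11_def N44_def N14_def N41_def
    by (simp add: divide_simps) algebra
  have n: "0 \<le> (lam - mu)\<^sup>2 * a * b" by (simp add: less_imp_le)
  have "0 < (q * q - lam * b * b) * (q * q - mu * a * a)"
    using lt by (intro mult_pos_pos) auto
  with n AB show "0 < \<tau>1\<^sup>2 - tr * \<tau>1 + dt" unfolding e1 by (intro divide_pos_pos) auto
  have "0 < (q * q + lam * b * b) * (q * q + mu * a * a)"
    using lt by (intro mult_pos_pos) auto
  with n AB show "0 < \<tau>1\<^sup>2 + tr * \<tau>1 + dt" unfolding e2 by (intro divide_pos_pos) auto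
qed

end

text \<open>The Schur-Cohn (Jury) criterion for a real quadratic, scaled to radius \<open>t\<close>.
  Non-real roots are conjugate with squared modulus \<open>d\<close>. For real roots the last two
  conditions place both on the same side of \<open>t\<close> and of \<open>- t\<close>, and
  \<open>d < t\<^sup>2\<close> rules out the outer sides.\<close>

lemma cmod_less_quadratic:
  fixes z w :: complex and s d t :: real
  assumes sum: "z + w = of_real s" and prod: "z * w = of_real d"
    and t: "0 < t" "d < t\<^sup>2" "0 < t\<^sup>2 - s * t + d" "0 < t\<^sup>2 + s * t + d"
  shows "cmod z < t"
proof (cases "Im z = 0")
  case False
  have "w = of_real s - z" using sum by (simp add: algebra_simps)
  then have w: "Re w = s - Re z" "Im w = - Im z" by simp_all
  have "Im (z * w) = 0" using prod by simp
  then have "s = 2 * Re z" using False by (simp add: w algebra_simps)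
  then have "w = cnj z" using w by (simp add: complex_eq_iff)
  then have "complex_of_real ((cmod z)\<^sup>2) = of_real d"
    using prod complex_norm_square[of z] by simp
  then have "(cmod z)\<^sup>2 = d" by (simp only: of_real_eq_iff)
  then show ?thesis using t by (intro power2_less_imp_less[of "cmod z" t]) auto
next
  case True
  define u v where "u = Re z" and "v = Re w"
  have z: "z = of_real u" using True by (simp add: u_def complex_eq_iff)
  have "Im (z + w) = 0" using sum by simp
  then have "Im w = 0" using True by simp
  then have w: "w = of_real v" by (simp add: v_def complex_eq_iff)
  have s: "s = u + v" and d: "d = u * v"
    using sum prod unfolding z w by (simp_all flip: of_real_add of_real_mult)
  have p: "0 < (t - u) * (t - v)" "0 < (t + u) * (t + v)"
    using t unfolding s d by (simp_all add: power2_eq_square algebra_simps)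
  have "u < t"
  proof (rule ccontr)
    assume "\<not> u < t"
    then have "t \<le> u" "t \<le> v" using p(1) by (auto simp: zero_less_mult_iff)
    then have "t * t \<le> u * v" using t by (intro mult_mono) auto
    then show False using t unfolding d by (simp add: power2_eq_square)
  qed
  moreover have "- t < u"
  proof (rule ccontr)
    assume "\<not> - t < u"
    then have "t \<le> - u" "t \<le> - v" using p(2) by (auto simp: zero_less_mult_iff)
    then have "t * t \<le> (- u) * (- v)" using t by (intro mult_mono) auto
    then show False using t unfolding d by (simp add: power2_eq_square)
  qed
  ultimately show ?thesis unfolding z by simp
qed

context driving
begin

lemma tau_less: "cmod (tau lam mu 2) < \<tau>1" "cmod (tau lam mu 3) < \<tau>1"
  using cmod_less_quadratic[OF tau_sum tau_prod tau1_pos dt_less char_poly_pos]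
    cmod_less_quadratic[of "tau lam mu 3" "tau lam mu 2" tr dt, OF _ _ tau1_pos dt_less char_poly_pos]
    tau_sum tau_prod by (auto simp: add.commute mult.commute)

definition \<theta> :: real where "\<theta> = cmod (tau_sub lam mu)"

lemma theta_max: "\<theta> = max (cmod (tau lam mu 2)) (cmod (tau lam mu 3))"
  by (simp add: \<theta>_def tau_sub_def max_def)

lemma theta_less: "\<theta> < \<tau>1"
  using tau_less by (simp add: theta_max)

lemma lam_mu_zero: "lam = 0 \<and> mu = 0" if "kap = 0" "lam * mu = 0"
proof -
  have "lam + mu = 0" using that unfolding kap_eq by linarith
  with that(2) show ?thesis by auto
qed

text \<open>If both eigenvalues vanish, the determinant gives
  \<open>lam + mu = - (lam * mu)\<close>; the numerator of the trace then becomes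
  \<open>lam * mu * (4 - lam * mu)\<close>, which forces both parameters to be 0.\<close>

lemma theta_pos:
  assumes "generic_driving lam mu"
  shows "0 < \<theta>"
proof (rule ccontr)
  assume "\<not> 0 < \<theta>"
  then have "tau lam mu 2 = 0" "tau lam mu 3 = 0"
    by (auto simp: theta_max max_def not_less split: if_splits)
  then have "tr = 0" "dt = 0" using tau_sum tau_prod by auto
  then have k: "kap = 0" by (simp add: dt_eq)
  have "tr * (A * B) = lam * b * b + mu * a * a" by (simp add: tr_def N11_def N44_def add_divide_distrib[symmetric])
  then have "lam * b * b + mu * a * a = 0" using \<open>tr = 0\<close> by simp
  moreover have "lam * b * b + mu * a * a = (lam + mu) * (lam * mu + 4) + 8 * (lam * mu)"
    by (simp add: a_def b_def algebra_simps)
  moreover have "lam + mu = - (lam * mu)" using k by (simp add: kap_eq)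
  ultimately have "(- (lam * mu)) * (lam * mu + 4) + 8 * (lam * mu) = 0" by simp
  then have "(lam * mu) * (4 - lam * mu) = 0" by algebra
  then have "lam * mu = 0 \<or> 4 - lam * mu = 0" by (simp only: mult_eq_0_iff)
  then have "lam * mu = 0" using lam_mu_less by linarith
  then have "lam = 0 \<and> mu = 0" by (rule lam_mu_zero[OF k])
  then show False using assms unfolding generic_driving_def by blast
qed

end

section \<open>Two-term recurrences\<close>

lemma recurrence_difference:
  fixes c :: "nat \<Rightarrow> complex"
  assumes "\<And>k. c (Suc (Suc k)) = (z + w) * c (Suc k) - z * w * c k"
  shows "c (Suc k) - w * c k = z ^ k * (c 1 - w * c 0)"
proof (induction k)
  case (Suc k)
  have "c (Suc (Suc k)) - w * c (Suc k) = z * (c (Suc k) - w * c k)"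
    unfolding assms by (simp add: algebra_simps)
  then show ?case using Suc by (simp add: mult.assoc)
qed (simp add: One_nat_def)

text \<open>For \<open>z \<noteq> w\<close> the sequence is a combination of two geometric ones. A
  double root would in general bring in a factor \<open>k\<close>, which is why the coalescence
  curve is excluded from generic driving.\<close>

lemma recurrence_bound:
  fixes c :: "nat \<Rightarrow> real" and z w :: complex
  assumes rec: "\<And>k. complex_of_real (c (Suc (Suc k))) = (z + w) * c (Suc k) - z * w * c k"
    and "z \<noteq> w" "cmod z \<le> t" "cmod w \<le> t"
  shows "\<exists>K. \<forall>k. \<bar>c k\<bar> \<le> K * t ^ k"
proof -
  define e e' where "e = c 1 - w * c 0" and "e' = c 1 - z * c 0"
  have "\<bar>c k\<bar> \<le> (cmod e + cmod e') / cmod (z - w) * t ^ k" for k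
  proof -
    have "c (Suc k) - w * c k = z ^ k * e" "c (Suc k) - z * c k = w ^ k * e'"
      using recurrence_difference[of "\<lambda>k. complex_of_real (c k)" z w k]
        recurrence_difference[of "\<lambda>k. complex_of_real (c k)" w z k] rec
      by (simp_all add: e_def e'_def ac_simps)
    then have "(z - w) * c k = z ^ k * e - w ^ k * e'"
      by (simp add: algebra_simps)
    then have "cmod (z - w) * \<bar>c k\<bar> = cmod (z ^ k * e - w ^ k * e')"
      by (metis norm_mult norm_of_real)
    also have "\<dots> \<le> cmod z ^ k * cmod e + cmod w ^ k * cmod e'"
      by (rule order_trans[OF norm_triangle_ineq4]) (simp add: norm_mult norm_power)
    also have "\<dots> \<le> t ^ k * cmod e + t ^ k * cmod e'"
      using assms by (intro add_mono mult_right_mono power_mono) auto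
    finally show ?thesis using \<open>z \<noteq> w\<close> by (simp add: field_simps)
  qed
  then show ?thesis by blast
qed

text \<open>If \<open>c k\<close> were of smaller order than \<open>cmod z ^ k\<close>, so would be
  \<open>c (Suc k) - w * c k\<close>; but this is a nonzero multiple of \<open>z ^ k\<close>. The
  argument also covers roots of equal modulus.\<close>

lemma recurrence_not_vanishing:
  fixes c :: "nat \<Rightarrow> real" and z w :: complex
  assumes rec: "\<And>k. complex_of_real (c (Suc (Suc k))) = (z + w) * c (Suc k) - z * w * c k"
    and ne: "complex_of_real (c 1) \<noteq> w * c 0" and z: "z \<noteq> 0"
  shows "\<not> (\<lambda>k. c k / cmod z ^ k) \<longlonglongrightarrow> 0"
proof
  define t where "t = cmod z"
  have t: "0 < t" using z by (simp add: t_def)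
  assume "(\<lambda>k. c k / cmod z ^ k) \<longlonglongrightarrow> 0"
  then have lim: "(\<lambda>k. c k / t ^ k) \<longlonglongrightarrow> 0" by (simp add: t_def)
  then have "(\<lambda>k. t * \<bar>c (Suc k) / t ^ Suc k\<bar> + cmod w * \<bar>c k / t ^ k\<bar>) \<longlonglongrightarrow> t * \<bar>0\<bar> + cmod w * \<bar>0\<bar>"
    by (intro tendsto_intros LIMSEQ_Suc)
  then have "(\<lambda>k. t * \<bar>c (Suc k) / t ^ Suc k\<bar> + cmod w * \<bar>c k / t ^ k\<bar>) \<longlonglongrightarrow> 0" by simp
  then have "cmod (c 1 - w * c 0) \<le> 0"
  proof (rule LIMSEQ_le_const)
    have "cmod (c 1 - w * c 0) \<le> t * \<bar>c (Suc k) / t ^ Suc k\<bar> + cmod w * \<bar>c k / t ^ k\<bar>" for k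
    proof -
      have "c (Suc k) - w * c k = z ^ k * (c 1 - w * c 0)"
        using recurrence_difference[of "\<lambda>k. complex_of_real (c k)" z w k] rec by simp
      then have "t ^ k * cmod (c 1 - w * c 0) = cmod (c (Suc k) - w * c k)"
        by (simp add: t_def norm_mult norm_power)
      also have "\<dots> \<le> \<bar>c (Suc k)\<bar> + cmod w * \<bar>c k\<bar>"
        by (rule order_trans[OF norm_triangle_ineq4]) (simp add: norm_mult)
      finally show ?thesis using t by (simp add: field_simps)
    qed
    then show "\<exists>N. \<forall>k\<ge>N. cmod (c 1 - w * c 0) \<le> t * \<bar>c (Suc k) / t ^ Suc k\<bar> + cmod w * \<bar>c k / t ^ k\<bar>"
      by blast
  qed
  then show False using ne by simp
qed

context driving
begin

section \<open>Decay of the connected correlations\<close>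

lemma matpow_subleading: "y \<in> subleading \<Longrightarrow> matpow T k *v y \<in> subleading"
  by (induction k) (simp_all add: matpow_Suc_left T_subleading' del: matpow.simps(2))

lemma inner_recurrence:
  assumes "y \<in> subleading"
  shows "f \<bullet> (matpow T (Suc (Suc k)) *v y) = tr * (f \<bullet> (matpow T (Suc k) *v y)) - dt * (f \<bullet> (matpow T k *v y))"
  using T_recurrence[OF matpow_subleading[OF assms, of k]]
  by (simp add: matpow_Suc_left inner_add_right inner_diff_right del: matpow.simps(2))

lemma inner_recurrence_complex:
  fixes z z' :: complex
  assumes "y \<in> subleading" "z + z' = of_real tr" "z * z' = of_real dt"
  shows "complex_of_real (f \<bullet> (matpow T (Suc (Suc k)) *v y))
    = (z + z') * of_real (f \<bullet> (matpow T (Suc k) *v y)) - z * z' * of_real (f \<bullet> (matpow T k *v y))"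
  unfolding inner_recurrence[OF assms(1)] assms(2,3) by simp

lemma matpow_equal:
  assumes "y \<in> subleading" "lam = mu"
  shows "matpow T k *v y = N11 ^ k *\<^sub>R y"
  by (induction k)
    (simp_all add: matpow_Suc_left T_recurrence_equal[OF assms] matrix_vector_mult_scaleR mult.commute del: matpow.simps(2))

lemma theta_equal:
  assumes "lam = mu"
  shows "\<theta> = \<bar>N11\<bar>"
proof -
  have "N14 = 0" "N44 = N11"
    unfolding N14_def N44_def N11_def a_def b_def using assms by simp_all
  then have s: "tau lam mu 2 + tau lam mu 3 = 2 * of_real N11"
    and p: "tau lam mu 2 * tau lam mu 3 = of_real N11 * of_real N11"
    using tau_sum tau_prod by (simp_all add: tr_def dt_def)
  have "(tau lam mu 2 - of_real N11) * (tau lam mu 2 - of_real N11) = 0"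
    using s p by algebra
  then have "tau lam mu 2 = of_real N11" by simp
  moreover from this have "tau lam mu 3 = of_real N11" using s by simp
  ultimately show ?thesis by (simp add: theta_max)
qed

lemma tau_distinct:
  assumes "generic_driving lam mu" "lam \<noteq> mu"
  shows "tau lam mu 2 \<noteq> tau lam mu 3"
proof -
  have "csqrt (of_real (discr lam mu)) \<noteq> 0"
    using assms by (simp add: generic_driving_def)
  moreover have "tau lam mu 2 - tau lam mu 3
    = of_real (lam - mu) * csqrt (of_real (discr lam mu)) / of_real (A * B)"
    by (simp add: tau_def tau_pm_def field_simps)
  ultimately show ?thesis using assms by auto
qed

lemma inner_bound:
  assumes gen: "generic_driving lam mu" and u: "l \<bullet> u = 0"
  shows "\<exists>K. \<forall>k. \<bar>f \<bullet> (matpow T k *v u)\<bar> \<le> K * \<theta> ^ k"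
proof -
  define y where "y = T *v u"
  have y: "y \<in> subleading" using u by (simp add: y_def T_subleading)
  have "\<exists>K. \<forall>k. \<bar>f \<bullet> (matpow T k *v y)\<bar> \<le> K * \<theta> ^ k"
  proof (cases "lam = mu")
    case True
    show ?thesis
      by (intro exI[of _ "\<bar>f \<bullet> y\<bar>"])
         (simp add: matpow_equal[OF y True] theta_equal[OF True] abs_mult power_abs mult.commute)
  next
    case False
    show ?thesis
      by (rule recurrence_bound[of "\<lambda>k. f \<bullet> (matpow T k *v y)", OF inner_recurrence_complex[OF y tau_sum tau_prod] tau_distinct[OF gen False]])
         (simp_all add: theta_max)
  qed
  then obtain K where K: "\<bar>f \<bullet> (matpow T k *v y)\<bar> \<le> K * \<theta> ^ k" for k by blast
  have "\<bar>f \<bullet> (matpow T k *v u)\<bar> \<le> max \<bar>f \<bullet> u\<bar> (K / \<theta>) * \<theta> ^ k" for k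
  \<comment> \<open>\<open>k = 0\<close> is separate, since \<open>u\<close> need not lie in the
    range of \<open>T\<close>.\<close>
  proof (cases k)
    case (Suc j)
    have "\<bar>f \<bullet> (matpow T k *v u)\<bar> \<le> K * \<theta> ^ j"
      using K[of j] by (simp add: Suc y_def matpow_Suc_right del: matpow.simps(2))
    also have "\<dots> = K / \<theta> * \<theta> ^ k" using theta_pos[OF gen] by (simp add: Suc)
    also have "\<dots> \<le> max \<bar>f \<bullet> u\<bar> (K / \<theta>) * \<theta> ^ k"
      using theta_pos[OF gen] by (intro mult_right_mono) auto
    finally show ?thesis .
  qed simp
  then show ?thesis by blast
qed

definition rho :: "nat \<Rightarrow> real" where
  "rho j = l \<bullet> (Dsite j *v r) / (l \<bullet> r)"

text \<open>\<open>Dsite j *v r\<close> without its component along the leading eigenvector;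
  dropping that component removes exactly the disconnected part of the correlation.\<close>

definition fluct :: "nat \<Rightarrow> real^4" where
  "fluct j = Dsite j *v r - rho j *\<^sub>R r"

definition conn :: "nat \<Rightarrow> nat \<Rightarrow> nat \<Rightarrow> real" where
  "conn i j k = (Dsite i *v l) \<bullet> (matpow T k *v (Dsite j *v r)) / (l \<bullet> (matpow T k *v r)) - rho i * rho j"

lemma l_fluct: "l \<bullet> fluct j = 0"
  using l_r_pos by (simp add: fluct_def rho_def inner_diff_right)

lemma matpow_r: "matpow T k *v r = \<tau>1 ^ k *\<^sub>R r"
  by (induction k) (simp_all add: matpow_Suc_left T_r matrix_vector_mult_scaleR mult.commute del: matpow.simps(2))

lemma conn_eq: "conn i j k = (Dsite i *v l) \<bullet> (matpow T k *v fluct j) / (\<tau>1 ^ k * (l \<bullet> r))"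
proof -
  have "(Dsite i *v l) \<bullet> r = rho i * (l \<bullet> r)"
    using l_r_pos by (simp add: rho_def Dsite_eq inner_diag4)
  moreover have "matpow T k *v fluct j = matpow T k *v (Dsite j *v r) - (rho j * \<tau>1 ^ k) *\<^sub>R r"
    by (simp add: fluct_def matrix_vector_mult_diff_distrib matrix_vector_mult_scaleR matpow_r)
  ultimately have "(Dsite i *v l) \<bullet> (matpow T k *v fluct j)
    = (Dsite i *v l) \<bullet> (matpow T k *v (Dsite j *v r)) - rho i * rho j * (\<tau>1 ^ k * (l \<bullet> r))"
    by (simp add: inner_diff_right)
  moreover have nz: "\<tau>1 ^ k * (l \<bullet> r) \<noteq> 0"
    using l_r_pos tau1_pos by simp
  ultimately show ?thesis
    unfolding conn_def l_matpow by (simp only: diff_divide_distrib nonzero_mult_div_cancel_right[OF nz])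
qed

lemma conn_bound:
  assumes "generic_driving lam mu"
  shows "\<exists>K. \<forall>k. \<bar>conn i j k\<bar> \<le> K * (\<theta> / \<tau>1) ^ k"
proof -
  obtain K where "\<bar>(Dsite i *v l) \<bullet> (matpow T k *v fluct j)\<bar> \<le> K * \<theta> ^ k" for k
    using inner_bound[OF assms l_fluct] by blast
  then have "\<bar>conn i j k\<bar> \<le> K / (l \<bullet> r) * (\<theta> / \<tau>1) ^ k" for k
    using l_r_pos tau1_pos by (simp add: conn_eq abs_mult power_divide field_simps)
  then show ?thesis by blast
qed

section \<open>The first terms of the correlation sequences\<close>

lemma l_r_eq: "l \<bullet> r = - (4 * h / B)"
  unfolding inner4 l_nth r_nth
  by (simp add: divide_simps) (simp only: Apar_def Bpar_def h_def a_def b_def q_def, algebra)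

lemma rho_eq: "rho j = (a + b) / h"
proof -
  have "l \<bullet> (Dsite j *v r) = - (4 * (a + b) / B)"
    by (auto simp: Dsite_eq site_diag_def inner4 diag4_mult l_nth r_nth divide_simps simp flip: a_def b_def)
  moreover have "- (4 * u / B) / - (4 * h / B) = u / h" for u by simp
  ultimately show ?thesis unfolding rho_def l_r_eq by (simp only:)
qed

lemma fluct_T: "T *v fluct j = T *v (Dsite j *v r) - ((a + b) / h * \<tau>1) *\<^sub>R r"
  by (simp add: fluct_def matrix_vector_mult_diff_distrib matrix_vector_mult_scaleR T_r rho_eq)

lemma Dsite_r_nth: "(Dsite j *v r) $ 1 = 0" "(Dsite j *v r) $ 2 = (if even j then 0 else r $ 2)"
  "(Dsite j *v r) $ 3 = (if even j then r $ 3 else 0)" "(Dsite j *v r) $ 4 = r $ 4"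
  by (simp_all add: Dsite_eq site_diag_def diag4_mult)

lemma r_nth': "r $ 1 = 2" "r $ 2 = - (2 * b / B)" "r $ 3 = 2 * a * b / (A * B)" "r $ 4 = - (2 * a / A)"
  by (simp_all add: r_nth a_def b_def)

lemmas polys = Apar_def Bpar_def h_def a_def b_def q_def

text \<open>Components 1 and 4 determine the vector, because one application of \<open>T\<close> has
  moved it into \<open>subleading\<close>.\<close>

lemma fluct_even:
  assumes "even j"
  shows "(T *v fluct j) $ 1 = 2 * q * (a * (a + b) - b * q) / (A * B * h)"
    and "(T *v fluct j) $ 4 = 2 * a * q * (a * q - b * (a + b)) / (A * A * B * h)"
  unfolding fluct_T vector_minus_component vector_scaleR_component Tmat_mult Dsite_r_nth r_nth'
    tau1_eq xw_eq
  by (simp_all add: assms divide_simps) (simp_all only: polys, algebra+)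

lemma fluct_odd:
  assumes "odd j"
  shows "(T *v fluct j) $ 1 = 2 * ((a + b) * (a + b) * q - 2 * a * b * h) / (A * B * h)"
    and "(T *v fluct j) $ 4 = 2 * a * ((b * B - a * b) * h + (a + b) * q * q) / (A * A * B * h)"
  unfolding fluct_T vector_minus_component vector_scaleR_component Tmat_mult Dsite_r_nth r_nth'
    tau1_eq xw_eq unfolding x_eq
  by (simp_all add: assms divide_simps) (simp_all only: polys, algebra+)

lemma site_even:
  assumes "y \<in> subleading" "even i"
  shows "(Dsite i *v l) \<bullet> y = 2 / B * (A * y $ 4 - b * y $ 1)"
proof -
  have y3: "y $ 3 = a * b / (A * B) * y $ 1"
    using assms(1) by (simp add: subleading_def xw_eq)
  show ?thesis
    using assms(2) unfolding inner4 Dsite_eq diag4_mult site_diag_def l_nth y3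
    by (simp add: divide_simps flip: a_def)
qed

lemma site_odd:
  assumes "y \<in> subleading" "odd i"
  shows "(Dsite i *v l) \<bullet> y = 2 * q / B * y $ 1"
proof -
  have "b - B = q" using params(2) by simp
  then have "b / B - 1 = q / B" by (metis diff_divide_distrib divide_self nonzero(2))
  then show ?thesis
    using assms(2) unfolding inner4 Dsite_eq diag4_mult site_diag_def l_nth subleading_2[OF assms(1)]
    by (simp add: algebra_simps)
qed

lemma fluct_subleading: "T *v fluct j \<in> subleading"
  by (intro T_subleading l_fluct)

lemma conn_first:
  assumes "even i = even j"
  shows "(Dsite i *v l) \<bullet> (T *v fluct j)
    = 4 * q * ((a + b) * (a + b) * q - 2 * a * b * h) / (A * B * B * h)"
proof (cases "even j")
  case True
  show ?thesis
    unfolding site_even[OF fluct_subleading True[folded assms]] fluct_even[OF True]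
    by (simp add: divide_simps) (simp only: polys, algebra)
next
  case False
  then have "odd i" using assms by simp
  have e: "2 * q / B * (2 * u / (A * B * h)) = 4 * q * u / (A * B * B * h)" for u
    by (simp add: mult_ac)
  show ?thesis
    unfolding site_odd[OF fluct_subleading \<open>odd i\<close>] fluct_odd[OF False]
    by (rule e)
qed

text \<open>The numerator as it arises on the even sublattice; on the odd one it agrees once
  everything is expressed through \<open>lam\<close> and \<open>mu\<close>.\<close>

definition second :: real where
  "second = mu * a * a * a * (a * q - b * (a + b)) - lam * b * b * b * (a * (a + b) - b * q)
    + a * b * (lam - mu) * ((a * q - b * (a + b)) + (a * (a + b) - b * q))"

lemma conn_second:
  assumes "even i = even j"
  shows "(Dsite i *v l) \<bullet> (T *v (T *v fluct j)) = 4 * q * second / (A * A * B * B * B * h)"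
proof (cases "even j")
  case True
  then have i: "even i" using assms by simp
  show ?thesis
    unfolding site_even[OF T_subleading'[OF fluct_subleading] i] T_coords[OF fluct_subleading]
      fluct_even[OF True] N11_def N14_def N41_def N44_def second_def
    by (simp add: divide_simps) algebra
next
  case False
  then have i: "odd i" using assms by simp
  show ?thesis
    unfolding site_odd[OF T_subleading'[OF fluct_subleading] i] T_coords[OF fluct_subleading]
      fluct_odd[OF False] N11_def N14_def second_def
    by (simp add: divide_simps) (simp only: polys, algebra)
qed

lemma Dsite_idem: "Dsite j *v (Dsite j *v v) = Dsite j *v v"
  by (auto simp: vec_eq_iff forall_4 Dsite_eq diag4_mult site_diag_def)

text \<open>At \<open>k = 0\<close> the claim rests on the idempotence of \<open>Dsite\<close> and
  the equality of the densities. From \<open>k = 1\<close> on, both sequences obey one recurrence,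
  with the same two initial values.\<close>

lemma conn_even_odd:
  assumes "even i" "odd j"
  shows "conn i i k = conn j j k"
proof (cases k)
  case 0
  have "(Dsite j *v l) \<bullet> (Dsite j *v r) = rho j * (l \<bullet> r)" for j
    using l_r_pos Dsite_idem[of j r] by (simp add: Dsite_eq rho_def flip: inner_diag4)
  then show ?thesis by (simp add: 0 conn_def rho_eq)
next
  case (Suc d)
  define c where "c j d = (Dsite j *v l) \<bullet> (matpow T d *v (T *v fluct j))" for j d
  have "c i d = c j d \<and> c i (Suc d) = c j (Suc d)"
  proof (induction d)
    case 0
    show ?case
      by (simp add: c_def conn_first matpow_Suc_left conn_second del: matpow.simps(2))
  next
    case (Suc d)
    have "c j (Suc (Suc d)) = tr * c j (Suc d) - dt * c j d" for j
      unfolding c_def by (rule inner_recurrence[OF fluct_subleading])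
    then show ?case using Suc by simp
  qed
  then show ?thesis
    by (simp add: Suc conn_eq c_def matpow_Suc_right del: matpow.simps(2))
qed

lemma fluct_dominant:
  assumes gen: "generic_driving lam mu"
  shows "\<not> (\<lambda>k. (Dsite 0 *v l) \<bullet> (matpow T k *v (T *v fluct 0)) / \<theta> ^ k) \<longlonglongrightarrow> 0"
proof -
  define y where "y = T *v fluct 0"
  define c where "c k = (Dsite 0 *v l) \<bullet> (matpow T k *v y)" for k
  have y: "y \<in> subleading" unfolding y_def by (rule fluct_subleading)
  have c0: "c 0 = 4 * q * ((a + b) * (a + b) * q - 2 * a * b * h) / (A * B * B * h)"
    by (simp add: c_def y_def conn_first)
  have c1: "c 1 = 4 * q * second / (A * A * B * B * B * h)"
    by (simp add: c_def y_def conn_second One_nat_def matpow_Suc_left del: matpow.simps(2))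
  have "\<not> (\<lambda>k. c k / \<theta> ^ k) \<longlonglongrightarrow> 0"
  proof (cases "lam = mu")
    case True
    have ab: "b = a" unfolding a_def b_def using True by simp
    have "(a + b) * (a + b) * q - 2 * a * b * h = - 2 * lam * a * a * a"
    proof -
      have q': "q = 4 - lam * lam" unfolding q_def using True by simp
      show ?thesis unfolding h_def ab q' a_def by algebra
    qed
    moreover have "lam \<noteq> 0" using gen True by (auto simp: generic_driving_def)
    ultimately have ne: "c 0 \<noteq> 0" by (simp add: c0)
    have "\<bar>c k / \<theta> ^ k\<bar> = \<bar>c 0\<bar>" for k
      using theta_pos[OF gen]
      by (simp add: c_def matpow_equal[OF y True] theta_equal[OF True] abs_mult power_abs)
    moreover have "(\<lambda>k. \<bar>c k / \<theta> ^ k\<bar>) \<longlonglongrightarrow> 0" if "(\<lambda>k. c k / \<theta> ^ k) \<longlonglongrightarrow> 0"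
      using tendsto_rabs[OF that] by simp
    ultimately show ?thesis using ne by (auto simp: LIMSEQ_const_iff)
  next
    case False
    obtain z w where zw: "z + w = of_real tr" "z * w = of_real dt" "cmod z = \<theta>"
    proof (cases "cmod (tau lam mu 3) \<le> cmod (tau lam mu 2)")
      case True
      then show ?thesis
        by (intro that[of "tau lam mu 2" "tau lam mu 3"] tau_sum tau_prod) (simp add: theta_max)
    next
      case False
      then show ?thesis
        using tau_sum tau_prod
        by (intro that[of "tau lam mu 3" "tau lam mu 2"])
           (simp_all add: theta_max add.commute mult.commute)
    qed
    have z: "z \<noteq> 0" using zw theta_pos[OF gen] by auto
    have rec: "complex_of_real (c (Suc (Suc k))) = (z + w) * c (Suc k) - z * w * c k" for k
      unfolding c_def by (rule inner_recurrence_complex[OF y zw(1,2)])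
    have "complex_of_real (c 1) \<noteq> w * c 0"
    proof
      assume c: "complex_of_real (c 1) = w * c 0"
      show False
      proof (cases "kap = 0")
        case True
        \<comment> \<open>The determinant vanishes and \<open>z\<close> is the nonzero root, so the
          sequence is geometric from its second term on, and it remains to see that this term is not
          0.\<close>
        then have "w = 0" using zw z by (simp add: dt_eq)
        then have "c 1 = 0" using c by simp
        then have "second = 0" by (simp add: c1)
        moreover have "second = (a + b) * (a + b) * (lam - mu) * (lam - mu) * (lam * mu)"
          using True params unfolding kap_def second_def by algebra
        ultimately have "lam * mu = 0"
          using False less_imp_neq[OF add_pos_pos[OF pos(1,2)]] by auto
        then have "lam = 0 \<and> mu = 0" by (rule lam_mu_zero[OF True])
        then show False using False by blast
      next
        case kap: False
        \<comment> \<open>If \<open>z\<close> did not contribute, the first three terms would be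
          geometric with ratio \<open>w\<close>, and their Hankel determinant would vanish.\<close>
        have "complex_of_real (c 2) = (z + w) * of_real (c 1) - z * w * of_real (c 0)"
          using rec[of 0] by (simp add: numeral_2_eq_2 One_nat_def)
        then have "complex_of_real (c 0) * of_real (c 2) = of_real (c 1) * of_real (c 1)"
          using c by algebra
        then have "complex_of_real (c 0 * c 2) = complex_of_real (c 1 * c 1)"
          by (simp only: of_real_mult)
        then have "c 0 * c 2 = c 1 * c 1" by (simp only: of_real_eq_iff)
        moreover have "c 2 = tr * c 1 - dt * c 0"
          using inner_recurrence[OF y, of "Dsite 0 *v l" 0]
          by (simp add: c_def numeral_2_eq_2 One_nat_def)
        ultimately have "c 0 * (tr * c 1 - dt * c 0) - c 1 * c 1 = 0" by simp
        moreover have "c 0 * (tr * c 1 - dt * c 0) - c 1 * c 1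
          = - (16 * q * q * a * a * b * b * (lam - mu) * (lam - mu) * kap * kap * kap
              / (A * A * A * A * B * B * B * B * B * B * h))"
          unfolding c0 c1 tr_def N11_def N44_def dt_eq power2_eq_square second_def
          by (simp add: divide_simps) (simp only: polys kap_def, algebra)
        ultimately show False using False kap by simp
      qed
    qed
    then show ?thesis
      using recurrence_not_vanishing[of c z w, OF rec _ z] zw(3) by simp
  qed
  then show ?thesis by (simp add: c_def y_def)
qed

end

section \<open>Eigenvalue decomposition\<close>

lemma bdot_cvec: "bdot (cvec u) (cvec v) = of_real (u \<bullet> v)"
  by (simp add: bdot_def cvec_def inner_vec_def)

text \<open>\<open>1 \<le> d\<close> is essential: the three terms have rank at most three, while
  the power 0 is the identity.\<close>

lemma matpow_eigen:
  assumes dec: "eigen_decomposition lam mu \<phi> \<psi>" and d: "1 \<le> d"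
  shows "of_real (matpow (Tmat lam mu) d $ i $ j) = (\<Sum>\<nu>=1..3. tau lam mu \<nu> ^ d * \<psi> \<nu> $ i * \<phi> \<nu> $ j)"
  using d
proof (induction d arbitrary: i j rule: nat_induct_at_least)
  case base
  have "matpow (Tmat lam mu) 1 = Tmat lam mu" by (simp add: One_nat_def)
  then show ?case using dec by (simp add: eigen_decomposition_def)
next
  case (Suc d)
  let ?t = "tau lam mu"
  have orth: "(\<Sum>k\<in>UNIV. \<phi> \<nu> $ k * \<psi> \<nu>' $ k) = of_bool (\<nu> = \<nu>')" if "\<nu> \<in> {1..3}" "\<nu>' \<in> {1..3}" for \<nu> \<nu>'
    using dec that by (simp add: eigen_decomposition_def bdot_def)
  have "of_real (matpow (Tmat lam mu) (Suc d) $ i $ j)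
    = (\<Sum>k\<in>UNIV. of_real (Tmat lam mu $ i $ k) * of_real (matpow (Tmat lam mu) d $ k $ j))"
    by (simp add: matrix_matrix_mult_def)
  also have "\<dots> = (\<Sum>k\<in>UNIV. (\<Sum>\<nu>=1..3. ?t \<nu> * \<psi> \<nu> $ i * \<phi> \<nu> $ k) * (\<Sum>\<nu>'=1..3. ?t \<nu>' ^ d * \<psi> \<nu>' $ k * \<phi> \<nu>' $ j))"
    using dec Suc.IH by (simp add: eigen_decomposition_def)
  also have "\<dots> = (\<Sum>k\<in>UNIV. \<Sum>\<nu>=1..3. \<Sum>\<nu>'=1..3.
      ?t \<nu> * \<psi> \<nu> $ i * ?t \<nu>' ^ d * \<phi> \<nu>' $ j * (\<phi> \<nu> $ k * \<psi> \<nu>' $ k))"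
    by (simp add: sum_product mult_ac)
  also have "\<dots> = (\<Sum>\<nu>=1..3. \<Sum>k\<in>UNIV. \<Sum>\<nu>'=1..3.
      ?t \<nu> * \<psi> \<nu> $ i * ?t \<nu>' ^ d * \<phi> \<nu>' $ j * (\<phi> \<nu> $ k * \<psi> \<nu>' $ k))"
    by (rule sum.swap)
  also have "\<dots> = (\<Sum>\<nu>=1..3. \<Sum>\<nu>'=1..3. \<Sum>k\<in>UNIV.
      ?t \<nu> * \<psi> \<nu> $ i * ?t \<nu>' ^ d * \<phi> \<nu>' $ j * (\<phi> \<nu> $ k * \<psi> \<nu>' $ k))"
    by (rule sum.cong[OF refl]) (rule sum.swap)
  also have "\<dots> = (\<Sum>\<nu>=1..3. \<Sum>\<nu>'=1..3.
      ?t \<nu> * \<psi> \<nu> $ i * ?t \<nu>' ^ d * \<phi> \<nu>' $ j * of_bool (\<nu> = \<nu>'))"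
    by (intro sum.cong refl) (simp only: sum_distrib_left[symmetric] orth)
  also have "\<dots> = (\<Sum>\<nu>=1..3. ?t \<nu> ^ Suc d * \<psi> \<nu> $ i * \<phi> \<nu> $ j)"
    by (intro sum.cong refl) (simp add: of_bool_def if_distrib[of "\<lambda>z. _ * z"] cong: if_cong)
  finally show ?case .
qed

lemma inner_matpow_eigen:
  assumes "eigen_decomposition lam mu \<phi> \<psi>" "1 \<le> d"
  shows "of_real (u \<bullet> (matpow (Tmat lam mu) d *v v))
    = (\<Sum>\<nu>=1..3. tau lam mu \<nu> ^ d * (bdot (cvec u) (\<psi> \<nu>) * bdot (\<phi> \<nu>) (cvec v)))"
proof -
  let ?t = "tau lam mu"
  have "complex_of_real (u \<bullet> (matpow (Tmat lam mu) d *v v))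
    = (\<Sum>i\<in>UNIV. \<Sum>j\<in>UNIV. of_real (u $ i) * of_real (matpow (Tmat lam mu) d $ i $ j) * of_real (v $ j))"
    by (simp add: inner_vec_def matrix_vector_mult_def sum_distrib_left mult.assoc)
  also have "\<dots> = (\<Sum>i\<in>UNIV. \<Sum>j\<in>UNIV. \<Sum>\<nu>=1..3.
      ?t \<nu> ^ d * ((of_real (u $ i) * \<psi> \<nu> $ i) * (\<phi> \<nu> $ j * of_real (v $ j))))"
    unfolding matpow_eigen[OF assms] by (simp add: sum_distrib_left sum_distrib_right mult_ac)
  also have "\<dots> = (\<Sum>i\<in>UNIV. \<Sum>\<nu>=1..3. \<Sum>j\<in>UNIV.
      ?t \<nu> ^ d * ((of_real (u $ i) * \<psi> \<nu> $ i) * (\<phi> \<nu> $ j * of_real (v $ j))))"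
    by (rule sum.cong[OF refl]) (rule sum.swap)
  also have "\<dots> = (\<Sum>\<nu>=1..3. \<Sum>i\<in>UNIV. \<Sum>j\<in>UNIV.
      ?t \<nu> ^ d * ((of_real (u $ i) * \<psi> \<nu> $ i) * (\<phi> \<nu> $ j * of_real (v $ j))))"
    by (rule sum.swap)
  also have "\<dots> = (\<Sum>\<nu>=1..3. ?t \<nu> ^ d * (bdot (cvec u) (\<psi> \<nu>) * bdot (\<phi> \<nu>) (cvec v)))"
    unfolding bdot_def cvec_def vec_lambda_beta sum_product by (simp only: sum_distrib_left)
  finally show ?thesis .
qed

context driving
begin

lemma conn_cong: "even i = even i' \<Longrightarrow> even j = even j' \<Longrightarrow> conn i j k = conn i' j' k"
  by (simp add: conn_def rho_def Dsite_def)

text \<open>The term of the leading eigenvalue equals the product of the densities and cancels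
  against it.\<close>

lemma conn_eigen:
  assumes dec: "eigen_decomposition lam mu \<phi> \<psi>" and d: "1 \<le> d" and ij: "even i" "even j"
  shows "of_real (conn i j d)
    = bdot (cvec (De *v l)) (\<psi> 2) * bdot (\<phi> 2) (cvec (De *v r)) / of_real (l \<bullet> r)
        * (tau lam mu 2 / tau lam mu 1) ^ d
    + bdot (cvec (De *v l)) (\<psi> 3) * bdot (\<phi> 3) (cvec (De *v r)) / of_real (l \<bullet> r)
        * (tau lam mu 3 / tau lam mu 1) ^ d"
proof -
  define c where "c \<nu> = bdot (cvec (De *v l)) (\<psi> \<nu>) * bdot (\<phi> \<nu>) (cvec (De *v r))" for \<nu>
  define L where "L = complex_of_real (l \<bullet> r)"
  define t where "t = complex_of_real \<tau>1"
  have L: "L \<noteq> 0" and t: "t \<noteq> 0" using l_r_pos tau1_pos by (auto simp: L_def t_def)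
  have D: "Dsite i = De" "Dsite j = De" using ij by (simp_all add: Dsite_def)
  have rho: "(De *v l) \<bullet> r = rho i * (l \<bullet> r)" "l \<bullet> (De *v r) = rho i * (l \<bullet> r)"
    using l_r_pos by (simp_all add: rho_def D De_def flip: inner_diag4)
  have s: "sqrt (l \<bullet> r) * sqrt (l \<bullet> r) = l \<bullet> r" "sqrt (l \<bullet> r) \<noteq> 0" using l_r_pos by auto
  have "c 1 = of_real (rho i * rho i * (l \<bullet> r))"
  proof -
    have p: "\<phi> 1 = cvec ((1 / sqrt (l \<bullet> r)) *\<^sub>R l)" "\<psi> 1 = cvec ((1 / sqrt (l \<bullet> r)) *\<^sub>R r)"
      using dec unfolding eigen_decomposition_def by blast+
    have "c 1 = of_real ((De *v l) \<bullet> ((1 / sqrt (l \<bullet> r)) *\<^sub>R r) * (((1 / sqrt (l \<bullet> r)) *\<^sub>R l) \<bullet> (De *v r)))"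
      unfolding c_def p bdot_cvec by (simp only: of_real_mult)
    also have "(De *v l) \<bullet> ((1 / sqrt (l \<bullet> r)) *\<^sub>R r) * (((1 / sqrt (l \<bullet> r)) *\<^sub>R l) \<bullet> (De *v r))
      = ((De *v l) \<bullet> r) * (l \<bullet> (De *v r)) / (sqrt (l \<bullet> r) * sqrt (l \<bullet> r))"
      by (simp only: inner_scaleR_right inner_scaleR_left times_divide_eq_left times_divide_eq_right
          divide_divide_eq_left mult_1_left)
    also have "\<dots> = rho i * rho i * (l \<bullet> r)"
      unfolding rho s(1) using l_r_pos by simp
    finally show ?thesis .
  qed
  then have c1: "c 1 = of_real (rho i) * of_real (rho i) * L" by (simp add: L_def)
  have t1: "tau lam mu 1 = t" by (simp add: tau_def t_def)
  have "{1..3::nat} = {1, 2, 3}" by auto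
  then have "of_real ((De *v l) \<bullet> (matpow T d *v (De *v r)))
    = t ^ d * c 1 + tau lam mu 2 ^ d * c 2 + tau lam mu 3 ^ d * c 3"
    unfolding inner_matpow_eigen[OF dec d] c_def[symmetric] by (simp add: t1)
  then have "of_real (conn i j d)
    = (t ^ d * c 1 + tau lam mu 2 ^ d * c 2 + tau lam mu 3 ^ d * c 3) / (t ^ d * L)
      - of_real (rho i) * of_real (rho i)"
    unfolding conn_def D l_matpow rho_eq[of i] rho_eq[of j] by (simp add: t_def L_def)
  also have "\<dots> = c 2 / L * (tau lam mu 2 / t) ^ d + c 3 / L * (tau lam mu 3 / t) ^ d"
    using L t by (simp add: c1 add_divide_distrib power_divide mult.commute)
  finally show ?thesis by (simp add: c_def L_def t1)
qed

end

section \<open>Dependence on the distance\<close>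

text \<open>Sites 0 and 1 merely represent the two parities. The last argument of
  \<open>conn\<close> counts the factors of the transfer matrix between sites \<open>0\<close> and
  \<open>d\<close>, or \<open>1\<close> and \<open>Suc d\<close>.\<close>

definition corr_fun :: "bool \<Rightarrow> real \<Rightarrow> real \<Rightarrow> nat \<Rightarrow> real" where
  "corr_fun ev lam mu d =
     (if ev then driving.conn lam mu 0 d (d div 2)
      else driving.conn lam mu 1 (Suc d) (Suc d div 2))"

context driving
begin

lemma corr_fun_even: "even d \<Longrightarrow> corr_fun ev lam mu d = conn 0 0 (d div 2)"
  using conn_even_odd[of 0 1 "d div 2"] conn_cong[of 0 0 d 0] conn_cong[of 1 1 "Suc d" 1]
  by (auto simp: corr_fun_def)

lemma corr_fun_eq_conn:
  assumes "j \<le> j'"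
  shows "conn j j' (j' div 2 - j div 2) = corr_fun (even j) lam mu (j' - j)"
proof -
  obtain d where j': "j' = j + d" using assms le_Suc_ex by blast
  show ?thesis
  proof (cases "even j")
    case True
    then obtain c where c: "j = 2 * c" by (rule evenE)
    have "(d + 2 * c) div 2 = c + d div 2" by (rule div_mult_self2) simp
    then have k: "j' div 2 - j div 2 = d div 2" by (simp add: j' c add.commute)
    have "conn j j' (d div 2) = conn 0 d (d div 2)"
      by (rule conn_cong) (simp_all add: j' c)
    then show ?thesis unfolding k using True by (simp add: corr_fun_def j')
  next
    case False
    then obtain c where c: "j = 2 * c + 1" by (rule oddE)
    have "(Suc d + 2 * c) div 2 = c + Suc d div 2" by (rule div_mult_self2) simp
    then have k: "j' div 2 - j div 2 = Suc d div 2" by (simp add: j' c add.commute)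
    have "conn j j' (Suc d div 2) = conn 1 (Suc d) (Suc d div 2)"
      by (rule conn_cong) (simp_all add: j' c)
    then show ?thesis unfolding k using False by (simp add: corr_fun_def j')
  qed
qed

text \<open>The decay factor per site; the square root appears because one transfer matrix advances
  by two sites.\<close>

definition decay :: real where "decay = sqrt (\<theta> / \<tau>1)"

context
  assumes gen: "generic_driving lam mu"
begin

lemma decay: "0 < decay" "decay < 1" "decay ^ 2 = \<theta> / \<tau>1"
  using theta_pos[OF gen] theta_less tau1_pos by (simp_all add: decay_def)

lemma corr_scale_pos: "0 < corr_scale lam mu"
  and exp_corr_scale: "exp (- (real d / 2) / corr_scale lam mu) = decay ^ d"
proof -
  have c: "cmod (tau lam mu 1 / tau_sub lam mu) = \<tau>1 / \<theta>"
    using tau1_pos by (simp add: norm_divide tau_def \<theta>_def)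
  have "1 < \<tau>1 / \<theta>" using theta_pos[OF gen] theta_less by simp
  then show "0 < corr_scale lam mu" by (simp add: corr_scale_def c)
  have "ln (\<tau>1 / \<theta>) = - ln (decay ^ 2)"
    using theta_pos[OF gen] tau1_pos by (simp add: decay(3) ln_div)
  also have "\<dots> = - 2 * ln decay" using decay(1) by (simp add: ln_realpow)
  finally have "- (real d / 2) / corr_scale lam mu = real d * ln decay"
    by (simp add: corr_scale_def c)
  then show "exp (- (real d / 2) / corr_scale lam mu) = decay ^ d"
    using decay(1) by (simp add: exp_of_nat_mult)
qed

lemma corr_fun_bigo: "corr_fun ev lam mu \<in> O(\<lambda>d. exp (- (real d / 2) / corr_scale lam mu))"
proof -
  have "\<exists>K. \<forall>k. \<bar>conn i j k\<bar> \<le> K * decay ^ (2 * k)" for i j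
    unfolding power_mult decay(3) by (rule conn_bound[OF gen])
  then obtain K where K: "\<bar>conn i j k\<bar> \<le> K i j * decay ^ (2 * k)" for i j k by metis
  define M where "M = \<bar>K 0 0\<bar> + \<bar>K 0 1\<bar> + \<bar>K 1 0\<bar> + \<bar>K 1 1\<bar>"
  \<comment> \<open>Rounding the distance to whole cells costs at most one site, hence the condition
    on \<open>d\<close> and the factor \<open>1 / decay\<close>.\<close>
  have bound: "\<bar>conn i j k\<bar> \<le> M / decay * decay ^ d" if "d \<le> 2 * k + 1" for i j k d
  proof -
    define i' j' where "i' = i mod 2" and "j' = j mod (2::nat)"
    have "conn i j k = conn i' j' k" by (rule conn_cong) (simp_all add: i'_def j'_def)
    moreover have "(i' = 0 \<or> i' = 1) \<and> (j' = 0 \<or> j' = 1)" by (auto simp: i'_def j'_def)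
    then have "K i' j' \<le> M" by (auto simp: M_def)
    then have "K i' j' * decay ^ (2 * k) \<le> M * decay ^ (2 * k)"
      using decay(1) by (intro mult_right_mono) auto
    moreover have "M * decay ^ (2 * k) \<le> M / decay * decay ^ d"
    proof -
      have "decay * decay ^ (2 * k) \<le> decay ^ d"
        using power_decreasing[OF that, of decay] decay(1,2) by (simp add: power_add mult.commute)
      then have "decay ^ (2 * k) \<le> decay ^ d / decay"
        using decay(1) by (simp add: field_simps)
      then have "M * decay ^ (2 * k) \<le> M * (decay ^ d / decay)"
        by (intro mult_left_mono) (auto simp: M_def)
      then show ?thesis by simp
    qed
    ultimately show ?thesis using K[of i' j' k] by linarith
  qed
  have "norm (corr_fun ev lam mu d) \<le> M / decay * norm (exp (- (real d / 2) / corr_scale lam mu))" for d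
  proof -
    have "\<bar>conn 0 d (d div 2)\<bar> \<le> M / decay * decay ^ d"
      "\<bar>conn 1 (Suc d) (Suc d div 2)\<bar> \<le> M / decay * decay ^ d"
      by (rule bound, presburger)+
    then show ?thesis
      unfolding exp_corr_scale corr_fun_def using decay(1) by (cases ev) simp_all
  qed
  then show ?thesis by (intro bigoI[of _ "M / decay"] always_eventually allI)
qed

text \<open>Positive even distances suffice: there the ratio is, up to a nonzero constant, the
  sequence of \<open>fluct_dominant\<close>.\<close>

lemma corr_fun_not_smallo: "corr_fun ev lam mu \<notin> o(\<lambda>d. exp (- (real d / 2) / corr_scale lam mu))"
proof
  assume "corr_fun ev lam mu \<in> o(\<lambda>d. exp (- (real d / 2) / corr_scale lam mu))"
  then have "(\<lambda>d. corr_fun ev lam mu d / decay ^ d) \<longlonglongrightarrow> 0"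
    unfolding exp_corr_scale by (rule smalloD_tendsto)
  moreover have "filterlim (\<lambda>k. 2 * Suc k) at_top sequentially"
    by (rule filterlim_subseq) (simp add: strict_mono_def)
  ultimately have "(\<lambda>k. corr_fun ev lam mu (2 * Suc k) / decay ^ (2 * Suc k)) \<longlonglongrightarrow> 0"
    by (rule filterlim_compose)
  then have "(\<lambda>k. \<theta> * (l \<bullet> r) * (corr_fun ev lam mu (2 * Suc k) / decay ^ (2 * Suc k))) \<longlonglongrightarrow> 0"
    by (rule tendsto_mult_right_zero)
  moreover have "\<theta> * (l \<bullet> r) * (corr_fun ev lam mu (2 * Suc k) / decay ^ (2 * Suc k))
    = (Dsite 0 *v l) \<bullet> (matpow T k *v (T *v fluct 0)) / \<theta> ^ k" for k
  proof -
    have "2 * Suc k div 2 = Suc k" by (rule nonzero_mult_div_cancel_left) simp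
    then have "corr_fun ev lam mu (2 * Suc k) = conn 0 0 (Suc k)"
      using corr_fun_even[OF dvd_triv_left, of ev "Suc k"] by (simp only:)
    moreover have "decay ^ (2 * Suc k) = \<theta> ^ Suc k / \<tau>1 ^ Suc k"
      unfolding power_mult decay(3) by (rule power_divide)
    ultimately show ?thesis
      using l_r_pos tau1_pos theta_pos[OF gen]
      by (simp add: conn_eq matpow_Suc_right del: matpow.simps(2))
  qed
  ultimately show False using fluct_dominant[OF gen] by simp
qed

end

end

context chain
begin

lemma conn_corr_sym: "conn_corr n p j j' = conn_corr n p j' j"
  by (simp add: conn_corr_def corr2_def mult_ac)

lemma conn_corr_eq:
  assumes p: "steady_state m \<alpha> \<beta> \<gamma> \<delta> p" and j: "1 < j" "j \<le> j'" "j' < n"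
  shows "conn_corr n p j j' = conn j j' (j' div 2 - j div 2)"
proof (cases "j = j'")
  case True
  \<comment> \<open>Occupation numbers are idempotent; this covers distance 0.\<close>
  have "corr2 n p j j = density n p j"
    unfolding corr2_def density_def by (rule sum.cong) auto
  also have "\<dots> = (Dsite j *v l) \<bullet> (Dsite j *v r) / (l \<bullet> r)"
    using j density_eq[OF p, of j] Dsite_idem[of j r] True by (simp add: Dsite_eq flip: inner_diag4)
  finally show ?thesis
    using j True by (simp add: conn_corr_def conn_def rho_def density_eq[OF p])
next
  case False
  then show ?thesis
    using j by (simp add: conn_corr_def conn_def rho_def density_eq[OF p] corr2_eq[OF p])
qed

lemma conn_corr_eq_corr_fun:
  assumes p: "steady_state m \<alpha> \<beta> \<gamma> \<delta> p" and j: "1 < j" "j < n" "1 < j'" "j' < n"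
  shows "conn_corr n p j j' = corr_fun (even (min j j')) lam mu (nat \<bar>int j - int j'\<bar>)"
proof (cases "j \<le> j'")
  case True
  moreover have "nat \<bar>int j - int j'\<bar> = j' - j" using True by simp
  ultimately show ?thesis using j by (simp add: conn_corr_eq[OF p] corr_fun_eq_conn min_def)
next
  case False
  moreover have "nat \<bar>int j - int j'\<bar> = j - j'" using False by simp
  ultimately show ?thesis
    using j conn_corr_sym[of p j j'] by (simp add: conn_corr_eq[OF p] corr_fun_eq_conn min_def)
qed

end

lemma chainI:
  assumes "2 \<le> m \<and> {\<alpha>, \<beta>, \<gamma>, \<delta>} \<subseteq> {0<..<1} \<and> steady_state m \<alpha> \<beta> \<gamma> \<delta> p"
  shows "chain (\<alpha> - \<beta>) (\<gamma> - \<delta>) \<alpha> \<beta> \<gamma> \<delta> m"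
  using assms by unfold_locales auto

theorem mainTheorem4:
  shows
    "(\<forall>(m::nat) \<alpha> \<beta> \<gamma> \<delta> p.
        2 \<le> m \<and> {\<alpha>, \<beta>, \<gamma>, \<delta>} \<subseteq> {0<..<1} \<and> steady_state m \<alpha> \<beta> \<gamma> \<delta> p \<longrightarrow>
        (let n = 2 * m; lam = \<alpha> - \<beta>; mu = \<gamma> - \<delta>;
             T = Tmat lam mu; l = lvec lam mu; r = rvec lam mu
         in
           (\<forall>j j'. 1 < j \<and> j < j' \<and> j' < n \<longrightarrow>
              corr2 n p j j' =
                ((Dsite j *v l) \<bullet> (matpow T (j' div 2 - j div 2) *v (Dsite j' *v r))) /
                (l \<bullet> (matpow T (j' div 2 - j div 2) *v r))) \<and>
           (\<forall>\<phi> \<psi>. eigen_decomposition lam mu \<phi> \<psi> \<longrightarrow>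
              (\<forall>k k'. 1 \<le> k \<and> k < k' \<and> k' \<le> m - 1 \<longrightarrow>
                 complex_of_real (conn_corr n p (2 * k) (2 * k')) =
                   bdot (cvec (De *v l)) (\<psi> 2) * bdot (\<phi> 2) (cvec (De *v r)) / of_real (l \<bullet> r)
                     * (tau lam mu 2 / tau lam mu 1) ^ (k' - k) +
                   bdot (cvec (De *v l)) (\<psi> 3) * bdot (\<phi> 3) (cvec (De *v r)) / of_real (l \<bullet> r)
                     * (tau lam mu 3 / tau lam mu 1) ^ (k' - k)))))
     \<and>
     (\<exists>F :: bool \<Rightarrow> real \<Rightarrow> real \<Rightarrow> nat \<Rightarrow> real.
        (\<forall>(m::nat) \<alpha> \<beta> \<gamma> \<delta> p.
           2 \<le> m \<and> {\<alpha>, \<beta>, \<gamma>, \<delta>} \<subseteq> {0<..<1} \<and> steady_state m \<alpha> \<beta> \<gamma> \<delta> p \<longrightarrow>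
           (\<forall>j j'. 1 < j \<and> j < 2 * m \<and> 1 < j' \<and> j' < 2 * m \<longrightarrow>
              conn_corr (2 * m) p j j' =
                F (even (min j j')) (\<alpha> - \<beta>) (\<gamma> - \<delta>) (nat \<bar>int j - int j'\<bar>))) \<and>
        (\<forall>lam\<in>{-1<..<1}. \<forall>mu\<in>{-1<..<1}. \<forall>d. even d \<longrightarrow> F True lam mu d = F False lam mu d) \<and>
        (\<forall>lam\<in>{-1<..<1}. \<forall>mu\<in>{-1<..<1}. generic_driving lam mu \<longrightarrow>
           0 < corr_scale lam mu \<and>
           (\<forall>b. F b lam mu \<in> O(\<lambda>d. exp (- (real d / 2) / corr_scale lam mu)) \<and>
                F b lam mu \<notin> o(\<lambda>d. exp (- (real d / 2) / corr_scale lam mu)))))"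
proof (rule conjI, goal_cases)
  case 1
  show ?case
  proof (intro allI impI, goal_cases)
    case (1 m \<alpha> \<beta> \<gamma> \<delta> p)
    interpret chain "\<alpha> - \<beta>" "\<gamma> - \<delta>" \<alpha> \<beta> \<gamma> \<delta> m
      using 1 by (rule chainI)
    have p: "steady_state m \<alpha> \<beta> \<gamma> \<delta> p" using 1 by blast
    have eigen: "complex_of_real (conn_corr n p (2 * k) (2 * k'))
      = bdot (cvec (De *v l)) (\<psi> 2) * bdot (\<phi> 2) (cvec (De *v r)) / of_real (l \<bullet> r)
          * (tau (\<alpha> - \<beta>) (\<gamma> - \<delta>) 2 / tau (\<alpha> - \<beta>) (\<gamma> - \<delta>) 1) ^ (k' - k)
        + bdot (cvec (De *v l)) (\<psi> 3) * bdot (\<phi> 3) (cvec (De *v r)) / of_real (l \<bullet> r)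
          * (tau (\<alpha> - \<beta>) (\<gamma> - \<delta>) 3 / tau (\<alpha> - \<beta>) (\<gamma> - \<delta>) 1) ^ (k' - k)"
      if "eigen_decomposition (\<alpha> - \<beta>) (\<gamma> - \<delta>) \<phi> \<psi>" "1 \<le> k \<and> k < k' \<and> k' \<le> m - 1" for \<phi> \<psi> k k'
    proof -
      have k: "1 < 2 * k" "2 * k \<le> 2 * k'" "2 * k' < n" "1 \<le> k' - k" using that(2) m by linarith+
      have "2 * k' div 2 - 2 * k div 2 = k' - k" by simp
      then show ?thesis
        using conn_corr_eq[OF p k(1-3)] conn_eigen[OF that(1) k(4), of "2 * k" "2 * k'"] by simp
    qed
    show ?case
      unfolding Let_def using corr2_eq[OF p] eigen by blast
  qed
next
  case 2
  \<comment> \<open>No chain is given here, only a pair of parameters, so the facts are taken from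
    \<open>driving\<close>.\<close>
  have "driving lam mu" if "lam \<in> {-1<..<1}" "mu \<in> {-1<..<1}" for lam mu
    using that by unfold_locales auto
  note facts = driving.corr_fun_even[OF this] driving.corr_scale_pos[OF this]
    driving.corr_fun_bigo[OF this] driving.corr_fun_not_smallo[OF this]
  show ?case
  proof (intro exI[of _ corr_fun] conjI allI impI ballI, goal_cases)
    case (1 m \<alpha> \<beta> \<gamma> \<delta> p j j')
    interpret chain "\<alpha> - \<beta>" "\<gamma> - \<delta>" \<alpha> \<beta> \<gamma> \<delta> m
      using 1(1) by (rule chainI)
    show ?case
      using 1 by (intro conn_corr_eq_corr_fun) auto
  next
    case (2 lam mu d)
    then show ?case by (simp only: facts)
  qed (rule facts; assumption)+
qed

end
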